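(* Let $\Sigma\subset\mathbb{R}^m$ be an $n$-dimensional complete submanifold without boundary which has polynomial volume growth. Suppose that $\Sigma_s$ is a normal variation of $\Sigma$, that $x_s\in\mathbb{R}^m$ and $t_s>0$ are variations of $x_0$ and $t_0$, and that $$\frac{\partial\Sigma_s}{\partial s}=V,\quad\frac{\partial x_s}{\partial s}=y,\quad\frac{\partial t_s}{\partial s}=\tau,\quad\frac{\partial^2x_s}{\partial s^2}=y',\quad\frac{\partial^2t_s}{\partial s^2}=\tau',$$ where $V$ has compact support. Then, with all quantities evaluated at $s=0$, $$\begin{aligned}\frac{\partial^2F}{\partial s^2}(\Sigma,x_0,t_0)=\frac{1}{\sqrt{4\pi t_0}^{\,n}}\int_{\Sigma}e^{-\frac{|X-x_0|^2}{4t_0}}\Big\{&-\langle V,L^{\perp}_{x_0,t_0}V\rangle+\frac{\langle X-x_0,V\rangle}{t_0^2}\tau+\frac{\langle V,y\rangle}{t_0}\\&-\frac{(|X-x_0|^2-nt_0)\tau^2}{2t_0^3}-\frac{|y|^2}{2t_0}-\frac{\tau\langle X-x_0,y\rangle}{t_0^2}\\&+\Big(-\Big\langle V,H+\frac{X-x_0}{2t_0}\Big\rangle+\tau\Big(\frac{|X-x_0|^2}{4t_0^2}-\frac{n}{2t_0}\Big)+\Big\langle\frac{X-x_0}{2t_0},y\Big\rangle\Big)^2\\&-\Big\langle\overline{\nabla}_V^{\perp}V,H+\frac{X-x_0}{2t_0}\Big\rangle+\tau'\Big(\frac{|X-x_0|^2}{4t_0^2}-\frac{n}{2t_0}\Big)+\frac{\langle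 X-x_0,y'\rangle}{2t_0}\Big\}d\mu,\end{aligned}$$ where $$L_{x_0,t_0}^{\perp}V=\Delta^{\perp}V+\langle A_{ij},V\rangle g^{ki}g^{jl}A_{kl}+\frac{V}{2t_0}-\frac{1}{2t_0}\nabla^{\perp}_{(X-x_0)^{\top}}V .$$
   Context: $F(\Sigma,x,t)=(4\pi t)^{-n/2}\int_\Sigma e^{-\frac{|X-x|^2}{4t}}d\mu$ for an $n$-dimensional (immersed) submanifold $\Sigma$ with position vector $X:\Sigma\to\mathbb{R}^m$ and induced volume measure $d\mu$, $x\in\mathbb{R}^m$, $t>0$; $\frac{\partial^2F}{\partial s^2}(\Sigma,x_0,t_0)$ denotes $\frac{\partial^2}{\partial s^2}\big|_{s=0}F(\Sigma_s,x_s,t_s)$. A normal variation $\Sigma_s$ of $\Sigma=\Sigma_0$ is a smooth one-parameter family of immersions $X_s$ with $\frac{\partial X_s}{\partial s}=V$ normal to $\Sigma_s$ for every $s$. $\overline\nabla$ is the flat connection of $\mathbb{R}^m$; $\overline\nabla^\perp_VV$ is the normal part of the derivative of $V$ in the variation direction, i.e. of $\frac{\partial V}{\partial s}=\frac{\partial^2X_s}{\partial s^2}$. $v^\top,v^\perp$ are tangential and normal projections of $v$, $g$ is the induced metric, $\nabla^\perp$ the normal connection, $\Delta^\perp$ the associated Laplacian on normal fields, $A_{ij}=(\overline\nabla_{e_i}e_j)^\perp$ the second fundamental form in a tangent frame $\{e_i\}$ and $H=g^{ij}A_{ij}$ the mean curvature vector (repeated indices summed). $\Sigma$ has polynomial volume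 growth if there are constants $C_1,C_2$ and $k\in\mathbb{N}$ with $\mathrm{Vol}(B_r(0)\cap\Sigma)\le C_1r^k+C_2$ for all $r\ge0$, $B_r(0)$ being the ball of radius $r$ in $\mathbb{R}^m$. *)

theory Defs
  imports "HOL-Analysis.Analysis"
begin

section \<open>Smooth maps between Euclidean spaces\<close>

text \<open>These notions are only used on open sets \<open>S\<close>.\<close>

primrec Ck_on :: "nat \<Rightarrow> 'a::euclidean_space set \<Rightarrow> ('a \<Rightarrow> 'b::real_normed_vector) \<Rightarrow> bool" where
  "Ck_on 0 S f \<longleftrightarrow> continuous_on S f"
| "Ck_on (Suc k) S f \<longleftrightarrow>
     (\<forall>x\<in>S. f differentiable (at x)) \<and> (\<forall>v. Ck_on k S (\<lambda>x. frechet_derivative f (at x) v))"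

definition smooth_on :: "'a::euclidean_space set \<Rightarrow> ('a \<Rightarrow> 'b::real_normed_vector) \<Rightarrow> bool" where
  "smooth_on S f \<longleftrightarrow> (\<forall>k. Ck_on k S f)"


section \<open>Manifolds\<close>

text \<open>
  The manifold underlying an \<open>n\<close>-dimensional immersed submanifold is a Hausdorff, second countable
  type \<open>'p\<close> with an atlas of smooth local parametrisations \<open>\<phi> : D \<rightarrow> 'p\<close>, where \<open>D\<close> is an open
  subset of \<open>\<real>\<^sup>n\<close>; here \<open>n = CARD('n)\<close>. A chart is the pair \<open>(D, \<phi>)\<close>, and \<open>\<phi>\<close> is irrelevant
  outside \<open>D\<close>. As the domains are open subsets of \<open>\<real>\<^sup>n\<close>, there is no boundary.
\<close>

type_synonym ('n, 'p) chart = "(real^'n) set \<times> (real^'n \<Rightarrow> 'p)"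

definition smooth_atlas ::
    "('n::finite, 'p::{t2_space, second_countable_topology}) chart set \<Rightarrow> bool" where
  "smooth_atlas A \<longleftrightarrow>
     (\<forall>(D, \<phi>)\<in>A. open D \<and> open (\<phi> ` D) \<and> homeomorphism D (\<phi> ` D) \<phi> (inv_into D \<phi>)) \<and>
     (\<Union>(D, \<phi>)\<in>A. \<phi> ` D) = UNIV \<and>
     (\<forall>(D, \<phi>)\<in>A. \<forall>(E, \<psi>)\<in>A. smooth_on (D \<inter> \<phi> -` (\<psi> ` E)) (inv_into E \<psi> \<circ> \<phi>))"

text \<open>
  Tensorial quantities at a point are computed in one chart around it, chosen arbitrarily;
  they do not depend on the choice.
\<close>

definition chart_at :: "('n::finite, 'p) chart set \<Rightarrow> 'p \<Rightarrow> ('n, 'p) chart" where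
  "chart_at A p = (SOME c. c \<in> A \<and> p \<in> snd c ` fst c)"

definition param_at :: "('n::finite, 'p) chart set \<Rightarrow> 'p \<Rightarrow> real^'n \<Rightarrow> 'p" where
  "param_at A p = snd (chart_at A p)"

definition coord_at :: "('n::finite, 'p) chart set \<Rightarrow> 'p \<Rightarrow> real^'n" where
  "coord_at A p = inv_into (fst (chart_at A p)) (snd (chart_at A p)) p"

definition smooth_immersion :: "('n::finite, 'p) chart set \<Rightarrow> ('p \<Rightarrow> real^'m::finite) \<Rightarrow> bool" where
  "smooth_immersion A X \<longleftrightarrow>
     (\<forall>(D, \<phi>)\<in>A. smooth_on D (X \<circ> \<phi>) \<and> (\<forall>u\<in>D. inj (frechet_derivative (X \<circ> \<phi>) (at u))))"


section \<open>Geometry of a parametrised piece\<close>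

text \<open>
  Below \<open>f\<close> is a local parametrisation \<open>X \<circ> \<phi>\<close> of the submanifold, \<open>w\<close> the coordinate representation
  \<open>W \<circ> \<phi>\<close> of a field \<open>W\<close> of vectors of the ambient space, and \<open>u\<close> a point of the coordinate domain.
  The tangent frame is \<open>e\<^sub>i = \<partial>\<^sub>i f\<close>.
\<close>

definition pd :: "'n::finite \<Rightarrow> (real^'n \<Rightarrow> 'b::real_normed_vector) \<Rightarrow> real^'n \<Rightarrow> 'b" where
  "pd i h u = frechet_derivative h (at u) (axis i 1)"

definition metric :: "(real^'n::finite \<Rightarrow> real^'m::finite) \<Rightarrow> real^'n \<Rightarrow> real^'n^'n" where
  "metric f u = (\<chi> i j. pd i f u \<bullet> pd j f u)"

definition inv_metric :: "(real^'n::finite \<Rightarrow> real^'m::finite) \<Rightarrow> real^'n \<Rightarrow> real^'n^'n" where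
  "inv_metric f u = matrix_inv (metric f u)"

definition orth_proj :: "'a::euclidean_space set \<Rightarrow> 'a \<Rightarrow> 'a" where
  "orth_proj T v = (THE w. w \<in> T \<and> (\<forall>x\<in>T. (v - w) \<bullet> x = 0))"

definition tangential ::
    "(real^'n::finite \<Rightarrow> real^'m::finite) \<Rightarrow> real^'n \<Rightarrow> real^'m \<Rightarrow> real^'m" where
  "tangential f u v = orth_proj (range (frechet_derivative f (at u))) v"

definition normal_part ::
    "(real^'n::finite \<Rightarrow> real^'m::finite) \<Rightarrow> real^'n \<Rightarrow> real^'m \<Rightarrow> real^'m" where
  "normal_part f u v = v - tangential f u v"

definition second_ff ::
    "(real^'n::finite \<Rightarrow> real^'m::finite) \<Rightarrow> real^'n \<Rightarrow> 'n \<Rightarrow> 'n \<Rightarrow> real^'m" where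
  "second_ff f u i j = normal_part f u (pd i (pd j f) u)"

definition mean_curv_loc ::
    "(real^'n::finite \<Rightarrow> real^'m::finite) \<Rightarrow> real^'n \<Rightarrow> real^'m" where
  "mean_curv_loc f u = (\<Sum>i\<in>UNIV. \<Sum>j\<in>UNIV. inv_metric f u $ i $ j *\<^sub>R second_ff f u i j)"

text \<open>
  The normal connection, for a normal field \<open>w\<close> and a tangent vector \<open>v\<close> at \<open>u\<close>. The argument of
  the derivative of \<open>w\<close> is the coordinate vector of \<open>v\<close>.
\<close>

definition normal_conn ::
    "(real^'n::finite \<Rightarrow> real^'m::finite) \<Rightarrow> (real^'n \<Rightarrow> real^'m) \<Rightarrow> real^'m \<Rightarrow> real^'n \<Rightarrow> real^'m" where
  "normal_conn f w v u =
     normal_part f u (frechet_derivative w (at u) (inv (frechet_derivative f (at u)) v))"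

text \<open>
  The Laplacian \<open>g\<^sup>i\<^sup>j (\<nabla>\<^sup>\<bottom>\<^bsub>e\<^sub>i\<^esub> \<nabla>\<^sup>\<bottom>\<^bsub>e\<^sub>j\<^esub> w - \<nabla>\<^sup>\<bottom>\<^bsub>D\<^esub> w)\<close>, where \<open>D\<close> is the Levi-Civita derivative of \<open>e\<^sub>j\<close> in
  direction \<open>e\<^sub>i\<close>, that is, the tangential part of \<open>\<partial>\<^sub>i \<partial>\<^sub>j f\<close>.
\<close>

definition normal_laplacian ::
    "(real^'n::finite \<Rightarrow> real^'m::finite) \<Rightarrow> (real^'n \<Rightarrow> real^'m) \<Rightarrow> real^'n \<Rightarrow> real^'m" where
  "normal_laplacian f w u =
     (\<Sum>i\<in>UNIV. \<Sum>j\<in>UNIV. inv_metric f u $ i $ j *\<^sub>R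
        (normal_conn f (\<lambda>u'. normal_conn f w (pd j f u') u') (pd i f u) u
         - normal_conn f w (tangential f u (pd i (pd j f) u)) u))"

definition L_perp_loc ::
    "(real^'n::finite \<Rightarrow> real^'m::finite) \<Rightarrow> real^'m \<Rightarrow> real \<Rightarrow> (real^'n \<Rightarrow> real^'m) \<Rightarrow> real^'n \<Rightarrow> real^'m"
  where
  "L_perp_loc f x0 t0 w u =
     normal_laplacian f w u
     + (\<Sum>i\<in>UNIV. \<Sum>j\<in>UNIV. \<Sum>k\<in>UNIV. \<Sum>l\<in>UNIV.
          ((second_ff f u i j \<bullet> w u) * inv_metric f u $ k $ i * inv_metric f u $ j $ l)
            *\<^sub>R second_ff f u k l)
     + (1 / (2 * t0)) *\<^sub>R w u
     - (1 / (2 * t0)) *\<^sub>R normal_conn f w (tangential f u (f u - x0)) u"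


section \<open>Geometry of an immersed submanifold\<close>

definition tangent_space ::
    "('n::finite, 'p) chart set \<Rightarrow> ('p \<Rightarrow> real^'m::finite) \<Rightarrow> 'p \<Rightarrow> (real^'m) set" where
  "tangent_space A X p = range (frechet_derivative (X \<circ> param_at A p) (at (coord_at A p)))"

definition normal_proj ::
    "('n::finite, 'p) chart set \<Rightarrow> ('p \<Rightarrow> real^'m::finite) \<Rightarrow> 'p \<Rightarrow> real^'m \<Rightarrow> real^'m" where
  "normal_proj A X p v = normal_part (X \<circ> param_at A p) (coord_at A p) v"

definition mean_curv ::
    "('n::finite, 'p) chart set \<Rightarrow> ('p \<Rightarrow> real^'m::finite) \<Rightarrow> 'p \<Rightarrow> real^'m" where
  "mean_curv A X p = mean_curv_loc (X \<circ> param_at A p) (coord_at A p)"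

definition L_perp ::
    "('n::finite, 'p) chart set \<Rightarrow> ('p \<Rightarrow> real^'m::finite) \<Rightarrow> real^'m \<Rightarrow> real \<Rightarrow> ('p \<Rightarrow> real^'m) \<Rightarrow> 'p \<Rightarrow> real^'m"
  where
  "L_perp A X x0 t0 W p = L_perp_loc (X \<circ> param_at A p) x0 t0 (W \<circ> param_at A p) (coord_at A p)"

text \<open>
  The induced volume measure: the unique Borel measure with density \<open>sqrt (det g)\<close> in every chart.
\<close>

definition volume_measure ::
    "('n::finite, 'p::topological_space) chart set \<Rightarrow> ('p \<Rightarrow> real^'m::finite) \<Rightarrow> 'p measure" where
  "volume_measure A X =
     (THE \<mu>. sets \<mu> = sets borel \<and>
        (\<forall>(D, \<phi>)\<in>A. \<forall>E\<in>sets borel. E \<subseteq> \<phi> ` D \<longrightarrow>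
           emeasure \<mu> E =
             (\<integral>\<^sup>+u\<in>(D \<inter> \<phi> -` E). ennreal (sqrt (det (metric (X \<circ> \<phi>) u))) \<partial>lborel)))"

text \<open>
  The length of a curve \<open>\<gamma>\<close> in the induced metric is the Euclidean length of \<open>X \<circ> \<gamma>\<close>. As \<open>X\<close> is an
  immersion, a continuous \<open>\<gamma>\<close> is piecewise \<open>C\<^sup>1\<close> iff \<open>X \<circ> \<gamma>\<close> is. Points in different components have
  infinite distance.
\<close>

definition riem_dist ::
    "('p::topological_space \<Rightarrow> real^'m::finite) \<Rightarrow> 'p \<Rightarrow> 'p \<Rightarrow> ennreal" where
  "riem_dist X p q =
     (INF \<gamma>\<in>{\<gamma>. path \<gamma> \<and> pathstart \<gamma> = p \<and> pathfinish \<gamma> = q \<and>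
              (X \<circ> \<gamma>) piecewise_C1_differentiable_on {0..1}}.
        \<integral>\<^sup>+r\<in>{0..1}. ennreal (norm (vector_derivative (X \<circ> \<gamma>) (at r))) \<partial>lborel)"

definition complete_immersion :: "('p::topological_space \<Rightarrow> real^'m::finite) \<Rightarrow> bool" where
  "complete_immersion X \<longleftrightarrow>
     (\<forall>\<sigma> :: nat \<Rightarrow> 'p.
        (\<forall>e>0. \<exists>N. \<forall>i\<ge>N. \<forall>j\<ge>N. riem_dist X (\<sigma> i) (\<sigma> j) < e) \<longrightarrow>
        (\<exists>p. (\<lambda>i. riem_dist X (\<sigma> i) p) \<longlonglongrightarrow> 0))"

definition polynomial_volume_growth ::
    "('n::finite, 'p::topological_space) chart set \<Rightarrow> ('p \<Rightarrow> real^'m::finite) \<Rightarrow> bool" where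
  "polynomial_volume_growth A X \<longleftrightarrow>
     (\<exists>C1 C2 :: real. \<exists>k :: nat. \<forall>r\<ge>0.
        emeasure (volume_measure A X) (X -` ball 0 r) \<le> ennreal (C1 * r ^ k + C2))"

definition F_functional ::
    "('n::finite, 'p::topological_space) chart set \<Rightarrow> ('p \<Rightarrow> real^'m::finite) \<Rightarrow> real^'m \<Rightarrow> real \<Rightarrow> real"
  where
  "F_functional A X x t =
     (4 * pi * t) powr (- real CARD('n) / 2) *
       (\<integral>p. exp (- (norm (X p - x))\<^sup>2 / (4 * t)) \<partial>volume_measure A X)"

definition normal_variation ::
    "('n::finite, 'p::topological_space) chart set \<Rightarrow> real set \<Rightarrow>
     (real \<Rightarrow> 'p \<Rightarrow> real^'m::finite) \<Rightarrow> (real \<Rightarrow> 'p \<Rightarrow> real^'m) \<Rightarrow> bool" where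
  "normal_variation A I X V \<longleftrightarrow>
     (\<forall>(D, \<phi>)\<in>A. smooth_on (I \<times> D) (\<lambda>(s, u). X s (\<phi> u))) \<and>
     (\<forall>s\<in>I. smooth_immersion A (X s)) \<and>
     (\<forall>s\<in>I. \<forall>p. ((\<lambda>r. X r p) has_vector_derivative V s p) (at s)) \<and>
     (\<forall>s\<in>I. \<forall>p. \<forall>v\<in>tangent_space A (X s) p. V s p \<bullet> v = 0)"

end

theory Submission
  imports Defs
begin

text \<open>
  Write \<open>F (\<Sigma>\<^sub>s, x\<^sub>s, t\<^sub>s)\<close> as an integral over the fixed measure \<open>\<mu>\<close> of \<open>\<Sigma>\<^sub>0\<close> of \<open>exp b * J\<close>, where
  \<open>J = sqrt (det g\<^sub>s) / sqrt (det g\<^sub>0)\<close> is the area ratio, which does not depend on the chart, and \<open>b\<close> is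
  the logarithm of the heat kernel. The formula holds pointwise for the integrands: normality of \<open>V\<close>
  for all \<open>s\<close> gives \<open>\<partial>\<^sub>s J = - J \<langle>V, H\<rangle>\<close>, and differentiating \<open>\<langle>V, e\<^sub>j\<rangle> = 0\<close> once in \<open>s\<close> and once along
  \<open>\<Sigma>\<close> turns \<open>\<partial>\<^sub>s \<langle>V, H\<rangle>\<close> into the terms with \<open>\<Delta>\<^sup>\<bottom>\<close> and \<open>|\<langle>A, V\<rangle>|\<^sup>2\<close>, while the tangential part of the
  acceleration \<open>\<partial>\<^sub>s V\<close>, paired with \<open>X - x\<close>, produces the drift term of \<open>L\<^sup>\<bottom>\<close>. So no integration by
  parts is needed. Outside the compact support of \<open>V\<close> only \<open>x\<close> and \<open>t\<close> vary; hence the integrand and its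
  first two derivatives are bounded by a multiple of \<open>exp (- c |X|\<^sup>2)\<close>, which is integrable because of the
  polynomial volume growth, and one may differentiate twice under the integral.
\<close>


section \<open>Calculus of smooth maps\<close>

text \<open>In a chart the whole variation is one smooth map on the product
  \<open>I \<times> D\<close>, so derivatives in \<open>s\<close> and along the submanifold are
  directional derivatives of the same map and commute. The shape of the final formula comes from
  logarithmic derivatives: \<open>J = 1\<close> at \<open>s = 0\<close>, so the second derivative of
  \<open>exp b * J\<close> is the weight times the square of the first logarithmic derivative plus
  the second one. The former is the squared bracket of the theorem, the latter all its other terms.
  The summand \<open>V / (2 t)\<close> of \<open>L_perp\<close> has its origin in the weight, where
  differentiating the squared distance twice produces the squared norm of the velocity. The
  measure-theoretic obstacle is that charts give everything only locally. The volume measure is a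
  definite description, so its existence and uniqueness have to be proved by patching countably many
  charts; only then can the measures for different \<open>s\<close> be compared through
  \<open>J\<close>. Uniform bounds over the manifold are likewise patched together from charts over
  the compact support, and off the support they come from the fact that nothing moves there.\<close>

abbreviation dd :: "'a::euclidean_space \<Rightarrow> ('a \<Rightarrow> 'b::real_normed_vector) \<Rightarrow> 'a \<Rightarrow> 'b" where
  "dd v f x \<equiv> frechet_derivative f (at x) v"

lemma dd_eqI: "(f has_derivative f') (at x) \<Longrightarrow> dd v f x = f' v"
  by (simp add: frechet_derivative_at[symmetric])

section \<open>Closure of \<open>Ck_on\<close> and \<open>smooth_on\<close> under algebraic
  operations\<close>

lemma Ck_on_cong:
  assumes "open S" "\<And>x. x \<in> S \<Longrightarrow> f x = g x" "Ck_on k S f"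
  shows "Ck_on k S g"
  using assms(2,3)
proof (induction k arbitrary: f g)
  case 0
  then show ?case by (simp cong: continuous_on_cong)
next
  case (Suc k)
  have der: "(g has_derivative (\<lambda>v. dd v f x)) (at x)" if "x \<in> S" for x
  proof (rule has_derivative_transform_within_open[OF _ \<open>open S\<close> that Suc.prems(1)])
    show "(f has_derivative (\<lambda>v. dd v f x)) (at x)"
      using Suc.prems(2) that frechet_derivative_works by auto
  qed
  have "Ck_on k S (\<lambda>x. dd v g x)" for v
    by (rule Suc.IH[of "\<lambda>x. dd v f x"]) (use Suc.prems(2) in \<open>auto simp: dd_eqI[OF der]\<close>)
  then show ?case
    using der by (auto simp: differentiable_def)
qed

lemma Ck_on_Suc_imp: "Ck_on (Suc k) S f \<Longrightarrow> Ck_on k S f"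
proof (induction k arbitrary: f)
  case 0
  then show ?case
    by (auto intro!: continuous_at_imp_continuous_on differentiable_imp_continuous_within)
next
  case (Suc k)
  then show ?case by (metis Ck_on.simps(2))
qed

lemma Ck_on_const: "Ck_on k S (\<lambda>x. c)"
  by (induction k arbitrary: c) auto

lemma Ck_on_SucI:
  assumes "open S" "\<And>x. x \<in> S \<Longrightarrow> (f has_derivative f' x) (at x)"
    "\<And>v. Ck_on k S (\<lambda>x. f' x v)"
  shows "Ck_on (Suc k) S f"
proof -
  have "Ck_on k S (\<lambda>x. dd v f x)" for v
    by (rule Ck_on_cong[OF assms(1) _ assms(3)[of v]]) (simp add: dd_eqI[OF assms(2)])
  then show ?thesis
    using assms(2) by (auto simp: differentiable_def)
qed

lemma Ck_on_Suc_has_derivative: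
  "Ck_on (Suc k) S f \<Longrightarrow> x \<in> S \<Longrightarrow> (f has_derivative (\<lambda>v. dd v f x)) (at x)"
  using frechet_derivative_works by auto

lemma Ck_on_add:
  assumes "open S" "Ck_on k S f" "Ck_on k S g"
  shows "Ck_on k S (\<lambda>x. f x + g x)"
  using assms(2,3)
proof (induction k arbitrary: f g)
  case (Suc k)
  show ?case
    by (rule Ck_on_SucI[OF \<open>open S\<close> has_derivative_add[OF Ck_on_Suc_has_derivative Ck_on_Suc_has_derivative]])
      (use Suc in auto)
qed (simp add: continuous_on_add)

lemma Ck_on_bounded_linear:
  assumes "open S" "bounded_linear L" "Ck_on k S f"
  shows "Ck_on k S (\<lambda>x. L (f x))"
  using assms(3)
proof (induction k arbitrary: f)
  case 0
  then show ?case using assms(2) by (simp add: bounded_linear.continuous_on)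
next
  case (Suc k)
  show ?case
    by (rule Ck_on_SucI[OF \<open>open S\<close> bounded_linear.has_derivative[OF assms(2) Ck_on_Suc_has_derivative]])
      (use Suc in auto)
qed

lemma Ck_on_bounded_bilinear:
  assumes "open S" "bounded_bilinear b" "Ck_on k S f" "Ck_on k S g"
  shows "Ck_on k S (\<lambda>x. b (f x) (g x))"
  using assms(3,4)
proof (induction k arbitrary: f g)
  case 0
  then show ?case using assms(2) by (simp add: bounded_bilinear.continuous_on)
next
  case (Suc k)
  \<comment> \<open>In the product rule each factor meets the derivative of the other one; the
    undifferentiated factor is lowered from order \<open>Suc k\<close> to \<open>k\<close> before
    the induction hypothesis applies.\<close>
  have "Ck_on k S (\<lambda>x. b (f x) (dd v g x))" "Ck_on k S (\<lambda>x. b (dd v f x) (g x))" for v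
    using Suc.prems by (auto intro!: Suc.IH dest: Ck_on_Suc_imp simp del: Ck_on.simps) simp_all
  then show ?case
    by (intro Ck_on_SucI[OF \<open>open S\<close> bounded_bilinear.FDERIV[OF assms(2)
            Ck_on_Suc_has_derivative[OF Suc.prems(1)] Ck_on_Suc_has_derivative[OF Suc.prems(2)]]] Ck_on_add[OF \<open>open S\<close>])
qed

text \<open>The derivative of \<open>1 / f\<close> is a product of \<open>f'\<close> with two copies
  of \<open>1 / f\<close> itself, and for these the induction hypothesis at order \<open>k\<close>
  is available. The square root below is treated in the same way.\<close>

lemma Ck_on_inverse:
  fixes f :: "'a::euclidean_space \<Rightarrow> real"
  assumes "open S" "\<And>x. x \<in> S \<Longrightarrow> f x \<noteq> 0" "Ck_on k S f"
  shows "Ck_on k S (\<lambda>x. inverse (f x))"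
  using assms(3)
proof (induction k)
  case 0
  then show ?case using assms(2) by (simp add: continuous_on_inverse)
next
  case (Suc k)
  have f: "Ck_on k S f" by (rule Ck_on_Suc_imp[OF Suc.prems])
  have "Ck_on k S (\<lambda>x. - (inverse (f x) * dd v f x * inverse (f x)))" for v
    by (intro Ck_on_bounded_bilinear[OF \<open>open S\<close> bounded_bilinear_mult]
        Ck_on_bounded_linear[OF \<open>open S\<close> bounded_linear_minus[OF bounded_linear_ident]] Suc.IH f)
      (use Suc.prems in auto)
  with Suc.prems assms(2) show ?case
    by (intro Ck_on_SucI[OF \<open>open S\<close> Deriv.has_derivative_inverse[OF _ Ck_on_Suc_has_derivative]]) auto
qed

lemma Ck_on_sqrt:
  fixes f :: "'a::euclidean_space \<Rightarrow> real"
  assumes "open S" "\<And>x. x \<in> S \<Longrightarrow> f x > 0" "Ck_on k S f"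
  shows "Ck_on k S (\<lambda>x. sqrt (f x))"
  using assms(3)
proof (induction k)
  case 0
  then show ?case by (simp add: continuous_on_real_sqrt)
next
  case (Suc k)
  have f: "Ck_on k S f" by (rule Ck_on_Suc_imp[OF Suc.prems])
  have "Ck_on k S (\<lambda>x. dd v f x * (inverse (sqrt (f x)) * (1 / 2)))" for v
    by (intro Ck_on_bounded_bilinear[OF \<open>open S\<close> bounded_bilinear_mult] Ck_on_const
        Ck_on_inverse[OF \<open>open S\<close>] Suc.IH f) (use Suc.prems assms(2) in \<open>auto simp: less_imp_neq[THEN not_sym]\<close>)
  moreover have "((\<lambda>x. sqrt (f x)) has_derivative (\<lambda>v. dd v f x * (inverse (sqrt (f x)) * (1 / 2)))) (at x)"
    if "x \<in> S" for x
    using has_derivative_real_sqrt[OF assms(2)[OF that] Ck_on_Suc_has_derivative[OF Suc.prems that]]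
    by (simp add: field_simps)
  ultimately show ?case
    by (intro Ck_on_SucI[OF \<open>open S\<close>])
qed

lemma smooth_on_cong: "open S \<Longrightarrow> (\<And>x. x \<in> S \<Longrightarrow> f x = g x) \<Longrightarrow> smooth_on S f \<Longrightarrow> smooth_on S g"
  unfolding smooth_on_def by (metis Ck_on_cong)

lemma smooth_on_const: "smooth_on S (\<lambda>x. c)"
  unfolding smooth_on_def by (metis Ck_on_const)

lemma smooth_on_add: "open S \<Longrightarrow> smooth_on S f \<Longrightarrow> smooth_on S g \<Longrightarrow> smooth_on S (\<lambda>x. f x + g x)"
  unfolding smooth_on_def by (metis Ck_on_add)

lemma smooth_on_bounded_linear:
  "open S \<Longrightarrow> bounded_linear L \<Longrightarrow> smooth_on S f \<Longrightarrow> smooth_on S (\<lambda>x. L (f x))"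
  unfolding smooth_on_def by (metis Ck_on_bounded_linear)

lemma smooth_on_mult:
  fixes f g :: "'a::euclidean_space \<Rightarrow> real"
  shows "open S \<Longrightarrow> smooth_on S f \<Longrightarrow> smooth_on S g \<Longrightarrow> smooth_on S (\<lambda>x. f x * g x)"
  unfolding smooth_on_def by (metis Ck_on_bounded_bilinear bounded_bilinear_mult)

lemma smooth_on_scaleR:
  "open S \<Longrightarrow> smooth_on S f \<Longrightarrow> smooth_on S g \<Longrightarrow> smooth_on S (\<lambda>x. f x *\<^sub>R g x)"
  unfolding smooth_on_def by (metis Ck_on_bounded_bilinear bounded_bilinear_scaleR)

lemma smooth_on_inner:
  "open S \<Longrightarrow> smooth_on S f \<Longrightarrow> smooth_on S g \<Longrightarrow> smooth_on S (\<lambda>x. f x \<bullet> g x)"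
  unfolding smooth_on_def by (metis Ck_on_bounded_bilinear bounded_bilinear_inner)

lemma smooth_on_minus: "open S \<Longrightarrow> smooth_on S f \<Longrightarrow> smooth_on S (\<lambda>x. - f x)"
  by (rule smooth_on_bounded_linear[OF _ bounded_linear_minus[OF bounded_linear_ident]])

lemma smooth_on_diff: "open S \<Longrightarrow> smooth_on S f \<Longrightarrow> smooth_on S g \<Longrightarrow> smooth_on S (\<lambda>x. f x - g x)"
  using smooth_on_add[of S f "\<lambda>x. - g x"] smooth_on_minus[of S g] by simp

lemma smooth_on_inverse:
  fixes f :: "'a::euclidean_space \<Rightarrow> real"
  shows "open S \<Longrightarrow> (\<And>x. x \<in> S \<Longrightarrow> f x \<noteq> 0) \<Longrightarrow> smooth_on S f \<Longrightarrow> smooth_on S (\<lambda>x. inverse (f x))"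
  unfolding smooth_on_def by (metis Ck_on_inverse)

lemma smooth_on_divide:
  fixes f g :: "'a::euclidean_space \<Rightarrow> real"
  shows "open S \<Longrightarrow> (\<And>x. x \<in> S \<Longrightarrow> g x \<noteq> 0) \<Longrightarrow> smooth_on S f \<Longrightarrow> smooth_on S g \<Longrightarrow>
    smooth_on S (\<lambda>x. f x / g x)"
  unfolding divide_inverse by (intro smooth_on_mult smooth_on_inverse)

lemma smooth_on_sqrt:
  fixes f :: "'a::euclidean_space \<Rightarrow> real"
  shows "open S \<Longrightarrow> (\<And>x. x \<in> S \<Longrightarrow> f x > 0) \<Longrightarrow> smooth_on S f \<Longrightarrow> smooth_on S (\<lambda>x. sqrt (f x))"
  unfolding smooth_on_def by (metis Ck_on_sqrt)

lemma smooth_on_sum: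
  assumes "open S" "\<And>i. i \<in> J \<Longrightarrow> smooth_on S (f i)"
  shows "smooth_on S (\<lambda>x. \<Sum>i\<in>J. f i x)"
  using assms(2)
  by (induction J rule: infinite_finite_induct) (auto intro: smooth_on_const smooth_on_add[OF \<open>open S\<close>])

lemma smooth_on_prod:
  fixes f :: "'i \<Rightarrow> 'a::euclidean_space \<Rightarrow> real"
  assumes "open S" "\<And>i. i \<in> J \<Longrightarrow> smooth_on S (f i)"
  shows "smooth_on S (\<lambda>x. \<Prod>i\<in>J. f i x)"
  using assms(2)
  by (induction J rule: infinite_finite_induct) (auto intro: smooth_on_const smooth_on_mult[OF \<open>open S\<close>])

lemma smooth_on_dd: "smooth_on S f \<Longrightarrow> smooth_on S (dd v f)"
  unfolding smooth_on_def by (metis Ck_on.simps(2))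

lemma smooth_on_has_derivative:
  "smooth_on S f \<Longrightarrow> x \<in> S \<Longrightarrow> (f has_derivative (\<lambda>v. dd v f x)) (at x)"
  unfolding smooth_on_def by (metis Ck_on_Suc_has_derivative)

lemma smooth_on_continuous: "smooth_on S f \<Longrightarrow> continuous_on S f"
  unfolding smooth_on_def by (metis Ck_on.simps(1))

lemma smooth_on_linear: "smooth_on S f \<Longrightarrow> x \<in> S \<Longrightarrow> linear (\<lambda>v. dd v f x)"
  using smooth_on_has_derivative has_derivative_linear by blast

lemma smooth_on_line:
  assumes "smooth_on S f" "x + r *\<^sub>R a \<in> S"
  shows "((\<lambda>r. f (x + r *\<^sub>R a)) has_vector_derivative dd a f (x + r *\<^sub>R a)) (at r)"
proof -
  have "((\<lambda>r. x + r *\<^sub>R a) has_derivative (\<lambda>h. h *\<^sub>R a)) (at r)"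
    by (auto intro!: derivative_eq_intros)
  from has_derivative_compose[OF this smooth_on_has_derivative[OF assms]]
  show ?thesis
    using linear_cmul[OF smooth_on_linear[OF assms]] by (simp add: has_vector_derivative_def)
qed

section \<open>Symmetry of second directional derivatives\<close>

lemma second_difference_mvt:
  fixes f :: "'a::euclidean_space \<Rightarrow> real"
  assumes f: "smooth_on S f" and h: "h > 0"
    and S: "\<And>r q. r \<in> {0..h} \<Longrightarrow> q \<in> {0..h} \<Longrightarrow> x + r *\<^sub>R a + q *\<^sub>R b \<in> S"
  shows "\<exists>r q. r \<in> {0..h} \<and> q \<in> {0..h} \<and>
    f (x + h *\<^sub>R a + h *\<^sub>R b) - f (x + h *\<^sub>R a) - f (x + h *\<^sub>R b) + f x
      = h\<^sup>2 * dd b (dd a f) (x + r *\<^sub>R a + q *\<^sub>R b)"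
proof -
  \<comment> \<open>The second difference is the increment of \<open>\<phi>\<close> over
    \<open>{0..h}\<close>. The mean value theorem is applied once along \<open>a\<close> to
    \<open>\<phi>\<close>, and then along \<open>b\<close> to the derivative that it
    produces.\<close>
  define \<phi> where "\<phi> r = f (x + h *\<^sub>R b + r *\<^sub>R a) - f (x + r *\<^sub>R a)" for r
  have der: "DERIV \<phi> r :> dd a f (x + h *\<^sub>R b + r *\<^sub>R a) - dd a f (x + r *\<^sub>R a)"
    if "0 \<le> r" "r \<le> h" for r
  proof -
    have r: "r \<in> {0..h}" using that by simp
    show ?thesis
      unfolding \<phi>_def has_real_derivative_iff_has_vector_derivative
      using S[OF r, of h] S[OF r, of 0] h
      by (intro has_vector_derivative_diff smooth_on_line[OF f]) (auto simp: algebra_simps)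
  qed
  obtain r where r: "0 < r" "r < h" "\<phi> h - \<phi> 0 = h * (dd a f (x + h *\<^sub>R b + r *\<^sub>R a) - dd a f (x + r *\<^sub>R a))"
    using MVT2[where f = \<phi> and a = 0 and b = h
        and f' = "\<lambda>r. dd a f (x + h *\<^sub>R b + r *\<^sub>R a) - dd a f (x + r *\<^sub>R a)", OF h der]
    by (auto simp only: diff_0_right)
  have der2: "((\<lambda>q. dd a f (x + r *\<^sub>R a + q *\<^sub>R b)) has_real_derivative dd b (dd a f) (x + r *\<^sub>R a + q *\<^sub>R b)) (at q)"
    if "0 \<le> q" "q \<le> h" for q
    unfolding has_real_derivative_iff_has_vector_derivative
    by (rule smooth_on_line[OF smooth_on_dd[OF f]]) (use S[of r q] r that in auto)
  obtain q where q: "0 < q" "q < h" "dd a f (x + r *\<^sub>R a + h *\<^sub>R b) - dd a f (x + r *\<^sub>R a + 0 *\<^sub>R b)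
      = h * dd b (dd a f) (x + r *\<^sub>R a + q *\<^sub>R b)"
    using MVT2[where f = "\<lambda>q. dd a f (x + r *\<^sub>R a + q *\<^sub>R b)" and a = 0 and b = h
        and f' = "\<lambda>q. dd b (dd a f) (x + r *\<^sub>R a + q *\<^sub>R b)", OF h der2]
    by (auto simp only: diff_0_right)
  show ?thesis
  proof (intro exI conjI)
    show "f (x + h *\<^sub>R a + h *\<^sub>R b) - f (x + h *\<^sub>R a) - f (x + h *\<^sub>R b) + f x
      = h\<^sup>2 * dd b (dd a f) (x + r *\<^sub>R a + q *\<^sub>R b)"
      using r(3) q(3) by (simp add: \<phi>_def power2_eq_square algebra_simps)
  qed (use r q in auto)
qed

text \<open>The second difference over a small parallelogram is symmetric in \<open>a\<close> and
  \<open>b\<close>, so the two mixed derivatives coincide at two points of the parallelogram, in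
  general different ones. Continuity at \<open>x\<close> then excludes different values at
  \<open>x\<close>.\<close>

lemma dd_commute_real:
  fixes f :: "'a::euclidean_space \<Rightarrow> real"
  assumes f: "smooth_on S f" and S: "open S" and x: "x \<in> S"
  shows "dd a (dd b f) x = dd b (dd a f) x"
proof (rule ccontr)
  assume neq: "\<not> ?thesis"
  \<comment> \<open>Half of the supposed gap: two numbers within \<open>e\<close> of the two values
    cannot be equal.\<close>
  define e where "e = \<bar>dd a (dd b f) x - dd b (dd a f) x\<bar> / 2"
  have e: "e > 0" using neq by (simp add: e_def)
  have cont: "isCont (dd v (dd w f)) x" for v w
    using smooth_on_continuous[OF smooth_on_dd[OF smooth_on_dd[OF f]]] S x
    by (simp add: continuous_on_eq_continuous_at)
  obtain d1 where d1: "d1 > 0" "\<And>z. dist z x < d1 \<Longrightarrow> dist (dd a (dd b f) z) (dd a (dd b f) x) < e"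
    using continuous_at_eps_delta[THEN iffD1, OF cont[of b a], rule_format, OF e] by auto
  obtain d2 where d2: "d2 > 0" "\<And>z. dist z x < d2 \<Longrightarrow> dist (dd b (dd a f) z) (dd b (dd a f) x) < e"
    using continuous_at_eps_delta[THEN iffD1, OF cont[of a b], rule_format, OF e] by auto
  obtain d3 where d3: "d3 > 0" "ball x d3 \<subseteq> S"
    using S x open_contains_ball by blast
  define d where "d = min d1 (min d2 d3)"
  \<comment> \<open>This keeps the whole parallelogram within \<open>d / 2\<close> of
    \<open>x\<close>; the summand 1 keeps the denominator positive when both directions
    vanish.\<close>
  define h where "h = d / (2 * (norm a + norm b + 1))"
  have d: "d > 0" using d1 d2 d3 by (simp add: d_def)
  have p: "norm a + norm b + 1 > 0" by (simp add: add_nonneg_pos)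
  have h: "h > 0" using d p by (simp add: h_def)
  have near: "dist (x + r *\<^sub>R v + q *\<^sub>R w) x < d"
    if "r \<in> {0..h}" "q \<in> {0..h}" "(v = a \<and> w = b) \<or> (v = b \<and> w = a)" for r q v w
  proof -
    have "dist (x + r *\<^sub>R v + q *\<^sub>R w) x = norm (r *\<^sub>R v + q *\<^sub>R w)"
      by (simp add: dist_norm algebra_simps)
    also have "\<dots> \<le> r * norm v + q * norm w"
      using that norm_triangle_ineq[of "r *\<^sub>R v" "q *\<^sub>R w"] by auto
    also have "\<dots> \<le> h * norm v + h * norm w"
      using that by (intro add_mono mult_right_mono) auto
    also have "\<dots> < h * (norm a + norm b + 1)"
      using that(3) h by (auto simp: algebra_simps)
    also have "\<dots> = d / 2"
      using p by (simp add: h_def field_simps)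
    finally show ?thesis using d by simp
  qed
  have inS: "x + r *\<^sub>R v + q *\<^sub>R w \<in> S"
    if "r \<in> {0..h}" "q \<in> {0..h}" "(v = a \<and> w = b) \<or> (v = b \<and> w = a)" for r q v w
    using near[OF that] d3(2) by (auto simp: d_def dist_commute)
  obtain r q where 1: "r \<in> {0..h}" "q \<in> {0..h}"
    "f (x + h *\<^sub>R a + h *\<^sub>R b) - f (x + h *\<^sub>R a) - f (x + h *\<^sub>R b) + f x
      = h\<^sup>2 * dd b (dd a f) (x + r *\<^sub>R a + q *\<^sub>R b)"
    using second_difference_mvt[OF f h inS, of a b] by auto
  obtain r' q' where 2: "r' \<in> {0..h}" "q' \<in> {0..h}"
    "f (x + h *\<^sub>R b + h *\<^sub>R a) - f (x + h *\<^sub>R b) - f (x + h *\<^sub>R a) + f x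
      = h\<^sup>2 * dd a (dd b f) (x + r' *\<^sub>R b + q' *\<^sub>R a)"
    using second_difference_mvt[OF f h inS, of b a] by auto
  have "h\<^sup>2 * dd b (dd a f) (x + r *\<^sub>R a + q *\<^sub>R b) = h\<^sup>2 * dd a (dd b f) (x + r' *\<^sub>R b + q' *\<^sub>R a)"
    using 1(3) 2(3) by (simp add: algebra_simps)
  then have "dd b (dd a f) (x + r *\<^sub>R a + q *\<^sub>R b) = dd a (dd b f) (x + r' *\<^sub>R b + q' *\<^sub>R a)"
    using h by simp
  moreover have "dist (dd b (dd a f) (x + r *\<^sub>R a + q *\<^sub>R b)) (dd b (dd a f) x) < e"
    using near[OF 1(1,2)] by (intro d2) (auto simp: d_def)
  moreover have "dist (dd a (dd b f) (x + r' *\<^sub>R b + q' *\<^sub>R a)) (dd a (dd b f) x) < e"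
    using near[OF 2(1,2)] by (intro d1) (auto simp: d_def)
  moreover have False if "u = v" "dist u p < \<bar>q - p\<bar> / 2" "dist v q < \<bar>q - p\<bar> / 2" for u v p q :: real
    using that dist_triangle3[of q p u] by (simp add: dist_real_def)
  ultimately show False
    unfolding e_def by blast
qed

lemma dd_bounded_linear:
  assumes "bounded_linear L" "f differentiable (at x)"
  shows "dd v (\<lambda>x. L (f x)) x = L (dd v f x)"
  using assms by (intro dd_eqI bounded_linear.has_derivative[OF assms(1)]) (simp add: frechet_derivative_works)

lemma smooth_on_differentiable: "smooth_on S f \<Longrightarrow> x \<in> S \<Longrightarrow> f differentiable (at x)"
  using smooth_on_has_derivative differentiableI by blast

text \<open>No differentiability is assumed: \<open>frechet_derivative\<close> is a choice among all
  derivatives at \<open>x\<close>, and both functions have the same ones.\<close>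

lemma dd_cong_open:
  assumes "open S" "x \<in> S" "\<And>x. x \<in> S \<Longrightarrow> f x = g x"
  shows "dd v f x = dd v g x"
proof -
  have "(f has_derivative f') (at x) \<longleftrightarrow> (g has_derivative f') (at x)" for f'
    using has_derivative_transform_within_open[OF _ assms(1,2)] assms(3) by metis
  then show ?thesis by (simp add: frechet_derivative_def)
qed

lemma dd_commute:
  fixes f :: "'a::euclidean_space \<Rightarrow> 'b::euclidean_space"
  assumes f: "smooth_on S f" and S: "open S" and x: "x \<in> S"
  shows "dd a (dd b f) x = dd b (dd a f) x"
proof (rule euclidean_eqI)
  fix i :: 'b assume "i \<in> Basis"
  have L: "bounded_linear (\<lambda>y. y \<bullet> i)" by (rule bounded_linear_inner_left)
  have *: "dd v (dd w (\<lambda>x. f x \<bullet> i)) x = dd v (dd w f) x \<bullet> i" for v w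
  proof -
    have "dd v (dd w (\<lambda>x. f x \<bullet> i)) x = dd v (\<lambda>x. dd w f x \<bullet> i) x"
      by (rule dd_cong_open[OF S x])
        (use dd_bounded_linear[OF L smooth_on_differentiable[OF f]] in auto)
    also have "\<dots> = dd v (dd w f) x \<bullet> i"
      by (rule dd_bounded_linear[OF L smooth_on_differentiable[OF smooth_on_dd[OF f] x]])
    finally show ?thesis .
  qed
  show "dd a (dd b f) x \<bullet> i = dd b (dd a f) x \<bullet> i"
    unfolding *[symmetric]
    by (rule dd_commute_real[OF smooth_on_bounded_linear[OF S L f] S x])
qed


section \<open>Derivatives of determinants and inverse matrices\<close>

text \<open>A permutation that fixes all indices but one is the identity. Hence only the identity
  survives when the Leibniz formula is differentiated at the unit matrix.\<close>

lemma prod_mat_1_remove: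
  assumes "p permutes (UNIV :: 'n::finite set)"
  shows "(\<Prod>j\<in>UNIV - {i}. (mat 1 :: real^'n^'n) $ j $ p j) = (if p = id then 1 else 0)"
proof (cases "p = id")
  case False
  have "\<exists>j. j \<noteq> i \<and> p j \<noteq> j"
  proof (rule ccontr)
    assume "\<not> ?thesis"
    then have fixed: "p j = j" if "j \<noteq> i" for j using that by auto
    then have "p i = i"
      by (metis permutes_inj[OF assms] injD)
    with fixed have "p = id" by (metis eq_id_iff)
    with False show False by simp
  qed
  then obtain j where j: "j \<noteq> i" "p j \<noteq> j" by blast
  then have "(mat 1 :: real^'n^'n) $ j $ p j = 0" by (simp add: mat_def)
  with j False show ?thesis by (auto intro!: prod_zero)
qed (simp add: mat_def)

lemma has_derivative_det_at_mat_1: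
  fixes B :: "'a::real_normed_vector \<Rightarrow> real^'n::finite^'n"
  assumes B: "\<And>i j. ((\<lambda>y. B y $ i $ j) has_derivative (\<lambda>h. B' h $ i $ j)) (at x)"
    and x: "B x = mat 1"
  shows "((\<lambda>y. det (B y)) has_derivative (\<lambda>h. trace (B' h))) (at x)"
proof -
  have "((\<lambda>y. det (B y)) has_derivative (\<lambda>h. \<Sum>p\<in>{p. p permutes UNIV}. of_int (sign p) *
      (\<Sum>i\<in>UNIV. B' h $ i $ p i * (\<Prod>j\<in>UNIV - {i}. B x $ j $ p j)))) (at x)"
    unfolding det_def
    by (intro has_derivative_sum has_derivative_mult_right has_derivative_prod B)
  moreover have "(\<Sum>p\<in>{p. p permutes UNIV}. of_int (sign p) *
      (\<Sum>i\<in>UNIV. B' h $ i $ p i * (\<Prod>j\<in>UNIV - {i}. B x $ j $ p j))) = trace (B' h)" for h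
  proof -
    have "(\<Sum>p\<in>{p. p permutes UNIV}. of_int (sign p) *
        (\<Sum>i\<in>UNIV. B' h $ i $ p i * (\<Prod>j\<in>UNIV - {i}. B x $ j $ p j)))
      = (\<Sum>p\<in>{p. p permutes (UNIV::'n set)}. if p = id then trace (B' h) else 0)"
      by (intro sum.cong refl) (simp add: x prod_mat_1_remove trace_def)
    also have "\<dots> = trace (B' h)"
      by (subst sum.delta) (auto simp: permutes_id finite_permutations)
    finally show ?thesis .
  qed
  ultimately show ?thesis by simp
qed

lemma matrix_inv_left_right:
  fixes A :: "real^'n::finite^'n"
  assumes "det A \<noteq> 0"
  shows "matrix_inv A ** A = mat 1" "A ** matrix_inv A = mat 1"
  using someI_ex[of "\<lambda>B. A ** B = mat 1 \<and> B ** A = mat 1"] assms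
  by (auto simp: invertible_det_nz[symmetric] invertible_def matrix_inv_def)

text \<open>Jacobi's formula. Factoring \<open>A x\<close> out of \<open>A y\<close> moves the point
  of differentiation to the unit matrix, where the derivative of the determinant is the
  trace.\<close>

lemma has_derivative_det:
  fixes A :: "'a::real_normed_vector \<Rightarrow> real^'n::finite^'n"
  assumes A: "\<And>i j. ((\<lambda>y. A y $ i $ j) has_derivative (\<lambda>h. A' h $ i $ j)) (at x)"
    and x: "det (A x) \<noteq> 0"
  shows "((\<lambda>y. det (A y)) has_derivative (\<lambda>h. det (A x) * trace (matrix_inv (A x) ** A' h))) (at x)"
proof -
  have "((\<lambda>y. det (matrix_inv (A x) ** A y)) has_derivative (\<lambda>h. trace (matrix_inv (A x) ** A' h))) (at x)"
  proof (rule has_derivative_det_at_mat_1)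
    show "((\<lambda>y. (matrix_inv (A x) ** A y) $ i $ j) has_derivative
        (\<lambda>h. (matrix_inv (A x) ** A' h) $ i $ j)) (at x)" for i j
      by (simp add: matrix_matrix_mult_def) (intro has_derivative_sum has_derivative_mult_right A)
  qed (simp add: matrix_inv_left_right x)
  then have "((\<lambda>y. det (A x) * det (matrix_inv (A x) ** A y)) has_derivative
      (\<lambda>h. det (A x) * trace (matrix_inv (A x) ** A' h))) (at x)"
    by (rule has_derivative_mult_right)
  moreover have "det (A x) * det (matrix_inv (A x) ** A y) = det (A y)" for y
  proof -
    have "det (A x) * det (matrix_inv (A x) ** A y) = det (A x ** (matrix_inv (A x) ** A y))"
      by (simp add: det_mul)
    then show ?thesis by (simp add: matrix_mul_assoc matrix_inv_left_right x)
  qed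
  ultimately show ?thesis by simp
qed

lemma smooth_on_det:
  fixes A :: "'a::euclidean_space \<Rightarrow> real^'n::finite^'n"
  assumes "open S" "\<And>i j. smooth_on S (\<lambda>x. A x $ i $ j)"
  shows "smooth_on S (\<lambda>x. det (A x))"
  unfolding det_def
  by (intro smooth_on_sum smooth_on_mult smooth_on_prod smooth_on_const assms)

text \<open>Cramer's rule for the columns of the unit matrix. It exhibits the entries of the inverse
  as quotients of polynomials in the entries of \<open>A\<close>, which gives their smooth
  dependence on parameters.\<close>

lemma matrix_inv_cramer:
  fixes A :: "real^'n::finite^'n"
  assumes "det A \<noteq> 0"
  shows "matrix_inv A $ k $ j = det (\<chi> i l. if l = k then axis j 1 $ i else A $ i $ l) / det A"
proof -
  have "A *v (matrix_inv A *v axis j 1) = axis j 1"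
    by (simp add: matrix_vector_mul_assoc matrix_inv_left_right assms)
  then have "(matrix_inv A *v axis j 1) $ k = det (\<chi> i l. if l = k then axis j 1 $ i else A $ i $ l) / det A"
    using cramer[OF assms, of "matrix_inv A *v axis j 1" "axis j 1"] by simp
  then show ?thesis
    by (simp add: matrix_vector_mul_component inner_axis)
qed

lemma smooth_on_matrix_inv:
  fixes A :: "'a::euclidean_space \<Rightarrow> real^'n::finite^'n"
  assumes S: "open S" and A: "\<And>i j. smooth_on S (\<lambda>x. A x $ i $ j)"
    and det: "\<And>x. x \<in> S \<Longrightarrow> det (A x) \<noteq> 0"
  shows "smooth_on S (\<lambda>x. matrix_inv (A x) $ k $ j)"
proof (rule smooth_on_cong[OF S])
  show "det (\<chi> i l. if l = k then axis j 1 $ i else A x $ i $ l) / det (A x) = matrix_inv (A x) $ k $ j"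
    if "x \<in> S" for x
    using matrix_inv_cramer[OF det[OF that]] by simp
  have "smooth_on S (\<lambda>x. (\<chi> i l. if l = k then axis j 1 $ i else A x $ i $ l) $ i $ l)" for i l
    by (cases "l = k") (simp_all add: smooth_on_const A)
  then show "smooth_on S (\<lambda>x. det (\<chi> i l. if l = k then axis j 1 $ i else A x $ i $ l) / det (A x))"
    by (intro smooth_on_divide smooth_on_det S A det)
qed

lemma dd_sum: "(\<And>i. i \<in> J \<Longrightarrow> f i differentiable (at x)) \<Longrightarrow>
    dd v (\<lambda>x. \<Sum>i\<in>J. f i x) x = (\<Sum>i\<in>J. dd v (f i) x)"
  by (rule dd_eqI) (auto intro!: has_derivative_sum simp: frechet_derivative_works)

lemma dd_mult:
  fixes f g :: "'a::euclidean_space \<Rightarrow> real"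
  shows "f differentiable (at x) \<Longrightarrow> g differentiable (at x) \<Longrightarrow>
    dd v (\<lambda>x. f x * g x) x = f x * dd v g x + dd v f x * g x"
  by (rule dd_eqI) (auto intro!: has_derivative_mult simp: frechet_derivative_works)

lemma dd_inner:
  "f differentiable (at x) \<Longrightarrow> g differentiable (at x) \<Longrightarrow>
    dd v (\<lambda>x. f x \<bullet> g x) x = f x \<bullet> dd v g x + dd v f x \<bullet> g x"
  by (rule dd_eqI) (auto intro!: has_derivative_inner simp: frechet_derivative_works)

text \<open>Differentiating the identity \<open>A ** B = mat 1\<close> entrywise gives
  \<open>A ** B' + A' ** B = 0\<close>; multiplication by \<open>B\<close> from the left isolates
  \<open>B'\<close>.\<close>

lemma dd_matrix_inv:
  fixes A :: "'a::euclidean_space \<Rightarrow> real^'n::finite^'n"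
  assumes S: "open S" and A: "\<And>i j. smooth_on S (\<lambda>x. A x $ i $ j)"
    and det: "\<And>x. x \<in> S \<Longrightarrow> det (A x) \<noteq> 0" and x: "x \<in> S"
  shows "dd v (\<lambda>x. matrix_inv (A x) $ i $ j) x =
    - (\<Sum>k\<in>UNIV. \<Sum>l\<in>UNIV. matrix_inv (A x) $ i $ k * dd v (\<lambda>x. A x $ k $ l) x * matrix_inv (A x) $ l $ j)"
proof -
  define B where "B x = matrix_inv (A x)" for x
  define A' where "A' = (\<chi> i j. dd v (\<lambda>x. A x $ i $ j) x)"
  define B' where "B' = (\<chi> i j. dd v (\<lambda>x. B x $ i $ j) x)"
  have B: "smooth_on S (\<lambda>x. B x $ i $ j)" for i j
    unfolding B_def by (rule smooth_on_matrix_inv[OF S A det])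
  have "(A x ** B' + A' ** B x) $ i $ j = 0" for i j
  proof -
    have "(A x ** B' + A' ** B x) $ i $ j = dd v (\<lambda>x. \<Sum>k\<in>UNIV. A x $ i $ k * B x $ k $ j) x"
      using smooth_on_differentiable[OF A x] smooth_on_differentiable[OF B x]
      by (simp add: dd_sum dd_mult matrix_matrix_mult_def A'_def B'_def sum.distrib differentiable_mult)
    also have "\<dots> = dd v (\<lambda>x. mat 1 $ i $ j) x"
    proof (rule dd_cong_open[OF S x])
      fix x assume "x \<in> S"
      from matrix_inv_left_right(2)[OF det[OF this]]
      show "(\<Sum>k\<in>UNIV. A x $ i $ k * B x $ k $ j) = mat 1 $ i $ j"
        by (simp add: B_def matrix_matrix_mult_def vec_eq_iff)
    qed
    finally show ?thesis by simp
  qed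
  then have "A x ** B' + A' ** B x = 0" by (simp add: vec_eq_iff)
  then have "B x ** (A x ** B' + A' ** B x) = 0" by simp
  then have "(B x ** A x) ** B' + (B x ** A') ** B x = 0"
    by (simp add: matrix_add_ldistrib matrix_mul_assoc)
  then have "B' + B x ** A' ** B x = 0"
    using matrix_inv_left_right(1)[OF det[OF x]] by (simp add: B_def)
  then have "B' = - (B x ** A' ** B x)"
    by (simp only: eq_neg_iff_add_eq_0)
  then have "B' $ i $ j = - (B x ** A' ** B x) $ i $ j" by simp
  also have "\<dots> = - (\<Sum>l\<in>UNIV. \<Sum>k\<in>UNIV. B x $ i $ k * A' $ k $ l * B x $ l $ j)"
    by (simp add: matrix_matrix_mult_def sum_distrib_right)
  also have "\<dots> = - (\<Sum>k\<in>UNIV. \<Sum>l\<in>UNIV. B x $ i $ k * A' $ k $ l * B x $ l $ j)"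
    by (subst sum.swap) simp
  finally show ?thesis by (simp add: B'_def A'_def B_def)
qed

lemma dd_det:
  fixes A :: "'a::euclidean_space \<Rightarrow> real^'n::finite^'n"
  assumes A: "\<And>i j. (\<lambda>x. A x $ i $ j) differentiable (at x)" and "det (A x) \<noteq> 0"
  shows "dd v (\<lambda>x. det (A x)) x =
    det (A x) * (\<Sum>i\<in>UNIV. \<Sum>j\<in>UNIV. matrix_inv (A x) $ i $ j * dd v (\<lambda>x. A x $ j $ i) x)"
proof -
  have "((\<lambda>y. det (A y)) has_derivative
      (\<lambda>h. det (A x) * trace (matrix_inv (A x) ** (\<chi> i j. dd h (\<lambda>x. A x $ i $ j) x)))) (at x)"
    using A assms(2) by (intro has_derivative_det) (simp_all add: frechet_derivative_works)
  from dd_eqI[OF this] show ?thesis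
    by (simp add: trace_def matrix_matrix_mult_def)
qed


section \<open>Change of variables over arbitrary finite index types\<close>

text \<open>
  The change of variables theorem of HOL-Analysis needs a wellordered index type. The type \<open>'a wo\<close> is a
  copy of the finite type \<open>'a\<close> with some wellorder, so that the theorem can be transferred to
  vectors indexed by \<open>'a\<close>.
\<close>

typedef 'a wo = "UNIV :: 'a set"
  morphisms of_wo to_wo by simp

instance wo :: (finite) finite
proof
  have "surj (to_wo :: 'a \<Rightarrow> 'a wo)"
    by (metis of_wo_inverse surjI)
  then show "finite (UNIV :: 'a wo set)"
    by (metis finite finite_imageI)
qed

instantiation wo :: (finite) wellorder
begin

definition less_eq_wo :: "'a wo \<Rightarrow> 'a wo \<Rightarrow> bool" where
  "less_eq_wo i j \<longleftrightarrow> to_nat (of_wo i) \<le> to_nat (of_wo j)"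

definition less_wo :: "'a wo \<Rightarrow> 'a wo \<Rightarrow> bool" where
  "less_wo i j \<longleftrightarrow> to_nat (of_wo i) < to_nat (of_wo j)"

instance
proof
  fix P :: "'a wo \<Rightarrow> bool" and a
  assume step: "\<And>x. (\<And>y. y < x \<Longrightarrow> P y) \<Longrightarrow> P x"
  show "P a"
    by (induction "to_nat (of_wo a)" arbitrary: a rule: less_induct) (rule step, simp add: less_wo_def)
qed (auto simp: less_eq_wo_def less_wo_def of_wo_inject)

end

definition wo_vec :: "real^'n::finite \<Rightarrow> real^('n wo)" where
  "wo_vec x = (\<chi> i. x $ of_wo i)"

definition unwo_vec :: "real^('n::finite wo) \<Rightarrow> real^'n" where
  "unwo_vec x = (\<chi> i. x $ to_wo i)"

lemma bij_of_wo: "bij of_wo"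
  by (metis bijI' of_wo_inject to_wo_inverse UNIV_I)

lemma wo_vec_unwo_vec [simp]: "wo_vec (unwo_vec x) = x" "unwo_vec (wo_vec y) = y"
  by (simp_all add: wo_vec_def unwo_vec_def vec_eq_iff of_wo_inverse to_wo_inverse)

lemma bounded_linear_wo_vec: "bounded_linear wo_vec" "bounded_linear unwo_vec"
  by (auto simp: wo_vec_def unwo_vec_def vec_eq_iff linear_iff intro!: linear_conv_bounded_linear[THEN iffD1])

lemma borel_measurable_wo_vec [measurable]: "wo_vec \<in> borel \<rightarrow>\<^sub>M borel" "unwo_vec \<in> borel \<rightarrow>\<^sub>M borel"
  by (intro borel_measurable_continuous_onI linear_continuous_on bounded_linear_wo_vec)+

text \<open>Relabelling coordinates maps boxes to boxes with the same side lengths, and Lebesgue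
  measure is determined by its values on boxes.\<close>

lemma lborel_distr_wo_vec: "distr lborel borel (wo_vec :: real^'n::finite \<Rightarrow> _) = lborel"
proof (rule lborel_eqI[symmetric])
  fix l u :: "real^('n wo)" assume le: "\<And>b. b \<in> Basis \<Longrightarrow> l \<bullet> b \<le> u \<bullet> b"
  have le': "l $ i \<le> u $ i" for i
    using le[of "axis i 1"] by (simp add: axis_in_Basis_iff inner_axis)
  have "wo_vec -` box l u = box (unwo_vec l) (unwo_vec u)"
    by (auto simp: mem_box_cart wo_vec_def unwo_vec_def) (metis of_wo_inverse to_wo_inverse UNIV_I)+
  then have "emeasure (distr lborel borel wo_vec) (box l u) = emeasure lborel (box (unwo_vec l) (unwo_vec u))"
    by (simp add: emeasure_distr)
  also have "\<dots> = (\<Prod>b\<in>Basis. (unwo_vec u - unwo_vec l) \<bullet> b)"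
    using le' by (subst emeasure_lborel_box) (auto simp: Basis_vec_def inner_axis unwo_vec_def)
  also have "(\<Prod>b\<in>Basis. (unwo_vec u - unwo_vec l) \<bullet> b) = (\<Prod>i\<in>UNIV. u $ to_wo i - l $ to_wo i)"
    by (simp add: Basis_vec_def inner_axis unwo_vec_def prod.UNION_disjoint axis_eq_axis)
  also have "\<dots> = (\<Prod>i\<in>UNIV. u $ i - l $ i)"
    by (rule prod.reindex_bij_witness[of _ of_wo to_wo]) (auto simp: of_wo_inverse to_wo_inverse)
  also have "\<dots> = (\<Prod>b\<in>Basis. (u - l) \<bullet> b)"
    by (simp add: Basis_vec_def inner_axis prod.UNION_disjoint axis_eq_axis)
  finally show "emeasure (distr lborel borel wo_vec) (box l u) = (\<Prod>b\<in>Basis. (u - l) \<bullet> b)" .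
qed simp

lemma det_reindex:
  fixes A :: "real^'n::finite^'n" and f :: "'k::finite \<Rightarrow> 'n"
  assumes f: "bij f"
  shows "det (\<chi> i j. A $ f i $ f j) = det A"
proof -
  define g where "g = inv f"
  have gf: "g (f i) = i" "f (g j) = j" for i j
    using f by (simp_all add: g_def bij_is_inj bij_is_surj surj_f_inv_f)
  define c where "c p = f \<circ> p \<circ> g" for p
  have permc: "c p permutes UNIV" if "p permutes UNIV" for p
    using that f unfolding c_def g_def
    by (metis bij_comp bij_imp_bij_inv bij_imp_permutes permutes_bij UNIV_I)
  \<comment> \<open>Transport along \<open>f\<close> turns a transposition into a transposition, so
    building \<open>p\<close> from transpositions shows that the sign is preserved.\<close>
  have sgn: "sign (c p) = sign p" if "p permutes (UNIV :: 'k set)" for p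
    using that finite
  proof (induction p rule: permutes_induct)
    case id
    have "c id = id" by (auto simp: c_def gf)
    then show ?case by (simp only: sign_id)
  next
    case (swap a b p)
    have "c (Transposition.transpose a b \<circ> p) = Transposition.transpose (f a) (f b) \<circ> c p"
      by (auto simp: c_def fun_eq_iff Transposition.transpose_def inj_eq[OF bij_is_inj[OF f]])
    moreover have "f a \<noteq> f b" using swap by (metis gf(1))
    ultimately show ?case
      using swap permc[OF \<open>p permutes UNIV\<close>]
      by (simp only: sign_compose permutation_swap_id permutes_imp_permutation[OF finite] sign_swap_id
          if_False)
  qed
  have "det A = (\<Sum>p\<in>{p. p permutes UNIV}. of_int (sign (c p)) * (\<Prod>i\<in>UNIV. A $ i $ c p i))"
    unfolding det_def
  proof (rule sum.reindex_bij_witness[of _ "c" "\<lambda>p. g \<circ> p \<circ> f"])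
    show "g \<circ> p \<circ> f \<in> {p. p permutes UNIV}" if "p \<in> {p. p permutes UNIV}" for p
      using that f unfolding g_def
      by (metis bij_comp bij_imp_bij_inv bij_imp_permutes permutes_bij UNIV_I mem_Collect_eq)
  qed (auto simp: c_def gf fun_eq_iff o_def permc[unfolded c_def o_def])
  also have "\<dots> = (\<Sum>p\<in>{p. p permutes UNIV}. of_int (sign p) * (\<Prod>i\<in>UNIV. A $ f i $ f (p i)))"
  proof (intro sum.cong refl arg_cong2[where f = "(*)"])
    fix p assume "p \<in> {p. p permutes (UNIV :: 'k set)}"
    then show "real_of_int (sign (c p)) = of_int (sign p)" by (simp add: sgn)
    show "(\<Prod>i\<in>UNIV. A $ i $ c p i) = (\<Prod>i\<in>UNIV. A $ f i $ f (p i))"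
      by (rule prod.reindex_bij_witness[of _ f g]) (auto simp: gf c_def)
  qed
  finally show ?thesis by (simp add: det_def)
qed

lemma det_matrix_wo_vec:
  fixes L :: "real^'n::finite \<Rightarrow> real^'n"
  shows "det (matrix (\<lambda>x. wo_vec (L (unwo_vec x)))) = det (matrix L)"
proof -
  have ax: "unwo_vec (axis i 1) = axis (of_wo i) (1::real)" for i :: "'n wo"
    by (auto simp: unwo_vec_def axis_def vec_eq_iff to_wo_inverse of_wo_inverse)
  have "matrix (\<lambda>x. wo_vec (L (unwo_vec x))) $ i $ j = matrix L $ of_wo i $ of_wo j" for i j
    by (simp add: matrix_def wo_vec_def ax)
  then have "matrix (\<lambda>x. wo_vec (L (unwo_vec x))) = (\<chi> i j. matrix L $ of_wo i $ of_wo j)"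
    by (simp add: vec_eq_iff)
  then show ?thesis by (simp add: det_reindex[OF bij_of_wo])
qed

text \<open>The theorem invoked here compares absolutely integrable functions. For nonnegative
  functions this suffices: if one of the two integrals is finite, that function is absolutely
  integrable, hence so is the other one with the same value; otherwise both integrals are
  infinite.\<close>

lemma nn_integral_change_of_variables_wellorder:
  fixes g :: "real^'n::{finite,wellorder} \<Rightarrow> real^'n::_" and f h :: "real^'n::_ \<Rightarrow> real"
  assumes S: "S \<in> sets borel"
    and g: "\<And>x. x \<in> S \<Longrightarrow> (g has_derivative g' x) (at x)" and inj: "inj_on g S"
    and h: "set_borel_measurable borel S h" and f: "set_borel_measurable borel (g ` S) f"
    and hf: "\<And>x. x \<in> S \<Longrightarrow> h x = \<bar>det (matrix (g' x))\<bar> * f (g x)"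
    and f0: "\<And>y. y \<in> g ` S \<Longrightarrow> 0 \<le> f y"
  shows "(\<integral>\<^sup>+x\<in>S. h x \<partial>lborel) = (\<integral>\<^sup>+y\<in>g ` S. f y \<partial>lborel)"
proof -
  have h0: "0 \<le> h x" if "x \<in> S" for x using that by (simp add: hf f0)
  have Sl: "S \<in> sets lebesgue" using S by auto
  have cov: "(h absolutely_integrable_on S \<and> integral S h = b) \<longleftrightarrow>
      (f absolutely_integrable_on g ` S \<and> integral (g ` S) f = b)" for b
  proof -
    \<comment> \<open>The theorem speaks of vector-valued functions, so scalars are regarded as
      elements of \<open>real^1\<close>.\<close>
    have eq: "(\<lambda>x. \<bar>det (matrix (g' x))\<bar> *\<^sub>R (vec (f (g x)) :: real^1)) = (\<lambda>x. vec (\<bar>det (matrix (g' x))\<bar> * f (g x)))"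
      by (intro ext) (simp add: vec_eq_iff)
    have "h absolutely_integrable_on S \<longleftrightarrow> (\<lambda>x. \<bar>det (matrix (g' x))\<bar> * f (g x)) absolutely_integrable_on S"
      by (rule set_integrable_cong) (simp_all add: hf)
    moreover have "integral S h = integral S (\<lambda>x. \<bar>det (matrix (g' x))\<bar> * f (g x))"
      by (rule integral_cong) (simp add: hf)
    ultimately show ?thesis
      using has_absolute_integral_change_of_variables[OF Sl has_derivative_at_withinI[OF g] inj,
          of "\<lambda>x. vec (f x) :: real^1" "vec b"]
      unfolding eq by (simp add: absolutely_integrable_on_1_iff integral_on_1_eq vec_eq_iff)
  qed
  have fin: "k absolutely_integrable_on T \<and> (\<integral>\<^sup>+x\<in>T. k x \<partial>lborel) = ennreal (integral T k)"
    if k: "set_borel_measurable borel T k" and k0: "\<And>x. x \<in> T \<Longrightarrow> 0 \<le> k x"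
      and kfin: "(\<integral>\<^sup>+x\<in>T. k x \<partial>lborel) < \<infinity>" for k :: "real^'n::_ \<Rightarrow> real" and T
  proof
    have eq: "(\<integral>\<^sup>+x\<in>T. k x \<partial>lborel) = (\<integral>\<^sup>+x. norm (indicator T x *\<^sub>R k x) \<partial>lborel)"
      using k0 by (intro nn_integral_cong) (auto simp: indicator_def)
    have "integrable lborel (\<lambda>x. indicator T x *\<^sub>R k x)"
      using k kfin eq by (intro integrableI_bounded) (auto simp: set_borel_measurable_def)
    then show "k absolutely_integrable_on T"
      by (simp add: set_integrable_def integrable_completion borel_measurable_integrable)
    show "(\<integral>\<^sup>+x\<in>T. k x \<partial>lborel) = ennreal (integral T k)"
      by (rule set_nn_integral_lborel_eq_integral[OF k k0 kfin])
  qed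
  have abs: "(\<integral>\<^sup>+x\<in>T. k x \<partial>lborel) = ennreal (integral T k)"
    if "k absolutely_integrable_on T" "\<And>x. x \<in> T \<Longrightarrow> 0 \<le> k x" for k :: "real^'n::_ \<Rightarrow> real" and T
    by (rule nn_integral_has_integral_lebesgue'[OF that(2)
          integrable_integral[OF set_lebesgue_integral_eq_integral(1)[OF that(1)]]])
  show ?thesis
  proof (cases "(\<integral>\<^sup>+x\<in>S. h x \<partial>lborel) < \<infinity>")
    case True
    from fin[OF h h0 this] cov[of "integral S h"] abs[where k = f and T = "g ` S"] f0 show ?thesis by auto
  next
    case hinf: False
    show ?thesis
    proof (cases "(\<integral>\<^sup>+y\<in>g ` S. f y \<partial>lborel) < \<infinity>")
      case True
      from fin[OF f f0 this] cov[of "integral (g ` S) f"] abs[where k = h and T = S] h0 show ?thesis by auto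
    next
      case False
      with hinf show ?thesis by (metis infinity_ennreal_def top.not_eq_extremum)
    qed
  qed
qed

lemma nn_integral_change_of_variables:
  fixes g :: "real^'n::finite \<Rightarrow> real^'n" and f h :: "real^'n \<Rightarrow> real"
  assumes S: "S \<in> sets borel"
    and g: "\<And>x. x \<in> S \<Longrightarrow> (g has_derivative g' x) (at x)" and inj: "inj_on g S"
    and h: "set_borel_measurable borel S h" and f: "set_borel_measurable borel (g ` S) f"
    and hf: "\<And>x. x \<in> S \<Longrightarrow> h x = \<bar>det (matrix (g' x))\<bar> * f (g x)"
    and f0: "\<And>y. y \<in> g ` S \<Longrightarrow> 0 \<le> f y"
  shows "(\<integral>\<^sup>+x\<in>S. h x \<partial>lborel) = (\<integral>\<^sup>+y\<in>g ` S. f y \<partial>lborel)"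
proof -
  have transfer: "(\<integral>\<^sup>+x\<in>T. k x \<partial>lborel) = (\<integral>\<^sup>+x\<in>wo_vec ` T. k (unwo_vec x) \<partial>lborel)"
    if "set_borel_measurable borel T k" for k :: "real^'n \<Rightarrow> real" and T
  proof -
    have ind: "indicator (wo_vec ` T) x = (indicator T (unwo_vec x) :: 'c::zero_neq_one)" for x :: "real^('n wo)"
      by (auto simp: indicator_def image_iff) (metis wo_vec_unwo_vec)
    have "(\<integral>\<^sup>+x\<in>wo_vec ` T. k (unwo_vec x) \<partial>lborel)
        = (\<integral>\<^sup>+x. ennreal (indicator T (unwo_vec x) *\<^sub>R k (unwo_vec x)) \<partial>distr lborel borel wo_vec)"
      unfolding lborel_distr_wo_vec ind by (intro nn_integral_cong) (auto simp: indicator_def)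
    also have "\<dots> = (\<integral>\<^sup>+x. ennreal (indicator T x *\<^sub>R k x) \<partial>lborel)"
      using that[unfolded set_borel_measurable_def]
      by (subst nn_integral_distr) (auto intro!: measurable_compose[OF borel_measurable_wo_vec(2)])
    also have "\<dots> = (\<integral>\<^sup>+x\<in>T. k x \<partial>lborel)"
      by (intro nn_integral_cong) (auto simp: indicator_def)
    finally show ?thesis ..
  qed
  have im: "wo_vec ` T = unwo_vec -` T" for T :: "(real^'n) set"
    by (auto simp: image_iff) (metis wo_vec_unwo_vec(1))
  have meas: "set_borel_measurable borel (wo_vec ` T) (\<lambda>x. k (unwo_vec x))"
    if "set_borel_measurable borel T k" for k :: "real^'n \<Rightarrow> real" and T
    using measurable_compose[OF borel_measurable_wo_vec(2) that[unfolded set_borel_measurable_def]]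
    unfolding set_borel_measurable_def im by (simp add: indicator_vimage[symmetric])
  define G where "G x = wo_vec (g (unwo_vec x))" for x
  have GS: "G ` (wo_vec ` S) = wo_vec ` (g ` S)"
    by (auto simp: G_def image_iff)
  have "(\<integral>\<^sup>+x\<in>wo_vec ` S. h (unwo_vec x) \<partial>lborel) = (\<integral>\<^sup>+y\<in>G ` (wo_vec ` S). f (unwo_vec y) \<partial>lborel)"
  proof (rule nn_integral_change_of_variables_wellorder[where g' = "\<lambda>x v. wo_vec (g' (unwo_vec x) (unwo_vec v))"])
    show "wo_vec ` S \<in> sets borel"
      unfolding im using measurable_sets[OF borel_measurable_wo_vec(2) S] by simp
    show "(G has_derivative (\<lambda>v. wo_vec (g' (unwo_vec x) (unwo_vec v)))) (at x)" if "x \<in> wo_vec ` S" for x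
      unfolding G_def
    proof (rule bounded_linear.has_derivative[OF bounded_linear_wo_vec(1)])
      have "unwo_vec x \<in> S" using that by auto
      from has_derivative_compose[OF bounded_linear_imp_has_derivative[OF bounded_linear_wo_vec(2)] g[OF this]]
      show "((\<lambda>x. g (unwo_vec x)) has_derivative (\<lambda>v. g' (unwo_vec x) (unwo_vec v))) (at x)" .
    qed
    show "inj_on G (wo_vec ` S)"
      using inj by (auto simp: inj_on_def G_def) (metis wo_vec_unwo_vec(2))+
    show "set_borel_measurable borel (G ` wo_vec ` S) (\<lambda>x. f (unwo_vec x))"
      unfolding GS by (rule meas[OF f])
    show "h (unwo_vec x) = \<bar>det (matrix (\<lambda>v. wo_vec (g' (unwo_vec x) (unwo_vec v))))\<bar> * f (unwo_vec (G x))"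
      if "x \<in> wo_vec ` S" for x
      using that unfolding det_matrix_wo_vec by (auto simp: G_def hf)
    show "0 \<le> f (unwo_vec y)" if "y \<in> G ` wo_vec ` S" for y
      using that unfolding GS by (auto simp: f0)
  qed (rule meas[OF h])
  then show ?thesis
    by (simp add: transfer[OF h] transfer[OF f] GS)
qed


section \<open>Tangential projection and the first variation of the area element\<close>

text \<open>Two candidates differ by an element of \<open>T\<close> that is orthogonal to all of
  \<open>T\<close>, hence to itself. This is how the definite description in
  \<open>orth_proj\<close> gets evaluated.\<close>

lemma orth_proj_eqI:
  assumes T: "subspace T" and w: "w \<in> T" and orth: "\<And>x. x \<in> T \<Longrightarrow> (v - w) \<bullet> x = 0"
  shows "orth_proj T v = w"
  unfolding orth_proj_def
proof (rule the_equality)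
  fix w' assume w': "w' \<in> T \<and> (\<forall>x\<in>T. (v - w') \<bullet> x = 0)"
  then have "w - w' \<in> T" using T w by (simp add: subspace_diff)
  then have "(v - w) \<bullet> (w - w') = 0" "(v - w') \<bullet> (w - w') = 0" using orth w' by auto
  then have "(w - w') \<bullet> (w - w') = 0" by (simp add: inner_diff_left)
  then show "w' = w" by simp
qed (use w orth in auto)

text \<open>The transpose of the inverse is a left inverse of the symmetric matrix \<open>A\<close>,
  and a left inverse equals the inverse.\<close>

lemma matrix_inv_symmetric:
  fixes A :: "real^'n::finite^'n"
  assumes "det A \<noteq> 0" and sym: "\<And>i j. A $ i $ j = A $ j $ i"
  shows "matrix_inv A $ i $ j = matrix_inv A $ j $ i"
proof -
  let ?B = "matrix_inv A"
  have "transpose A = A" using sym by (simp add: transpose_def vec_eq_iff)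
  then have "transpose ?B ** A = transpose (A ** ?B)"
    by (simp add: matrix_transpose_mul)
  then have 1: "transpose ?B ** A = mat 1"
    by (simp add: matrix_inv_left_right[OF assms(1)] transpose_mat)
  have "transpose ?B = transpose ?B ** (A ** ?B)"
    by (simp add: matrix_inv_left_right[OF assms(1)])
  also have "\<dots> = ?B" by (simp add: matrix_mul_assoc 1)
  finally have "transpose ?B $ j $ i = ?B $ j $ i" by simp
  then show ?thesis by (simp add: transpose_def)
qed

text \<open>The segment from the identity to \<open>A\<close> consists of positive definite, hence nonsingular, matrices.\<close>

lemma det_pos_def_pos:
  fixes A :: "real^'n::finite^'n"
  assumes pos: "\<And>x. x \<noteq> 0 \<Longrightarrow> x \<bullet> (A *v x) > 0"
  shows "det A > 0"
proof -
  define P where "P r = (1 - r) *\<^sub>R mat 1 + r *\<^sub>R A" for r :: real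
  have nz: "det (P r) \<noteq> 0" if r: "0 \<le> r" "r \<le> 1" for r
  proof -
    have "x = 0" if "P r *v x = 0" for x
    proof (rule ccontr)
      assume x: "x \<noteq> 0"
      have "x \<bullet> (P r *v x) = (1 - r) * (x \<bullet> x) + r * (x \<bullet> (A *v x))"
        by (simp add: P_def matrix_vector_mult_add_rdistrib scaleR_matrix_vector_assoc[symmetric] inner_add_right)
      moreover have "\<dots> > 0"
      proof (cases "r = 0")
        case False
        then have "r * (x \<bullet> (A *v x)) > 0" using r pos[OF x] by simp
        then show ?thesis using r by (intro add_nonneg_pos mult_nonneg_nonneg) auto
      qed (use x in simp)
      ultimately show False using that by simp
    qed
    then have "inj ((*v) (P r))"
      by (simp add: matrix_left_invertible_injective[symmetric] matrix_left_invertible_ker)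
    then show ?thesis
      by (simp add: invertible_det_nz[symmetric] invertible_left_inverse matrix_left_invertible_injective)
  qed
  have cont: "continuous_on {0..1} (\<lambda>r. det (P r))"
    unfolding det_def P_def by (intro continuous_intros)
  have "det (P 1) > 0"
  proof (rule ccontr)
    assume "\<not> ?thesis"
    then have "\<exists>r. 0 \<le> r \<and> r \<le> 1 \<and> det (P r) = 0"
      using cont by (intro IVT2') (auto simp: P_def)
    with nz show False by blast
  qed
  then show ?thesis by (simp add: P_def)
qed

lemma linear_axis_expansion:
  fixes f :: "real^'n::finite \<Rightarrow> 'b::real_vector"
  assumes "linear f"
  shows "f x = (\<Sum>i\<in>UNIV. x $ i *\<^sub>R f (axis i 1))"
proof -
  have "f x = f (\<Sum>i\<in>UNIV. x $ i *\<^sub>R axis i 1)"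
    by (rule arg_cong[of _ _ f]) (simp add: vec_eq_iff axis_def if_distrib cong: if_cong)
  then show ?thesis
    by (simp add: linear_sum[OF assms] linear_cmul[OF assms])
qed

text \<open>The quadratic form of a Gram matrix at \<open>x\<close> is the squared norm of the image
  of \<open>x\<close> under the derivative, which injectivity makes positive for nonzero
  \<open>x\<close>.\<close>

lemma metric_pos_def:
  assumes f: "f differentiable (at u)" and inj: "inj (frechet_derivative f (at u))"
  shows "det (metric f u) > 0"
proof (rule det_pos_def_pos)
  let ?L = "frechet_derivative f (at u)"
  have L: "linear ?L" using f frechet_derivative_works has_derivative_linear by blast
  fix x :: "real^'a" assume "x \<noteq> 0"
  then have "?L x \<noteq> 0" using inj linear_injective_0[OF L] by blast
  then have "0 < ?L x \<bullet> ?L x" by simp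
  also have "?L x \<bullet> ?L x = (\<Sum>i\<in>UNIV. \<Sum>j\<in>UNIV. x $ i * metric f u $ i $ j * x $ j)"
    unfolding linear_axis_expansion[OF L, of x]
    by (simp add: inner_sum_left inner_sum_right metric_def pd_def sum_distrib_left inner_commute mult_ac)
  also have "\<dots> = x \<bullet> (M *v x)" if "M = metric f u" for M
    by (simp add: that inner_vec_def matrix_vector_mult_def sum_distrib_left mult_ac)
  finally have "x \<bullet> (M *v x) > 0" if "M = metric f u" for M using that by simp
  then show "x \<bullet> (metric f u *v x) > 0" by simp
qed

text \<open>In a frame that is not orthonormal the projection needs the inverse Gram matrix. Pairing
  the candidate with a frame vector contracts this inverse with the metric, so candidate and
  \<open>v\<close> have the same inner products with the frame.\<close>

lemma
  assumes f: "f differentiable (at u)" and inj: "inj (frechet_derivative f (at u))"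
  shows tangential_eq: "tangential f u v =
      (\<Sum>i\<in>UNIV. \<Sum>j\<in>UNIV. (inv_metric f u $ i $ j * (v \<bullet> pd i f u)) *\<^sub>R pd j f u)" (is "_ = ?w")
    and tangential_in_range: "tangential f u v \<in> range (frechet_derivative f (at u))"
    and normal_part_orth: "normal_part f u v \<bullet> frechet_derivative f (at u) c = 0"
proof -
  let ?L = "frechet_derivative f (at u)"
  have L: "linear ?L" using f frechet_derivative_works has_derivative_linear by blast
  have sub: "subspace (range ?L)" by (simp add: L linear_subspace_image)
  have inR: "?w \<in> range ?L"
    unfolding pd_def by (intro subspace_sum[OF sub] subspace_scale[OF sub]) auto
  have "matrix_inv (metric f u) ** metric f u = mat 1"
    using metric_pos_def[OF f inj] by (intro matrix_inv_left_right) simp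
  then have inv: "(\<Sum>j\<in>UNIV. inv_metric f u $ i $ j * (pd j f u \<bullet> pd k f u)) = (if i = k then 1 else 0)" for i k
    by (simp add: inv_metric_def vec_eq_iff matrix_matrix_mult_def mat_def) (simp add: metric_def)
  have orth_e: "?w \<bullet> pd k f u = v \<bullet> pd k f u" for k
  proof -
    have "?w \<bullet> pd k f u = (\<Sum>i\<in>UNIV. (v \<bullet> pd i f u) * (\<Sum>j\<in>UNIV. inv_metric f u $ i $ j * (pd j f u \<bullet> pd k f u)))"
      by (simp add: inner_sum_left sum_distrib_left mult_ac)
    then show ?thesis by (simp add: inv if_distrib cong: if_cong)
  qed
  have orth: "(v - ?w) \<bullet> ?L c = 0" for c
    using orth_e unfolding linear_axis_expansion[OF L, of c] pd_def
    by (simp add: inner_sum_right inner_diff_left)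
  show eq: "tangential f u v = ?w"
    unfolding tangential_def by (rule orth_proj_eqI[OF sub inR]) (use orth in auto)
  show "tangential f u v \<in> range ?L" using inR eq by simp
  show "normal_part f u v \<bullet> ?L c = 0" using orth eq by (simp add: normal_part_def)
qed

lemma sum4_rotate:
  "(\<Sum>i\<in>A. \<Sum>j\<in>B. \<Sum>k\<in>C. \<Sum>l\<in>D. f i j k l) = (\<Sum>j\<in>B. \<Sum>k\<in>C. \<Sum>i\<in>A. \<Sum>l\<in>D. f i j k l)"
  for f :: "_ \<Rightarrow> _ \<Rightarrow> _ \<Rightarrow> _ \<Rightarrow> real"
proof -
  have "(\<Sum>i\<in>A. \<Sum>j\<in>B. \<Sum>k\<in>C. \<Sum>l\<in>D. f i j k l) = (\<Sum>j\<in>B. \<Sum>i\<in>A. \<Sum>k\<in>C. \<Sum>l\<in>D. f i j k l)"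
    by (rule sum.swap)
  also have "\<dots> = (\<Sum>j\<in>B. \<Sum>k\<in>C. \<Sum>i\<in>A. \<Sum>l\<in>D. f i j k l)"
    by (intro sum.cong refl sum.swap)
  finally show ?thesis .
qed

section \<open>One chart of a normal variation: derivatives of the metric and of the area element in
  \<open>s\<close>\<close>

lemma smooth_on_slices:
  fixes \<psi> :: "real \<times> 'a::euclidean_space \<Rightarrow> 'b::real_normed_vector"
  assumes "smooth_on S \<psi>" "(s, u) \<in> S"
  shows "((\<lambda>u. \<psi> (s, u)) has_derivative (\<lambda>v. dd (0, v) \<psi> (s, u))) (at u)"
    and "((\<lambda>r. \<psi> (r, u)) has_vector_derivative dd (1, 0) \<psi> (s, u)) (at s)"
proof -
  note der = smooth_on_has_derivative[OF assms]
  have "((\<lambda>u. (s, u)) has_derivative (\<lambda>v. (0, v))) (at u)"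
    by (auto intro!: derivative_eq_intros)
  from has_derivative_compose[OF this der]
  show "((\<lambda>u. \<psi> (s, u)) has_derivative (\<lambda>v. dd (0, v) \<psi> (s, u))) (at u)" .
  have "((\<lambda>r. (r, u)) has_derivative (\<lambda>r. (r, 0))) (at s)"
    by (auto intro!: derivative_eq_intros)
  from has_derivative_compose[OF this der]
  have 2: "((\<lambda>r. \<psi> (r, u)) has_derivative (\<lambda>r. dd (r, 0) \<psi> (s, u))) (at s)" .
  have "dd (r, 0) \<psi> (s, u) = r *\<^sub>R dd (1, 0) \<psi> (s, u)" for r
    using linear_cmul[OF has_derivative_linear[OF der], of r "(1, 0)"] by simp
  then have "(\<lambda>r. dd (r, 0) \<psi> (s, u)) = (\<lambda>r. r *\<^sub>R dd (1, 0) \<psi> (s, u))"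
    by (rule ext)
  with 2 show "((\<lambda>r. \<psi> (r, u)) has_vector_derivative dd (1, 0) \<psi> (s, u)) (at s)"
    unfolding has_vector_derivative_def by metis
qed

text \<open>\<open>\<Phi> (s, u)\<close> stands for the point of the submanifold at time
  \<open>s\<close> with coordinates \<open>u\<close>. Regarding it as one map on a product makes
  Schwarz's theorem applicable to mixed derivatives in time and space.\<close>

locale local_variation =
  fixes \<Phi> :: "real \<times> (real^'n::finite) \<Rightarrow> real^'m::finite" and I :: "real set" and D :: "(real^'n) set"
  assumes open_I: "open I" and open_D: "open D" and smooth: "smooth_on (I \<times> D) \<Phi>"
    and immersed: "\<And>s u. s \<in> I \<Longrightarrow> u \<in> D \<Longrightarrow> inj (\<lambda>v. dd (0, v) \<Phi> (s, u))"
    and normal: "\<And>s u v. s \<in> I \<Longrightarrow> u \<in> D \<Longrightarrow> dd (1, 0) \<Phi> (s, u) \<bullet> dd (0, v) \<Phi> (s, u) = 0"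
begin

abbreviation S where "S \<equiv> I \<times> D"

lemma open_S: "open S" by (rule open_Times[OF open_I open_D])

definition Ds :: "(real \<times> (real^'n) \<Rightarrow> 'b::real_normed_vector) \<Rightarrow> real \<times> (real^'n) \<Rightarrow> 'b" where
  "Ds h = dd (1, 0) h"

definition Di :: "'n \<Rightarrow> (real \<times> (real^'n) \<Rightarrow> 'b::real_normed_vector) \<Rightarrow> real \<times> (real^'n) \<Rightarrow> 'b" where
  "Di i h = dd (0, axis i 1) h"

definition e where "e i = Di i \<Phi>"
definition W where "W = Ds \<Phi>"
definition G :: "real \<times> (real^'n) \<Rightarrow> real^'n^'n" where "G z = (\<chi> i j. e i z \<bullet> e j z)"
definition B where "B z = matrix_inv (G z)"
definition \<rho> where "\<rho> z = sqrt (det (G z))"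
text \<open>Since \<open>W\<close> is normal, pairing it with the full derivative of
  \<open>e j\<close> is the same as pairing it with the second fundamental form. So \<open>h\<close>
  is the form \<open><A, V>\<close>, and its trace \<open>tr\<close> is
  \<open><V, H>\<close>.\<close>

definition h where "h i j z = W z \<bullet> Di i (e j) z"
definition tr where "tr z = (\<Sum>i\<in>UNIV. \<Sum>j\<in>UNIV. B z $ i $ j * h i j z)"

lemma partial_const [simp]: "Di i (\<lambda>z. c) z = 0" "Ds (\<lambda>z. c) z = 0"
  by (simp_all add: Di_def Ds_def)

lemma slice_dd:
  assumes "smooth_on S \<psi>" "s \<in> I" "u \<in> D"
  shows "((\<lambda>u. \<psi> (s, u)) has_derivative (\<lambda>v. dd (0, v) \<psi> (s, u))) (at u)"
    and "dd v (\<lambda>u. \<psi> (s, u)) u = dd (0, v) \<psi> (s, u)"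
    and "((\<lambda>r. \<psi> (r, u)) has_vector_derivative Ds \<psi> (s, u)) (at s)"
  using smooth_on_slices[OF assms(1), of s u] assms(2,3) by (auto simp: Ds_def intro: dd_eqI)

lemma smooth_partial: "smooth_on S \<psi> \<Longrightarrow> smooth_on S (Di i \<psi>)" "smooth_on S \<psi> \<Longrightarrow> smooth_on S (Ds \<psi>)"
  by (simp_all add: Di_def Ds_def smooth_on_dd)

lemma slice_pd: "smooth_on S \<psi> \<Longrightarrow> s \<in> I \<Longrightarrow> u \<in> D \<Longrightarrow> pd i (\<lambda>u. \<psi> (s, u)) u = Di i \<psi> (s, u)"
  by (simp add: pd_def slice_dd(2) Di_def)

lemma partial_cong:
  assumes "z \<in> S" "\<And>z. z \<in> S \<Longrightarrow> f z = g z"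
  shows "Di i f z = Di i g z" "Ds f z = Ds g z"
  using dd_cong_open[OF open_S assms] by (simp_all add: Di_def Ds_def)

lemma partial_commute:
  fixes \<psi> :: "_ \<Rightarrow> 'b::euclidean_space"
  assumes "smooth_on S \<psi>" "z \<in> S"
  shows "Di i (Di j \<psi>) z = Di j (Di i \<psi>) z" "Ds (Di i \<psi>) z = Di i (Ds \<psi>) z"
  using dd_commute[OF assms(1) open_S assms(2)] by (simp_all add: Di_def Ds_def)

lemma partial_inner:
  assumes "smooth_on S f" "smooth_on S g" "z \<in> S"
  shows "Di i (\<lambda>z. f z \<bullet> g z) z = f z \<bullet> Di i g z + Di i f z \<bullet> g z"
    "Ds (\<lambda>z. f z \<bullet> g z) z = f z \<bullet> Ds g z + Ds f z \<bullet> g z"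
  using assms by (simp_all add: Di_def Ds_def dd_inner smooth_on_differentiable)

lemma smooth_e: "smooth_on S (e i)" and smooth_W: "smooth_on S W"
  by (simp_all add: e_def W_def smooth_partial smooth)

lemma smooth_G: "smooth_on S (\<lambda>z. G z $ i $ j)"
  by (simp add: G_def smooth_on_inner open_S smooth_e)

lemma slice_frechet: "s \<in> I \<Longrightarrow> u \<in> D \<Longrightarrow> frechet_derivative (\<lambda>u. \<Phi> (s, u)) (at u) = (\<lambda>v. dd (0, v) \<Phi> (s, u))"
  using slice_dd(2)[OF smooth] by blast

lemma slice_differentiable: "s \<in> I \<Longrightarrow> u \<in> D \<Longrightarrow> (\<lambda>u. \<Phi> (s, u)) differentiable (at u)"
  using slice_dd(1)[OF smooth] differentiableI by blast

lemma metric_slice: "s \<in> I \<Longrightarrow> u \<in> D \<Longrightarrow> metric (\<lambda>u. \<Phi> (s, u)) u = G (s, u)"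
  by (simp add: metric_def G_def slice_pd[OF smooth] e_def)

lemma det_G_pos: "z \<in> S \<Longrightarrow> det (G z) > 0"
  using metric_pos_def[OF slice_differentiable, of "fst z" "snd z"] immersed
  by (auto simp: metric_slice slice_frechet)

lemma rho_pos: "z \<in> S \<Longrightarrow> \<rho> z > 0"
  by (simp add: \<rho>_def det_G_pos)

lemma smooth_rho: "smooth_on S \<rho>"
  unfolding \<rho>_def by (intro smooth_on_sqrt open_S det_G_pos smooth_on_det smooth_G)

lemma smooth_B: "smooth_on S (\<lambda>z. B z $ i $ j)"
  unfolding B_def by (rule smooth_on_matrix_inv[OF open_S smooth_G]) (use det_G_pos in force)

lemma smooth_h: "smooth_on S (h i j)"
  unfolding h_def by (intro smooth_on_inner open_S smooth_W smooth_partial smooth_e)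

lemma smooth_tr: "smooth_on S tr"
  unfolding tr_def by (intro smooth_on_sum smooth_on_mult open_S smooth_B smooth_h)

lemma B_sym: "z \<in> S \<Longrightarrow> B z $ i $ j = B z $ j $ i"
  unfolding B_def using det_G_pos[of z] by (intro matrix_inv_symmetric) (auto simp: G_def inner_commute)

lemma h_sym: "z \<in> S \<Longrightarrow> h i j z = h j i z"
  by (simp add: h_def e_def partial_commute(1)[OF smooth])

lemma W_normal: "z \<in> S \<Longrightarrow> W z \<bullet> e i z = 0" "z \<in> S \<Longrightarrow> W z \<bullet> dd (0, c) \<Phi> z = 0"
  using normal by (auto simp: W_def e_def Ds_def Di_def)

text \<open>The Weingarten relation: differentiate \<open>W z \<bullet> e j z = 0\<close> along the
  submanifold.\<close>

lemma partial_W_e: "z \<in> S \<Longrightarrow> Di i W z \<bullet> e j z = - h i j z"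
proof -
  assume z: "z \<in> S"
  have "Di i (\<lambda>z. W z \<bullet> e j z) z = Di i (\<lambda>z. 0) z"
    by (rule partial_cong[OF z]) (rule W_normal)
  then show ?thesis
    by (simp add: partial_inner[OF smooth_W smooth_e z] h_def add_eq_0_iff)
qed

lemma partial_s_e: "z \<in> S \<Longrightarrow> Ds (e i) z = Di i W z"
  by (simp add: e_def W_def partial_commute[OF smooth])

text \<open>Differentiating in \<open>s\<close> the orthogonality of \<open>W\<close> to a tangent
  direction fixes the tangential part of the acceleration in terms of spatial derivatives of
  \<open>W\<close>. This needs normality for all \<open>s\<close>, not only at one time.\<close>

lemma acceleration_tangent: "z \<in> S \<Longrightarrow> Ds W z \<bullet> dd (0, c) \<Phi> z = - (W z \<bullet> dd (0, c) W z)"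
proof -
  assume z: "z \<in> S"
  have sm: "smooth_on S (dd (0, c) \<Phi>)" by (rule smooth_on_dd[OF smooth])
  have "Ds (\<lambda>z. W z \<bullet> dd (0, c) \<Phi> z) z = Ds (\<lambda>z. 0) z"
    by (rule partial_cong[OF z]) (rule W_normal)
  moreover have "Ds (dd (0, c) \<Phi>) z = dd (0, c) W z"
    unfolding Ds_def W_def by (rule dd_commute[OF smooth open_S z])
  ultimately show ?thesis
    by (simp add: partial_inner[OF smooth_W sm z] add_eq_0_iff)
qed

text \<open>Since \<open>e i\<close> changes in time by \<open>Di i W\<close>, each of the two
  factors of the metric contributes one Weingarten term \<open>- h i j\<close>.\<close>

lemma partial_s_G: "z \<in> S \<Longrightarrow> Ds (\<lambda>z. G z $ i $ j) z = - 2 * h i j z"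
  using h_sym[of z j i]
  by (simp add: G_def partial_inner[OF smooth_e smooth_e] partial_s_e partial_W_e inner_commute[of "e i z"])

text \<open>First variation of area: Jacobi's formula gives \<open>-2 * tr\<close> as logarithmic
  derivative of \<open>det (G z)\<close>, and the square root halves it.\<close>

lemma partial_s_rho:
  assumes z: "z \<in> S"
  shows "Ds \<rho> z = - \<rho> z * tr z"
proof -
  have nz: "det (G z) \<noteq> 0" and pos: "det (G z) > 0" using det_G_pos[OF z] by auto
  have "Ds (\<lambda>z. det (G z)) z = det (G z) * (\<Sum>i\<in>UNIV. \<Sum>j\<in>UNIV. B z $ i $ j * Ds (\<lambda>z. G z $ j $ i) z)"
    unfolding Ds_def B_def by (rule dd_det[OF smooth_on_differentiable[OF smooth_G z] nz])
  also have "\<dots> = - 2 * det (G z) * tr z"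
    using h_sym[OF z] by (simp add: partial_s_G[OF z] tr_def sum_negf sum_distrib_left mult_ac)
  finally have d: "dd (1, 0) (\<lambda>z. det (G z)) z = - 2 * det (G z) * tr z" by (simp add: Ds_def)
  have "((\<lambda>z. det (G z)) has_derivative (\<lambda>v. dd v (\<lambda>z. det (G z)) z)) (at z)"
    by (rule smooth_on_has_derivative[OF smooth_on_det[OF open_S smooth_G] z])
  from dd_eqI[OF has_derivative_real_sqrt[OF pos this], of "(1, 0)"]
  have "Ds \<rho> z = - 2 * det (G z) * tr z * (1 / (\<rho> z * 2))"
    unfolding \<rho>_def Ds_def d by (simp add: field_simps)
  moreover have "det (G z) = \<rho> z * \<rho> z" using pos by (simp add: \<rho>_def)
  ultimately show ?thesis using rho_pos[OF z] by (simp add: field_simps)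
qed

lemma partial_s_s_rho:
  assumes z: "z \<in> S"
  shows "Ds (Ds \<rho>) z = \<rho> z * ((tr z)\<^sup>2 - Ds tr z)"
proof -
  have "Ds (Ds \<rho>) z = Ds (\<lambda>z. - \<rho> z * tr z) z"
    by (rule partial_cong[OF z]) (rule partial_s_rho)
  also have "\<dots> = - \<rho> z * Ds tr z + Ds (\<lambda>z. - \<rho> z) z * tr z"
    unfolding Ds_def
    by (intro dd_mult smooth_on_differentiable[OF _ z] smooth_tr smooth_on_minus open_S smooth_rho)
  also have "Ds (\<lambda>z. - \<rho> z) z = - Ds \<rho> z"
    unfolding Ds_def
    by (rule dd_bounded_linear[OF bounded_linear_minus[OF bounded_linear_ident]
        smooth_on_differentiable[OF smooth_rho z]])
  finally show ?thesis by (simp add: partial_s_rho[OF z] power2_eq_square algebra_simps)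
qed

lemma partial_s_h:
  assumes z: "z \<in> S"
  shows "Ds (h i j) z = Ds W z \<bullet> Di i (e j) z + W z \<bullet> Di i (Di j W) z"
proof -
  have "Ds (Di i (e j)) z = Di i (Ds (e j)) z"
    by (rule partial_commute(2)[OF smooth_e z])
  also have "\<dots> = Di i (Di j W) z"
    by (rule partial_cong[OF z]) (rule partial_s_e)
  finally show ?thesis
    unfolding h_def by (simp add: partial_inner[OF smooth_W smooth_partial(1)[OF smooth_e] z])
qed

text \<open>\<open>hh\<close> is the squared norm of \<open>\<langle>A, V\<rangle>\<close> with respect to the induced metric.\<close>

definition hh where "hh z = (\<Sum>i\<in>UNIV. \<Sum>j\<in>UNIV. \<Sum>k\<in>UNIV. \<Sum>l\<in>UNIV.
  h i j z * B z $ i $ k * h k l z * B z $ l $ j)"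

text \<open>The summand \<open>2 * hh z\<close> comes from the inverse metric, whose derivative is
  twice \<open>h\<close> with both indices raised; the remaining sum is the derivative of
  \<open>h\<close> itself.\<close>

lemma partial_s_tr:
  assumes z: "z \<in> S"
  shows "Ds tr z = 2 * hh z + (\<Sum>i\<in>UNIV. \<Sum>j\<in>UNIV. B z $ i $ j *
    (Ds W z \<bullet> Di i (e j) z + W z \<bullet> Di i (Di j W) z))"
proof -
  note diff = smooth_on_differentiable[OF _ z]
  have B': "Ds (\<lambda>z. B z $ i $ j) z = 2 * (\<Sum>k\<in>UNIV. \<Sum>l\<in>UNIV. B z $ i $ k * h k l z * B z $ l $ j)" for i j
  proof -
    have "Ds (\<lambda>z. B z $ i $ j) z
      = - (\<Sum>k\<in>UNIV. \<Sum>l\<in>UNIV. B z $ i $ k * Ds (\<lambda>z. G z $ k $ l) z * B z $ l $ j)"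
      unfolding Ds_def B_def by (rule dd_matrix_inv[OF open_S smooth_G _ z]) (use det_G_pos in force)
    then show ?thesis
      by (simp add: partial_s_G[OF z] sum_negf sum_distrib_left mult_ac)
  qed
  have "Ds tr z = (\<Sum>i\<in>UNIV. \<Sum>j\<in>UNIV. B z $ i $ j * Ds (h i j) z + Ds (\<lambda>z. B z $ i $ j) z * h i j z)"
    unfolding tr_def Ds_def
    by (simp add: dd_sum dd_mult diff smooth_on_sum smooth_on_mult open_S smooth_B smooth_h)
  also have "\<dots> = (\<Sum>i\<in>UNIV. \<Sum>j\<in>UNIV. B z $ i $ j * Ds (h i j) z)
    + (\<Sum>i\<in>UNIV. \<Sum>j\<in>UNIV. Ds (\<lambda>z. B z $ i $ j) z * h i j z)"
    by (simp add: sum.distrib)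
  also have "(\<Sum>i\<in>UNIV. \<Sum>j\<in>UNIV. Ds (\<lambda>z. B z $ i $ j) z * h i j z) = 2 * hh z"
    by (simp add: B' hh_def sum_distrib_left sum_distrib_right mult_ac)
  finally show ?thesis by (simp add: partial_s_h[OF z])
qed

end


section \<open>The second variation of the area element\<close>

context local_variation
begin

abbreviation f where "f s \<equiv> \<lambda>u. \<Phi> (s, u)"

abbreviation w where "w s \<equiv> \<lambda>u. W (s, u)"

context
  fixes s u assumes s: "s \<in> I" and u: "u \<in> D"
begin

lemma point_in_S: "(s, u) \<in> S" using s u by simp

lemma slice_inj: "inj (frechet_derivative (f s) (at u))"
  using immersed[OF s u] by (simp add: slice_frechet[OF s u])

lemma inv_metric_slice: "inv_metric (f s) u = B (s, u)"
  by (simp add: inv_metric_def B_def metric_slice[OF s u])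

lemma pd_slice: "pd i (f s) u = e i (s, u)"
  by (simp add: slice_pd[OF smooth s u] e_def)

lemma tangential_slice: "tangential (f s) u v =
    (\<Sum>i\<in>UNIV. \<Sum>j\<in>UNIV. (B (s, u) $ i $ j * (v \<bullet> e i (s, u))) *\<^sub>R e j (s, u))"
  by (simp add: tangential_eq[OF slice_differentiable[OF s u] slice_inj] inv_metric_slice pd_slice)

text \<open>Tangential components are invisible to \<open>W\<close>. Pairing with \<open>W\<close>
  therefore removes the projections hidden in the second fundamental form and in the normal
  connection.\<close>

lemma W_inner_normal_part: "W (s, u) \<bullet> normal_part (f s) u v = W (s, u) \<bullet> v"
  by (simp add: normal_part_def tangential_slice inner_diff_right inner_sum_right W_normal[OF point_in_S])

lemma tangential_coords: "\<exists>c. tangential (f s) u v = dd (0, c) \<Phi> (s, u)"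
  using tangential_in_range[OF slice_differentiable[OF s u] slice_inj, of v]
  by (auto simp: slice_frechet[OF s u])

lemma pd_pd_slice: "pd i (pd j (f s)) u = Di i (e j) (s, u)"
proof -
  have "pd i (pd j (f s)) u = pd i (\<lambda>u. e j (s, u)) u"
    unfolding pd_def by (rule dd_cong_open[OF open_D u])
      (simp add: slice_pd[OF smooth s, unfolded pd_def] e_def)
  then show ?thesis by (simp add: slice_pd[OF smooth_e s u])
qed

lemma W_inner_second_ff: "W (s, u) \<bullet> second_ff (f s) u i j = h i j (s, u)"
  by (simp add: second_ff_def W_inner_normal_part pd_pd_slice h_def)

lemma W_inner_mean_curv: "W (s, u) \<bullet> mean_curv_loc (f s) u = tr (s, u)"
  by (simp add: mean_curv_loc_def inner_sum_right inv_metric_slice W_inner_second_ff tr_def)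

text \<open>Injectivity of the derivative lets \<open>inv\<close> recover the coordinate vector
  \<open>c\<close>, so the normal connection is an ordinary directional derivative up to a
  projection that \<open>W\<close> does not see.\<close>

lemma W_inner_normal_conn:
  "W (s, u) \<bullet> normal_conn (f s) \<omega> (dd (0, c) \<Phi> (s, u)) u = W (s, u) \<bullet> dd c \<omega> u"
  using inv_f_f[OF slice_inj, of c]
  by (simp add: normal_conn_def W_inner_normal_part) (simp add: slice_frechet[OF s u])

text \<open>Split \<open>v\<close> into its tangential and normal parts: the tangential part of
  \<open>v\<close> sees only the tangential acceleration, which \<open>acceleration_tangent\<close>
  trades for a derivative of \<open>W\<close>.\<close>

lemma acceleration_tangential_inner:
  assumes "tangential (f s) u v = dd (0, c) \<Phi> (s, u)"
  shows "Ds W (s, u) \<bullet> v = normal_part (f s) u (Ds W (s, u)) \<bullet> v - W (s, u) \<bullet> dd (0, c) W (s, u)"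
proof -
  let ?n = "normal_part (f s) u" and ?t = "tangential (f s) u" and ?a = "Ds W (s, u)"
  have "?n ?a \<bullet> ?t v = 0" "?n v \<bullet> ?t ?a = 0"
    using normal_part_orth[OF slice_differentiable[OF s u] slice_inj]
      tangential_in_range[OF slice_differentiable[OF s u] slice_inj]
    by (metis imageE)+
  then have "?n ?a \<bullet> v = ?a \<bullet> v - ?a \<bullet> ?t v"
    by (simp add: normal_part_def inner_diff_left inner_diff_right inner_commute)
  then show ?thesis
    by (simp add: assms acceleration_tangent[OF point_in_S])
qed

end

text \<open>Beyond the coordinate Hessian, a second normal derivative picks up the product of the
  tangential parts of \<open>Di i W\<close> and \<open>Di j W\<close>, and these tangential parts
  are given by \<open>h\<close>.\<close>

lemma W_inner_normal_hessian:
  assumes s: "s \<in> I" and u: "u \<in> D"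
  shows "W (s, u) \<bullet> normal_conn (f s) (\<lambda>u'. normal_conn (f s) (w s) (pd j (f s) u') u') (pd i (f s) u) u
    = W (s, u) \<bullet> Di i (Di j W) (s, u)
      + (\<Sum>k\<in>UNIV. \<Sum>l\<in>UNIV. B (s, u) $ k $ l * h j k (s, u) * h i l (s, u))"
proof -
  let ?z = "(s, u)"
  have z: "?z \<in> S" using s u by simp
  define \<psi> where "\<psi> z = Di j W z - (\<Sum>k\<in>UNIV. \<Sum>l\<in>UNIV. (B z $ k $ l * (Di j W z \<bullet> e k z)) *\<^sub>R e l z)" for z
  have sm: "smooth_on S \<psi>"
    unfolding \<psi>_def
    by (intro smooth_on_diff smooth_on_sum smooth_on_scaleR smooth_on_mult smooth_on_inner open_S smooth_B
        smooth_e smooth_partial smooth_W)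
  have "normal_conn (f s) (w s) (pd j (f s) u') u' = \<psi> (s, u')" if u': "u' \<in> D" for u'
  proof -
    have "pd j (f s) u' = frechet_derivative (f s) (at u') (axis j 1)" by (simp add: pd_def)
    then have "normal_conn (f s) (w s) (pd j (f s) u') u' = normal_part (f s) u' (pd j (w s) u')"
      by (simp add: normal_conn_def inv_f_f[OF slice_inj[OF s u']] pd_def)
    also have "pd j (w s) u' = Di j W (s, u')" by (rule slice_pd[OF smooth_W s u'])
    finally show ?thesis by (simp add: \<psi>_def normal_part_def tangential_slice[OF s u'])
  qed
  then have "dd (axis i 1) (\<lambda>u'. normal_conn (f s) (w s) (pd j (f s) u') u') u = dd (axis i 1) (\<lambda>u'. \<psi> (s, u')) u"
    by (rule dd_cong_open[OF open_D u])
  also have "\<dots> = Di i \<psi> ?z"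
    by (simp add: slice_dd(2)[OF sm s u] Di_def)
  finally have 1: "W ?z \<bullet> normal_conn (f s) (\<lambda>u'. normal_conn (f s) (w s) (pd j (f s) u') u') (pd i (f s) u) u
      = W ?z \<bullet> Di i \<psi> ?z"
    using W_inner_normal_conn[OF s u, of _ "axis i 1"] by (simp add: pd_slice[OF s u] e_def Di_def)
  \<comment> \<open>\<open>\<psi>\<close> differs from \<open>Di j W\<close> by a tangential field,
    so both have the same product with \<open>W\<close> everywhere. Differentiating this equality
    avoids differentiating the projection.\<close>
  have "Di i (\<lambda>z. W z \<bullet> \<psi> z) ?z = Di i (\<lambda>z. W z \<bullet> Di j W z) ?z"
    by (rule partial_cong[OF z]) (simp add: \<psi>_def inner_diff_right inner_sum_right W_normal)
  then have "W ?z \<bullet> Di i \<psi> ?z = W ?z \<bullet> Di i (Di j W) ?z + Di i W ?z \<bullet> Di j W ?z - Di i W ?z \<bullet> \<psi> ?z"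
    by (simp add: partial_inner[OF smooth_W sm z] partial_inner[OF smooth_W smooth_partial(1)[OF smooth_W] z])
  also have "Di i W ?z \<bullet> \<psi> ?z = Di i W ?z \<bullet> Di j W ?z
      - (\<Sum>k\<in>UNIV. \<Sum>l\<in>UNIV. B ?z $ k $ l * h j k ?z * h i l ?z)"
    by (simp add: \<psi>_def inner_diff_right inner_sum_right partial_W_e[OF z])
  finally show ?thesis using 1 by simp
qed

lemma hh_eq1:
  assumes z: "z \<in> S"
  shows "(\<Sum>i\<in>UNIV. \<Sum>j\<in>UNIV. B z $ i $ j * (\<Sum>k\<in>UNIV. \<Sum>l\<in>UNIV. B z $ k $ l * h j k z * h i l z)) = hh z"
proof -
  have "(\<Sum>i\<in>UNIV. \<Sum>j\<in>UNIV. B z $ i $ j * (\<Sum>k\<in>UNIV. \<Sum>l\<in>UNIV. B z $ k $ l * h j k z * h i l z))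
      = (\<Sum>i\<in>UNIV. \<Sum>j\<in>UNIV. \<Sum>k\<in>UNIV. \<Sum>l\<in>UNIV. h j k z * B z $ j $ i * h i l z * B z $ l $ k)"
    by (simp add: sum_distrib_left B_sym[OF z] mult_ac)
  also have "\<dots> = hh z"
    unfolding hh_def by (rule sum4_rotate)
  finally show ?thesis .
qed

lemma hh_eq2:
  assumes z: "z \<in> S"
  shows "(\<Sum>i\<in>UNIV. \<Sum>j\<in>UNIV. \<Sum>k\<in>UNIV. \<Sum>l\<in>UNIV. h i j z * B z $ k $ i * B z $ j $ l * h k l z) = hh z"
  unfolding hh_def
  by (simp add: B_sym[OF z] mult_ac)

text \<open>Matching with \<open>partial_s_tr\<close>: one copy of \<open>hh\<close> comes from the
  normal Laplacian and one from the quadratic curvature term of \<open>L_perp_loc\<close>. The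
  Levi-Civita correction in the Laplacian cancels the tangential part of the frame derivatives
  paired with the acceleration, which leaves the normal acceleration paired with \<open>H\<close>.
  The second variation of area knows nothing of \<open>x0\<close> and \<open>t0\<close>; the terms
  containing them undo the last two summands of \<open>L_perp_loc\<close>.\<close>

lemma W_inner_L_perp:
  assumes s: "s \<in> I" and u: "u \<in> D"
  shows "Ds tr (s, u) = W (s, u) \<bullet> L_perp_loc (f s) x0 t0 (w s) u
    - (W (s, u) \<bullet> W (s, u)) / (2 * t0)
    - (Ds W (s, u) \<bullet> (\<Phi> (s, u) - x0) - normal_part (f s) u (Ds W (s, u)) \<bullet> (\<Phi> (s, u) - x0)) / (2 * t0)
    + normal_part (f s) u (Ds W (s, u)) \<bullet> mean_curv_loc (f s) u"
proof -
  let ?z = "(s, u)"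
  let ?n = "normal_part (f s) u" and ?t = "tangential (f s) u" and ?a = "Ds W ?z"
  have z: "?z \<in> S" using s u by simp
  \<comment> \<open>Coordinates of the Levi-Civita derivative of \<open>e j\<close> in direction
    \<open>e i\<close>.\<close>
  define c where "c i j = (SOME c. ?t (Di i (e j) ?z) = dd (0, c) \<Phi> ?z)" for i j
  have c: "?t (Di i (e j) ?z) = dd (0, c i j) \<Phi> ?z" for i j
    unfolding c_def by (rule someI_ex[OF tangential_coords[OF s u]])
  obtain d where d: "?t (\<Phi> ?z - x0) = dd (0, d) \<Phi> ?z"
    using tangential_coords[OF s u, of "\<Phi> ?z - x0"] by (rule exE)
  have ddw: "dd c (w s) u = dd (0, c) W ?z" for c
    by (rule slice_dd(2)[OF smooth_W s u])
  have lap: "W ?z \<bullet> normal_laplacian (f s) (w s) u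
    = (\<Sum>i\<in>UNIV. \<Sum>j\<in>UNIV. B ?z $ i $ j * (W ?z \<bullet> Di i (Di j W) ?z - W ?z \<bullet> dd (0, c i j) W ?z)) + hh ?z"
    by (simp add: normal_laplacian_def inner_sum_right inner_diff_right inv_metric_slice[OF s u]
        W_inner_normal_hessian[OF s u] pd_pd_slice[OF s u] c W_inner_normal_conn[OF s u] ddw
        hh_eq1[OF z, symmetric] sum.distrib[symmetric] algebra_simps)
  have A2: "W ?z \<bullet> (\<Sum>i\<in>UNIV. \<Sum>j\<in>UNIV. \<Sum>k\<in>UNIV. \<Sum>l\<in>UNIV.
      ((second_ff (f s) u i j \<bullet> W ?z) * inv_metric (f s) u $ k $ i * inv_metric (f s) u $ j $ l)
        *\<^sub>R second_ff (f s) u k l) = hh ?z"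
    using W_inner_second_ff[OF s u]
    by (simp add: inner_sum_right inv_metric_slice[OF s u] hh_eq2[OF z] inner_commute[of _ "W ?z"])
  have conn: "W ?z \<bullet> normal_conn (f s) (w s) (?t (\<Phi> ?z - x0)) u
      = ?n ?a \<bullet> (\<Phi> ?z - x0) - ?a \<bullet> (\<Phi> ?z - x0)"
    using acceleration_tangential_inner[OF s u d]
    by (simp add: d W_inner_normal_conn[OF s u] ddw)
  have L: "W ?z \<bullet> L_perp_loc (f s) x0 t0 (w s) u
    = (\<Sum>i\<in>UNIV. \<Sum>j\<in>UNIV. B ?z $ i $ j * (W ?z \<bullet> Di i (Di j W) ?z - W ?z \<bullet> dd (0, c i j) W ?z)) + 2 * hh ?z
      + (W ?z \<bullet> W ?z) / (2 * t0) - (?n ?a \<bullet> (\<Phi> ?z - x0) - ?a \<bullet> (\<Phi> ?z - x0)) / (2 * t0)"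
    unfolding L_perp_loc_def inner_add_right inner_diff_right[of "W ?z"] inner_scaleR_right A2 lap conn by simp
  have H: "?n ?a \<bullet> mean_curv_loc (f s) u
    = (\<Sum>i\<in>UNIV. \<Sum>j\<in>UNIV. B ?z $ i $ j * (?a \<bullet> Di i (e j) ?z + W ?z \<bullet> dd (0, c i j) W ?z))"
  proof -
    have "?n ?a \<bullet> ?n v = ?n ?a \<bullet> v" for v
      using normal_part_orth[OF slice_differentiable[OF s u] slice_inj[OF s u], of ?a]
        tangential_in_range[OF slice_differentiable[OF s u] slice_inj[OF s u], of v]
      by (auto simp: normal_part_def[of _ _ v] inner_diff_right)
    then have "?n ?a \<bullet> second_ff (f s) u i j = ?a \<bullet> Di i (e j) ?z + W ?z \<bullet> dd (0, c i j) W ?z" for i j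
      using acceleration_tangential_inner[OF s u c]
      by (simp add: second_ff_def pd_pd_slice[OF s u])
    then show ?thesis
      by (simp add: mean_curv_loc_def inner_sum_right inv_metric_slice[OF s u])
  qed
  show ?thesis
    unfolding partial_s_tr[OF z] L H by (simp add: sum.distrib[symmetric] algebra_simps diff_divide_distrib)
qed

end


section \<open>The induced volume measure\<close>

definition vol_density ::
    "('p \<Rightarrow> real^'m::finite) \<Rightarrow> (real^'n::finite \<Rightarrow> 'p) \<Rightarrow> real^'n \<Rightarrow> real" where
  "vol_density X \<phi> u = sqrt (det (metric (X \<circ> \<phi>) u))"

definition chart_measure ::
    "('p::topological_space \<Rightarrow> real^'m::finite) \<Rightarrow> ('n::finite, 'p) chart \<Rightarrow> 'p measure" where
  "chart_measure X c = distr
     (density (restrict_space lborel (fst c)) (\<lambda>u. ennreal (vol_density X (snd c) u))) borel (snd c)"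

text \<open>The condition that specifies \<open>volume_measure\<close>, with the integral over the
  coordinate domain replaced by a push-forward measure, so that countable additivity over pieces is
  available at once.\<close>

definition has_chart_densities ::
    "('n::finite, 'p::topological_space) chart set \<Rightarrow> ('p \<Rightarrow> real^'m::finite) \<Rightarrow> 'p measure \<Rightarrow> bool" where
  "has_chart_densities A X \<mu> \<longleftrightarrow> sets \<mu> = sets borel \<and>
     (\<forall>c\<in>A. \<forall>E\<in>sets borel. E \<subseteq> snd c ` fst c \<longrightarrow> emeasure \<mu> E = emeasure (chart_measure X c) E)"

locale manifold =
  fixes A :: "('n::finite, 'p::{t2_space, second_countable_topology}) chart set"
  assumes atlas: "smooth_atlas A"
begin

lemma
  assumes "(D, \<phi>) \<in> A"
  shows open_domain: "open D" and open_image: "open (\<phi> ` D)" and inj_chart: "inj_on \<phi> D"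
    and chart_continuous: "continuous_on D \<phi>" and chart_inv_continuous: "continuous_on (\<phi> ` D) (inv_into D \<phi>)"
proof -
  have *: "open D \<and> open (\<phi> ` D) \<and> homeomorphism D (\<phi> ` D) \<phi> (inv_into D \<phi>)"
    using assms atlas unfolding smooth_atlas_def by blast
  then show "open D" "open (\<phi> ` D)" "continuous_on D \<phi>" "continuous_on (\<phi> ` D) (inv_into D \<phi>)"
    by (auto simp: homeomorphism_def)
  show "inj_on \<phi> D"
    by (rule inj_on_inverseI[of _ "inv_into D \<phi>"]) (use * in \<open>simp add: homeomorphism_def\<close>)
qed

lemma charts_cover: "\<exists>D \<phi>. (D, \<phi>) \<in> A \<and> p \<in> \<phi> ` D"
proof -
  have "p \<in> (\<Union>(D, \<phi>)\<in>A. \<phi> ` D)" using atlas by (simp add: smooth_atlas_def)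
  then show ?thesis by blast
qed

lemma chart_at:
  "(fst (chart_at A p), param_at A p) \<in> A" (is ?A)
  "coord_at A p \<in> fst (chart_at A p)" (is ?B)
  "param_at A p (coord_at A p) = p" (is ?C)
proof -
  have ex: "\<exists>c. c \<in> A \<and> p \<in> snd c ` fst c" using charts_cover[of p] by force
  have *: "chart_at A p \<in> A \<and> p \<in> snd (chart_at A p) ` fst (chart_at A p)"
    unfolding chart_at_def by (rule someI_ex[OF ex])
  then show ?A by (simp add: param_at_def)
  show ?B ?C unfolding coord_at_def param_at_def
    using * by (simp_all add: inv_into_into f_inv_into_f)
qed

lemma chart_borel:
  assumes c: "(D, \<phi>) \<in> A" and B: "B \<in> sets borel"
  shows "D \<inter> \<phi> -` B \<in> sets borel"
proof -
  have "\<phi> \<in> borel_measurable (restrict_space borel D)"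
    by (rule borel_measurable_continuous_on_restrict[OF chart_continuous[OF c]])
  from measurable_sets[OF this B] open_domain[OF c] show ?thesis
    by (simp add: space_restrict_space sets_restrict_space_iff Int_commute)
qed

section \<open>Transition maps between two charts\<close>

context
  fixes D E :: "(real^'n) set" and \<phi> \<psi>
  assumes c1: "(D, \<phi>) \<in> A" and c2: "(E, \<psi>) \<in> A"
begin

lemma transition:
  assumes u: "u \<in> D \<inter> \<phi> -` (\<psi> ` E)"
  shows "\<psi> (inv_into E \<psi> (\<phi> u)) = \<phi> u" "inv_into E \<psi> (\<phi> u) \<in> E"
  using u by (auto simp: f_inv_into_f inv_into_into)

lemma transition_open: "open (D \<inter> \<phi> -` (\<psi> ` E))"
  by (rule continuous_open_preimage[OF chart_continuous[OF c1] open_domain[OF c1] open_image[OF c2]])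

lemma transition_smooth: "smooth_on (D \<inter> \<phi> -` (\<psi> ` E)) (inv_into E \<psi> \<circ> \<phi>)"
  using atlas c1 c2 unfolding smooth_atlas_def by blast

lemma transition_has_derivative:
  "u \<in> D \<inter> \<phi> -` (\<psi> ` E) \<Longrightarrow>
    ((\<lambda>u. inv_into E \<psi> (\<phi> u)) has_derivative frechet_derivative (inv_into E \<psi> \<circ> \<phi>) (at u)) (at u)"
  using smooth_on_has_derivative[OF transition_smooth] by (simp add: o_def)

lemma frechet_transition:
  fixes X :: "'p \<Rightarrow> real^'m::finite"
  assumes X: "smooth_on E (X \<circ> \<psi>)" and u: "u \<in> D \<inter> \<phi> -` (\<psi> ` E)"
  shows "frechet_derivative (X \<circ> \<phi>) (at u) v =
    frechet_derivative (X \<circ> \<psi>) (at (inv_into E \<psi> (\<phi> u))) (frechet_derivative (inv_into E \<psi> \<circ> \<phi>) (at u) v)"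
proof (rule dd_eqI)
  have "((\<lambda>u. (X \<circ> \<psi>) (inv_into E \<psi> (\<phi> u))) has_derivative (\<lambda>v.
    frechet_derivative (X \<circ> \<psi>) (at (inv_into E \<psi> (\<phi> u))) (frechet_derivative (inv_into E \<psi> \<circ> \<phi>) (at u) v))) (at u)"
    by (rule has_derivative_compose[OF transition_has_derivative[OF u]
          smooth_on_has_derivative[OF X transition(2)[OF u]]])
  then show "(X \<circ> \<phi> has_derivative (\<lambda>v.
    frechet_derivative (X \<circ> \<psi>) (at (inv_into E \<psi> (\<phi> u))) (frechet_derivative (inv_into E \<psi> \<circ> \<phi>) (at u) v))) (at u)"
    by (rule has_derivative_transform_within_open[OF _ transition_open u]) (simp add: transition)
qed

text \<open>The metric transforms by the Jacobian matrix on both sides, so its determinant gains the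
  squared Jacobian determinant. This is exactly the factor that the change of variables demands, and
  it does not depend on the immersion.\<close>

lemma vol_density_transition:
  fixes X :: "'p \<Rightarrow> real^'m::finite"
  assumes X: "smooth_on E (X \<circ> \<psi>)" and u: "u \<in> D \<inter> \<phi> -` (\<psi> ` E)"
  shows "vol_density X \<phi> u = \<bar>det (matrix (frechet_derivative (inv_into E \<psi> \<circ> \<phi>) (at u)))\<bar>
    * vol_density X \<psi> (inv_into E \<psi> (\<phi> u))"
proof -
  define L where "L = frechet_derivative (inv_into E \<psi> \<circ> \<phi>) (at u)"
  define K where "K = frechet_derivative (X \<circ> \<psi>) (at (inv_into E \<psi> (\<phi> u)))"
  let ?G = "metric (X \<circ> \<psi>) (inv_into E \<psi> (\<phi> u))"
  have K: "linear K" unfolding K_def by (rule smooth_on_linear[OF X transition(2)[OF u]])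
  have "metric (X \<circ> \<phi>) u $ i $ j = (transpose (matrix L) ** ?G ** matrix L) $ i $ j" for i j
  proof -
    have "metric (X \<circ> \<phi>) u $ i $ j = K (L (axis i 1)) \<bullet> K (L (axis j 1))"
      by (simp add: metric_def pd_def frechet_transition[OF X u] L_def K_def)
    also have "\<dots> = (\<Sum>l\<in>UNIV. \<Sum>k\<in>UNIV. matrix L $ k $ i * ?G $ k $ l * matrix L $ l $ j)"
      unfolding linear_axis_expansion[OF K, of "L _"]
      by (simp add: inner_sum_left inner_sum_right metric_def pd_def K_def[symmetric] matrix_def
          sum_distrib_left mult_ac)
    also have "\<dots> = (transpose (matrix L) ** ?G ** matrix L) $ i $ j"
      by (simp add: matrix_matrix_mult_def transpose_def sum_distrib_right)
    finally show ?thesis .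
  qed
  then have "metric (X \<circ> \<phi>) u = transpose (matrix L) ** ?G ** matrix L"
    by (simp add: vec_eq_iff)
  then have "det (metric (X \<circ> \<phi>) u) = (det (matrix L))\<^sup>2 * det ?G"
    by (simp add: det_mul det_transpose power2_eq_square)
  then show ?thesis
    by (simp add: vol_density_def L_def real_sqrt_mult)
qed

end

end

locale immersed_manifold = manifold A
  for A :: "('n::finite, 'p::{t2_space, second_countable_topology}) chart set" +
  fixes X :: "'p \<Rightarrow> real^'m::finite"
  assumes imm: "smooth_immersion A X"
begin

lemma smooth_X: "(D, \<phi>) \<in> A \<Longrightarrow> smooth_on D (X \<circ> \<phi>)"
  and inj_X: "(D, \<phi>) \<in> A \<Longrightarrow> u \<in> D \<Longrightarrow> inj (frechet_derivative (X \<circ> \<phi>) (at u))"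
  using imm unfolding smooth_immersion_def by auto

lemma vol_density_pos: "(D, \<phi>) \<in> A \<Longrightarrow> u \<in> D \<Longrightarrow> vol_density X \<phi> u > 0"
  unfolding vol_density_def
  by (simp add: metric_pos_def smooth_on_differentiable[OF smooth_X] inj_X)

lemma vol_density_continuous: "(D, \<phi>) \<in> A \<Longrightarrow> continuous_on D (vol_density X \<phi>)"
proof -
  assume c: "(D, \<phi>) \<in> A"
  have "smooth_on D (\<lambda>u. metric (X \<circ> \<phi>) u $ i $ j)" for i j
    by (simp add: metric_def pd_def smooth_on_inner smooth_on_dd[OF smooth_X[OF c]] open_domain[OF c])
  then have "smooth_on D (\<lambda>u. det (metric (X \<circ> \<phi>) u))"
    by (rule smooth_on_det[OF open_domain[OF c]])
  then show ?thesis
    unfolding vol_density_def by (intro continuous_on_real_sqrt smooth_on_continuous)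
qed

lemma vol_density_measurable:
  assumes c: "(D, \<phi>) \<in> A"
  shows "(\<lambda>u. ennreal (vol_density X \<phi> u)) \<in> borel_measurable (restrict_space lborel D)"
  using borel_measurable_continuous_on_restrict[OF vol_density_continuous[OF c]]
  by (simp cong: measurable_cong_sets add: sets_restrict_space_cong[OF sets_lborel])

lemma chart_measurable:
  assumes c: "(D, \<phi>) \<in> A"
  shows "\<phi> \<in> restrict_space lborel D \<rightarrow>\<^sub>M borel"
  using borel_measurable_continuous_on_restrict[OF chart_continuous[OF c]]
  by (simp cong: measurable_cong_sets add: sets_restrict_space_cong[OF sets_lborel])

lemma sets_chart_measure [simp]: "sets (chart_measure X c) = sets borel"
  by (simp add: chart_measure_def)

lemma nn_integral_chart_measure:
  fixes k :: "'p \<Rightarrow> ennreal"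
  assumes c: "(D, \<phi>) \<in> A" and k: "k \<in> borel_measurable borel"
  shows "(\<integral>\<^sup>+p. k p \<partial>chart_measure X (D, \<phi>)) = (\<integral>\<^sup>+u\<in>D. ennreal (vol_density X \<phi> u) * k (\<phi> u) \<partial>lborel)"
proof -
  have k': "(\<lambda>u. k (\<phi> u)) \<in> borel_measurable (restrict_space lborel D)"
    using measurable_compose[OF chart_measurable[OF c] k] .
  have "(\<integral>\<^sup>+p. k p \<partial>chart_measure X (D, \<phi>))
    = (\<integral>\<^sup>+u. k (\<phi> u) \<partial>density (restrict_space lborel D) (\<lambda>u. ennreal (vol_density X \<phi> u)))"
    unfolding chart_measure_def using chart_measurable[OF c] k by (subst nn_integral_distr) auto
  also have "\<dots> = (\<integral>\<^sup>+u. ennreal (vol_density X \<phi> u) * k (\<phi> u) \<partial>restrict_space lborel D)"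
    by (rule nn_integral_density[OF vol_density_measurable[OF c] k'])
  also have "\<dots> = (\<integral>\<^sup>+u\<in>D. ennreal (vol_density X \<phi> u) * k (\<phi> u) \<partial>lborel)"
    using open_domain[OF c] by (subst nn_integral_restrict_space) auto
  finally show ?thesis .
qed

lemma emeasure_chart_measure:
  assumes c: "(D, \<phi>) \<in> A" and B: "B \<in> sets borel"
  shows "emeasure (chart_measure X (D, \<phi>)) B = (\<integral>\<^sup>+u\<in>D \<inter> \<phi> -` B. vol_density X \<phi> u \<partial>lborel)"
proof -
  have "emeasure (chart_measure X (D, \<phi>)) B = (\<integral>\<^sup>+p. indicator B p \<partial>chart_measure X (D, \<phi>))"
    using B by simp
  also have "\<dots> = (\<integral>\<^sup>+u\<in>D. ennreal (vol_density X \<phi> u) * indicator B (\<phi> u) \<partial>lborel)"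
    using B by (intro nn_integral_chart_measure[OF c]) simp
  also have "\<dots> = (\<integral>\<^sup>+u\<in>D \<inter> \<phi> -` B. vol_density X \<phi> u \<partial>lborel)"
    by (intro nn_integral_cong) (auto simp: indicator_def)
  finally show ?thesis .
qed

text \<open>On the overlap of two charts the transition map carries one coordinate domain to the
  other, and the Jacobian factor in the densities is that of the change of variables.\<close>

lemma chart_measure_agree:
  assumes c1: "(D, \<phi>) \<in> A" and c2: "(E, \<psi>) \<in> A"
    and B: "B \<in> sets borel" "B \<subseteq> \<phi> ` D" "B \<subseteq> \<psi> ` E"
  shows "emeasure (chart_measure X (D, \<phi>)) B = emeasure (chart_measure X (E, \<psi>)) B"
proof -
  let ?T = "\<lambda>u. inv_into E \<psi> (\<phi> u)" and ?S = "D \<inter> \<phi> -` B"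
  have sub: "?S \<subseteq> D \<inter> \<phi> -` (\<psi> ` E)" using B by auto
  have im: "?T ` ?S = E \<inter> \<psi> -` B"
  proof
    show "?T ` ?S \<subseteq> E \<inter> \<psi> -` B"
      using transition[OF c1 c2 subsetD[OF sub]] by auto
    show "E \<inter> \<psi> -` B \<subseteq> ?T ` ?S"
    proof
      fix v assume v: "v \<in> E \<inter> \<psi> -` B"
      then obtain u where u: "u \<in> D" "\<psi> v = \<phi> u" using B by blast
      then have "?T u = v" using v inj_chart[OF c2] by (metis IntD1 inv_into_f_f)
      then show "v \<in> ?T ` ?S" using u v by force
    qed
  qed
  have meas: "set_borel_measurable borel (D' \<inter> \<phi>' -` B) (vol_density X \<phi>')" if "(D', \<phi>') \<in> A" for D' \<phi>'
    using vol_density_continuous[OF that] chart_borel[OF that B(1)]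
    by (intro borel_measurable_continuous_on_indicator[folded set_borel_measurable_def])
      (auto intro: continuous_on_subset simp: set_borel_measurable_def)
  have "(\<integral>\<^sup>+u\<in>?S. vol_density X \<phi> u \<partial>lborel) = (\<integral>\<^sup>+v\<in>?T ` ?S. vol_density X \<psi> v \<partial>lborel)"
  proof (rule nn_integral_change_of_variables)
    show "(?T has_derivative frechet_derivative (inv_into E \<psi> \<circ> \<phi>) (at u)) (at u)" if "u \<in> ?S" for u
      by (rule transition_has_derivative[OF c1 c2 subsetD[OF sub that]])
    show "inj_on ?T ?S"
    proof (rule inj_onI)
      fix u v assume uv: "u \<in> ?S" "v \<in> ?S" "?T u = ?T v"
      have "\<phi> u = \<psi> (?T u)" by (rule transition(1)[OF c1 c2 subsetD[OF sub uv(1)], symmetric])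
      also have "\<dots> = \<psi> (?T v)" by (simp only: uv(3))
      also have "\<dots> = \<phi> v" by (rule transition(1)[OF c1 c2 subsetD[OF sub uv(2)]])
      finally show "u = v" by (rule inj_onD[OF inj_chart[OF c1]]) (use uv(1,2) in auto)
    qed
    show "vol_density X \<phi> u = \<bar>det (matrix (frechet_derivative (inv_into E \<psi> \<circ> \<phi>) (at u)))\<bar> * vol_density X \<psi> (?T u)"
      if "u \<in> ?S" for u
      by (rule vol_density_transition[OF c1 c2 smooth_X[OF c2] subsetD[OF sub that]])
    show "0 \<le> vol_density X \<psi> v" if "v \<in> ?T ` ?S" for v
      using that unfolding im by (auto intro: less_imp_le[OF vol_density_pos[OF c2]])
    show "set_borel_measurable borel (?T ` ?S) (vol_density X \<psi>)"
      unfolding im by (rule meas[OF c2])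
  qed (rule chart_borel[OF c1 B(1)], rule meas[OF c1])
  then show ?thesis
    by (simp add: emeasure_chart_measure[OF c1 B(1)] emeasure_chart_measure[OF c2 B(1)] im)
qed

text \<open>The atlas may be uncountable. Second countability leaves countably many charts that
  still cover, and these are made disjoint; cutting any Borel set along the pieces reduces
  statements about measures to single charts.\<close>

lemma countable_partition:
  "\<exists>c P. range c \<subseteq> A \<and> disjoint_family (P :: nat \<Rightarrow> 'p set) \<and> (\<Union>n. P n) = UNIV \<and>
    (\<forall>n. P n \<in> sets borel \<and> P n \<subseteq> snd (c n) ` fst (c n))"
proof -
  have op: "open U" if "U \<in> (\<lambda>c. snd c ` fst c) ` A" for U
    using that open_image by auto
  obtain F where F: "F \<subseteq> (\<lambda>c. snd c ` fst c) ` A" "countable F" "\<Union>F = \<Union>((\<lambda>c. snd c ` fst c) ` A)"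
    by (rule Lindelof[OF op]) (assumption, rule that)
  obtain A' where A': "A' \<subseteq> A" "countable A'" "F = (\<lambda>c. snd c ` fst c) ` A'"
    using countable_subset_image[THEN iffD1, OF conjI[OF F(2) F(1)]] by auto
  have cover: "(\<Union>c\<in>A'. snd c ` fst c) = UNIV"
    using F(3) charts_cover unfolding A'(3) by force
  then have "A' \<noteq> {}" by auto
  define c where "c = from_nat_into A'"
  have ran: "range c = A'" unfolding c_def by (rule range_from_nat_into[OF \<open>A' \<noteq> {}\<close> A'(2)])
  define P where "P = disjointed (\<lambda>n. snd (c n) ` fst (c n))"
  have "(\<Union>n. P n) = (\<Union>n. snd (c n) ` fst (c n))"
    unfolding P_def by (rule UN_disjointed_eq)
  also have "\<dots> = UNIV" using cover unfolding ran[symmetric] by simp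
  finally have "(\<Union>n. P n) = UNIV" .
  moreover have "range (\<lambda>n. snd (c n) ` fst (c n)) \<subseteq> sets borel"
    using op ran A'(1) by auto
  then have "range P \<subseteq> sets borel"
    unfolding P_def using sets.range_disjointed_sets by blast
  ultimately show ?thesis
    using ran A'(1) disjoint_family_disjointed[of "\<lambda>n. snd (c n) ` fst (c n)"]
      disjointed_subset[of "\<lambda>n. snd (c n) ` fst (c n)"]
    by (intro exI[of _ c] exI[of _ P]) (auto simp: P_def)
qed

lemma has_chart_densities_unique:
  assumes "has_chart_densities A X \<mu>" "has_chart_densities A X \<nu>"
  shows "\<mu> = \<nu>"
proof (rule measure_eqI)
  obtain c and P :: "nat \<Rightarrow> 'p set" where c: "range c \<subseteq> A" and P: "disjoint_family P" "(\<Union>n. P n) = UNIV"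
    "\<And>n. P n \<in> sets borel" "\<And>n. P n \<subseteq> snd (c n) ` fst (c n)"
    using countable_partition by metis
  have sets: "sets \<mu> = sets borel" "sets \<nu> = sets borel"
    using assms by (auto simp: has_chart_densities_def)
  then show "sets \<mu> = sets \<nu>" by simp
  fix E assume "E \<in> sets \<mu>"
  then have E: "E \<in> sets borel" by (simp add: sets)
  have decomp: "emeasure M E = (\<Sum>n. emeasure M (E \<inter> P n))" if "sets M = sets borel" for M
  proof -
    have "(\<Sum>n. emeasure M (E \<inter> P n)) = emeasure M (\<Union>n. E \<inter> P n)"
      using E P(1,3) that by (intro suminf_emeasure) (auto simp: disjoint_family_on_def)
    also have "(\<Union>n. E \<inter> P n) = E" using P(2) by blast
    finally show ?thesis by simp
  qed
  have "emeasure \<mu> (E \<inter> P n) = emeasure \<nu> (E \<inter> P n)" for n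
  proof -
    have "E \<inter> P n \<in> sets borel" "E \<inter> P n \<subseteq> snd (c n) ` fst (c n)" "c n \<in> A"
      using E P(3,4)[of n] c by auto
    then show ?thesis using assms unfolding has_chart_densities_def by metis
  qed
  then show "emeasure \<mu> E = emeasure \<nu> E"
    by (simp add: decomp sets)
qed

text \<open>The chart measures are glued along the disjoint pieces. That the result is right in
  every chart of the atlas, not only in the selected ones, is the agreement on overlaps.\<close>

lemma has_chart_densities_exists: "\<exists>\<mu>. has_chart_densities A X \<mu>"
proof -
  obtain c and P :: "nat \<Rightarrow> 'p set" where c: "range c \<subseteq> A" and P: "disjoint_family P" "(\<Union>n. P n) = UNIV"
    "\<And>n. P n \<in> sets borel" "\<And>n. P n \<subseteq> snd (c n) ` fst (c n)"
    using countable_partition by metis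
  \<comment> \<open>The sum over the pieces is written as an integral over counting measure, so that
    countable additivity becomes an exchange of sum and integral.\<close>
  define m where "m E = (\<integral>\<^sup>+n. emeasure (chart_measure X (c n)) (E \<inter> P n) \<partial>count_space UNIV)" for E
  define \<mu> where "\<mu> = measure_of UNIV (sets borel) m"
  have sets: "sets \<mu> = sets borel"
    unfolding \<mu>_def using sets.sigma_sets_eq[of "borel :: 'p measure"] by (simp add: sets_measure_of)
  have em: "emeasure \<mu> E = m E" if "E \<in> sets borel" for E
  proof (rule emeasure_measure_of[OF \<mu>_def])
    show "positive (sets \<mu>) m" by (simp add: positive_def m_def)
    show "countably_additive (sets \<mu>) m"
    proof (rule countably_additiveI)
      fix F :: "nat \<Rightarrow> 'p set"
      assume F: "range F \<subseteq> sets \<mu>" "disjoint_family F"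
      have "(\<Sum>i. m (F i)) = (\<integral>\<^sup>+n. (\<Sum>i. emeasure (chart_measure X (c n)) (F i \<inter> P n)) \<partial>count_space UNIV)"
        unfolding m_def by (subst nn_integral_suminf) auto
      also have "\<dots> = m (\<Union>(range F))"
        unfolding m_def
      proof (rule nn_integral_cong)
        fix n
        have "(\<Sum>i. emeasure (chart_measure X (c n)) (F i \<inter> P n)) = emeasure (chart_measure X (c n)) (\<Union>i. F i \<inter> P n)"
          using F P(3) sets by (intro suminf_emeasure) (auto simp: disjoint_family_on_def)
        also have "(\<Union>i. F i \<inter> P n) = \<Union>(range F) \<inter> P n" by blast
        finally show "(\<Sum>i. emeasure (chart_measure X (c n)) (F i \<inter> P n))
          = emeasure (chart_measure X (c n)) (\<Union>(range F) \<inter> P n)" .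
      qed
      finally show "(\<Sum>i. m (F i)) = m (\<Union>(range F))" .
    qed
  qed (use that sets in auto)
  have "emeasure \<mu> E = emeasure (chart_measure X d) E"
    if d: "d \<in> A" and E: "E \<in> sets borel" "E \<subseteq> snd d ` fst d" for d E
  proof -
    have "emeasure (chart_measure X (c n)) (E \<inter> P n) = emeasure (chart_measure X d) (E \<inter> P n)" for n
      using chart_measure_agree[of "fst (c n)" "snd (c n)" "fst d" "snd d" "E \<inter> P n"] c d E P(3)[of n] P(4)[of n]
      by auto
    then have "emeasure \<mu> E = (\<Sum>n. emeasure (chart_measure X d) (E \<inter> P n))"
      by (simp add: em[OF E(1)] m_def nn_integral_count_space_nat)
    also have "\<dots> = emeasure (chart_measure X d) (\<Union>n. E \<inter> P n)"
      using E P(1,3) by (intro suminf_emeasure) (auto simp: disjoint_family_on_def)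
    also have "(\<Union>n. E \<inter> P n) = E" using P(2) by blast
    finally show ?thesis .
  qed
  then show ?thesis using sets by (auto simp: has_chart_densities_def)
qed

lemma volume_measure_eqI: "has_chart_densities A X \<mu> \<Longrightarrow> volume_measure A X = \<mu>"
  and has_chart_densities_volume_measure: "has_chart_densities A X (volume_measure A X)"
proof -
  have eq: "volume_measure A X = (THE \<mu>. has_chart_densities A X \<mu>)"
    unfolding volume_measure_def has_chart_densities_def
  proof (intro arg_cong[where f = The] ext conj_cong refl)
    fix \<mu> :: "'p measure"
    show "(\<forall>(D, \<phi>)\<in>A. \<forall>E\<in>sets borel. E \<subseteq> \<phi> ` D \<longrightarrow>
        emeasure \<mu> E = (\<integral>\<^sup>+u\<in>(D \<inter> \<phi> -` E). ennreal (sqrt (det (metric (X \<circ> \<phi>) u))) \<partial>lborel))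
      \<longleftrightarrow> (\<forall>c\<in>A. \<forall>E\<in>sets borel. E \<subseteq> snd c ` fst c \<longrightarrow> emeasure \<mu> E = emeasure (chart_measure X c) E)"
      by (auto simp: emeasure_chart_measure vol_density_def split_beta)
  qed
  show *: "has_chart_densities A X \<mu> \<Longrightarrow> volume_measure A X = \<mu>" for \<mu>
    unfolding eq by (blast intro: has_chart_densities_unique)
  then show "has_chart_densities A X (volume_measure A X)"
    using has_chart_densities_exists by metis
qed

lemma sets_volume_measure [simp]: "sets (volume_measure A X) = sets borel"
  using has_chart_densities_volume_measure by (simp add: has_chart_densities_def)

lemma space_volume_measure [simp]: "space (volume_measure A X) = UNIV"
  using sets_eq_imp_space_eq[OF sets_volume_measure] by simp

lemma measurable_volume_measure [simp]: "borel_measurable (volume_measure A X) = borel_measurable borel"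
  by (rule measurable_cong_sets) simp_all

text \<open>Cutting sets down to the image of the chart changes neither side, so the volume measure
  restricted to this image is the push-forward measure of the chart.\<close>

lemma nn_integral_volume_measure_chart:
  fixes k :: "'p \<Rightarrow> ennreal"
  assumes c: "(D, \<phi>) \<in> A" and k: "k \<in> borel_measurable borel"
  shows "(\<integral>\<^sup>+p\<in>\<phi> ` D. k p \<partial>volume_measure A X) = (\<integral>\<^sup>+u\<in>D. ennreal (vol_density X \<phi> u) * k (\<phi> u) \<partial>lborel)"
proof -
  let ?\<mu> = "volume_measure A X"
  have im: "\<phi> ` D \<in> sets borel" using open_image[OF c] by simp
  have "density ?\<mu> (indicator (\<phi> ` D)) = chart_measure X (D, \<phi>)"
  proof (rule measure_eqI)
    fix E assume "E \<in> sets (density ?\<mu> (indicator (\<phi> ` D)))"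
    then have E: "E \<in> sets borel" by simp
    have "emeasure (density ?\<mu> (indicator (\<phi> ` D))) E = (\<integral>\<^sup>+p. indicator (\<phi> ` D) p * indicator E p \<partial>?\<mu>)"
      using E im by (intro emeasure_density) auto
    also have "\<dots> = (\<integral>\<^sup>+p. indicator (E \<inter> \<phi> ` D) p \<partial>?\<mu>)"
      by (intro nn_integral_cong) (simp split: split_indicator)
    also have "\<dots> = emeasure ?\<mu> (E \<inter> \<phi> ` D)" using E im by (intro nn_integral_indicator) auto
    also have "\<dots> = emeasure (chart_measure X (D, \<phi>)) (E \<inter> \<phi> ` D)"
      using has_chart_densities_volume_measure c E im unfolding has_chart_densities_def by fastforce
    also have "\<dots> = emeasure (chart_measure X (D, \<phi>)) E"
      using E im by (simp add: emeasure_chart_measure[OF c]) (intro nn_integral_cong, auto simp: indicator_def)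
    finally show "emeasure (density ?\<mu> (indicator (\<phi> ` D))) E = emeasure (chart_measure X (D, \<phi>)) E" .
  qed simp
  moreover have "(\<integral>\<^sup>+p\<in>\<phi> ` D. k p \<partial>?\<mu>) = (\<integral>\<^sup>+p. k p \<partial>density ?\<mu> (indicator (\<phi> ` D)))"
    using im k by (subst nn_integral_density) (auto simp: mult.commute)
  ultimately show ?thesis by (simp add: nn_integral_chart_measure[OF c k])
qed

end


section \<open>Dominated differentiation and Gaussian integrals\<close>

text \<open>Difference quotients are taken along sequences tending to \<open>s\<close>, where
  dominated convergence applies. The mean value inequality on the convex set \<open>S\<close> bounds
  them by \<open>B\<close>.\<close>

lemma has_real_derivative_integral:
  fixes f f' :: "real \<Rightarrow> 'a \<Rightarrow> real"
  assumes S: "open S" "convex S" "s \<in> S"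
    and int: "\<And>s. s \<in> S \<Longrightarrow> integrable M (f s)"
    and der: "\<And>s p. s \<in> S \<Longrightarrow> p \<in> space M \<Longrightarrow> ((\<lambda>s. f s p) has_real_derivative f' s p) (at s)"
    and bound: "\<And>s p. s \<in> S \<Longrightarrow> p \<in> space M \<Longrightarrow> \<bar>f' s p\<bar> \<le> B p"
    and B: "integrable M B" and f': "f' s \<in> borel_measurable M"
  shows "((\<lambda>s. \<integral>p. f s p \<partial>M) has_real_derivative (\<integral>p. f' s p \<partial>M)) (at s)"
proof -
  have "((\<lambda>r. ((\<integral>p. f r p \<partial>M) - (\<integral>p. f s p \<partial>M)) / (r - s)) \<longlongrightarrow> (\<integral>p. f' s p \<partial>M)) (at s within S)"
    unfolding tendsto_at_iff_sequentially
  proof (intro allI impI)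
    fix R :: "nat \<Rightarrow> real"
    assume R: "\<forall>i. R i \<in> S - {s}" "R \<longlonglongrightarrow> s"
    have RS: "R i \<in> S" "R i \<noteq> s" for i using R(1) by auto
    have "(\<lambda>i. \<integral>p. (f (R i) p - f s p) / (R i - s) \<partial>M) \<longlonglongrightarrow> (\<integral>p. f' s p \<partial>M)"
    proof (rule integral_dominated_convergence[OF f' _ B])
      show "(\<lambda>p. (f (R i) p - f s p) / (R i - s)) \<in> borel_measurable M" for i
        using int[OF RS(1)] int[OF S(3)] by measurable
      show "AE p in M. (\<lambda>i. (f (R i) p - f s p) / (R i - s)) \<longlonglongrightarrow> f' s p"
      proof (rule AE_I2)
        fix p assume "p \<in> space M"
        then have "((\<lambda>r. (f r p - f s p) / (r - s)) \<longlongrightarrow> f' s p) (at s)"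
          using der[OF S(3)] by (simp add: has_field_derivative_iff)
        moreover have "filterlim R (at s) sequentially"
          using R(2) RS(2) by (auto simp: filterlim_at)
        ultimately show "(\<lambda>i. (f (R i) p - f s p) / (R i - s)) \<longlonglongrightarrow> f' s p"
          by (rule filterlim_compose)
      qed
      show "AE p in M. norm ((f (R i) p - f s p) / (R i - s)) \<le> B p" for i
      proof (rule AE_I2)
        fix p assume p: "p \<in> space M"
        have "norm (f (R i) p - f s p) \<le> B p * norm (R i - s)"
          by (rule field_differentiable_bound[OF S(2), where f' = "\<lambda>s. f' s p"])
            (use der bound p RS S(3) in \<open>auto intro: has_field_derivative_at_within\<close>)
        then show "norm ((f (R i) p - f s p) / (R i - s)) \<le> B p"
          using RS(2)[of i] by (simp add: divide_le_eq)
      qed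
    qed
    moreover have "(\<integral>p. (f (R i) p - f s p) / (R i - s) \<partial>M) = ((\<integral>p. f (R i) p \<partial>M) - (\<integral>p. f s p \<partial>M)) / (R i - s)" for i
      using int[OF RS(1)] int[OF S(3)] by simp
    ultimately show "((\<lambda>r. ((\<integral>p. f r p \<partial>M) - (\<integral>p. f s p \<partial>M)) / (r - s)) \<circ> R) \<longlonglongrightarrow> (\<integral>p. f' s p \<partial>M)"
      unfolding o_def by (simp only:)
  qed
  then show ?thesis
    unfolding has_field_derivative_iff at_within_open[OF S(3,1)] .
qed

section \<open>Integrability of Gaussians under polynomial volume growth\<close>

lemma power_le_exp:
  fixes x c :: real
  assumes "x \<ge> 0" "c > 0"
  shows "x ^ k \<le> fact k / c ^ k * exp (c * x)"
proof -
  \<comment> \<open>A single term of the exponential series, all of whose terms are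
    nonnegative.\<close>
  have "(c * x) ^ k / fact k = (\<Sum>n\<in>{k}. (c * x) ^ n /\<^sub>R fact n)" by (simp add: field_simps)
  also have "\<dots> \<le> exp (c * x)"
    unfolding exp_def using assms by (intro sum_le_suminf summable_exp_generic) auto
  finally show ?thesis
    using assms by (simp add: field_simps power_mult_distrib)
qed

lemma summable_gaussian_power:
  assumes c: "c > 0"
  shows "summable (\<lambda>j::nat. exp (- c * (real j)\<^sup>2) * (real j + 1) ^ k)"
proof -
  \<comment> \<open>The factor \<open>exp (2 * c)\<close> pays for replacing the square of
    \<open>j\<close> by \<open>j - 1\<close>, the other one for absorbing the power into half of the
    exponential decay. The other half leaves a geometric series with ratio
    \<open>exp (- c / 2)\<close>.\<close>
  define K where "K = exp (2 * c) * (fact k / (c / 2) ^ k)"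
  have bound: "norm (exp (- c * (real j)\<^sup>2) * (real j + 1) ^ k) \<le> K * exp (- c / 2) ^ Suc j" for j
  proof -
    have "real j \<le> (real j)\<^sup>2" by (cases j) (auto simp: power2_eq_square)
    then have "c * (real j + 1 - 2) \<le> c * (real j)\<^sup>2" by (intro mult_left_mono) (use c in linarith)+
    then have "exp (- c * (real j)\<^sup>2) \<le> exp (2 * c + - (c * (real j + 1)))"
      by (simp add: algebra_simps)
    moreover have "(real j + 1) ^ k \<le> fact k / (c / 2) ^ k * exp (c / 2 * (real j + 1))"
      using c by (intro power_le_exp) auto
    ultimately have "exp (- c * (real j)\<^sup>2) * (real j + 1) ^ k \<le>
        exp (2 * c + - (c * (real j + 1))) * (fact k / (c / 2) ^ k * exp (c / 2 * (real j + 1)))"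
      by (intro mult_mono) auto
    also have "\<dots> = K * (exp (- (c * (real j + 1))) * exp (c / 2 * (real j + 1)))"
      by (simp only: K_def exp_add mult_ac)
    also have "exp (- (c * (real j + 1))) * exp (c / 2 * (real j + 1)) = exp (- c / 2) ^ Suc j"
      unfolding exp_add[symmetric] exp_of_nat_mult[symmetric]
      by (rule arg_cong[of _ _ exp]) (simp add: field_simps)
    finally show ?thesis
      by simp
  qed
  have "summable (\<lambda>j. K * exp (- c / 2) ^ Suc j)"
    using c by (intro summable_mult summable_ignore_initial_segment[where k = 1, simplified] summable_geometric) auto
  then show ?thesis using bound by (rule summable_comparison_test'[where N = 0])
qed

text \<open>A point is sorted by the integer part of \<open>norm (X p)\<close>. On the shell with
  index \<open>j\<close> the integrand is at most \<open>a j\<close>, and the shell lies in the ball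
  \<open>U j\<close>, whose measure is controlled by the growth bound. Using balls in place of
  shells overcounts, but the series still converges.\<close>

lemma integrable_gaussian:
  fixes X :: "'a \<Rightarrow> 'b::real_normed_vector"
  assumes meas: "(\<lambda>p. norm (X p)) \<in> borel_measurable M" and c: "c > 0"
    and growth: "\<And>r. r \<ge> 0 \<Longrightarrow> emeasure M {p \<in> space M. norm (X p) < r} \<le> ennreal (C1 * r ^ k + C2)"
  shows "integrable M (\<lambda>p. exp (- c * (norm (X p))\<^sup>2))"
proof (rule integrableI_nonneg)
  define a where "a j = exp (- c * (real j)\<^sup>2)" for j :: nat
  define U where "U j = {p \<in> space M. norm (X p) < real j + 1}" for j :: nat
  have U: "U j \<in> sets M" for j unfolding U_def using meas by measurable
  have sum: "summable (\<lambda>j. a j * (\<bar>C1\<bar> * (real j + 1) ^ k + \<bar>C2\<bar>))"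
  proof -
    have "summable (\<lambda>j. \<bar>C1\<bar> * (a j * (real j + 1) ^ k) + \<bar>C2\<bar> * (a j * (real j + 1) ^ 0))"
      unfolding a_def by (intro summable_add summable_mult summable_gaussian_power c)
    then show ?thesis by (simp add: algebra_simps)
  qed
  have term_le: "T j \<le> (\<Sum>j. T j)" for T :: "nat \<Rightarrow> ennreal" and j
    using sum_le_suminf[OF summableI, of "{j}" T] by simp
  have "(\<integral>\<^sup>+p. exp (- c * (norm (X p))\<^sup>2) \<partial>M) \<le> (\<integral>\<^sup>+p. (\<Sum>j. ennreal (a j) * indicator (U j) p) \<partial>M)"
  proof (rule nn_integral_mono)
    fix p assume p: "p \<in> space M"
    define j where "j = nat \<lfloor>norm (X p)\<rfloor>"
    have j: "real j \<le> norm (X p)" "norm (X p) < real j + 1" by (simp_all add: j_def)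
    have "(real j)\<^sup>2 \<le> (norm (X p))\<^sup>2" using j by (intro power_mono) auto
    then have "ennreal (exp (- c * (norm (X p))\<^sup>2)) \<le> ennreal (a j) * indicator (U j) p"
      using c j p by (simp add: a_def U_def ennreal_leI)
    also have "\<dots> \<le> (\<Sum>j. ennreal (a j) * indicator (U j) p)"
      by (rule term_le)
    finally show "ennreal (exp (- c * (norm (X p))\<^sup>2)) \<le> (\<Sum>j. ennreal (a j) * indicator (U j) p)" .
  qed
  also have "\<dots> = (\<Sum>j. \<integral>\<^sup>+p. ennreal (a j) * indicator (U j) p \<partial>M)"
    using U by (intro nn_integral_suminf) auto
  also have "\<dots> = (\<Sum>j. ennreal (a j) * emeasure M (U j))"
    using U by (simp add: nn_integral_cmult_indicator)
  also have "\<dots> \<le> (\<Sum>j. ennreal (a j * (\<bar>C1\<bar> * (real j + 1) ^ k + \<bar>C2\<bar>)))"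
  proof (intro suminf_le summableI)
    fix j
    have "emeasure M (U j) \<le> ennreal (C1 * (real j + 1) ^ k + C2)"
      unfolding U_def by (rule growth) simp
    \<comment> \<open>The constants of the growth bound may be negative; absolute values make the
      factor nonnegative, as needed for splitting \<open>ennreal\<close> over the product.\<close>
    also have "\<dots> \<le> ennreal (\<bar>C1\<bar> * (real j + 1) ^ k + \<bar>C2\<bar>)"
      by (intro ennreal_leI add_mono mult_right_mono) auto
    finally show "ennreal (a j) * emeasure M (U j) \<le> ennreal (a j * (\<bar>C1\<bar> * (real j + 1) ^ k + \<bar>C2\<bar>))"
      by (simp add: ennreal_mult a_def mult_left_mono)
  qed
  also have "\<dots> = ennreal (\<Sum>j. a j * (\<bar>C1\<bar> * (real j + 1) ^ k + \<bar>C2\<bar>))"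
    by (intro suminf_ennreal2 sum) (simp add: a_def)
  also have "\<dots> < \<infinity>" by simp
  finally show "(\<integral>\<^sup>+p. exp (- c * (norm (X p))\<^sup>2) \<partial>M) < \<infinity>" .
qed (use meas in measurable)

text \<open>Half of the decay rate is spent on the polynomial: \<open>power_le_exp\<close> with
  exponent 2 and rate \<open>c / 2\<close> yields the constant \<open>8 / c^2\<close>.\<close>

lemma gaussian_polynomial_bound:
  fixes c z :: real
  assumes c: "c > 0" and z: "z \<ge> 0"
  shows "(1 + z)\<^sup>2 * exp (- c * z) \<le> 8 / c\<^sup>2 * exp (c / 2) * exp (- c / 2 * z)"
proof -
  have "(1 + z)\<^sup>2 \<le> 8 / c\<^sup>2 * exp (c / 2 * (1 + z))"
    using power_le_exp[of "1 + z" "c / 2" 2] c z by (simp add: power_divide)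
  then have "(1 + z)\<^sup>2 * exp (- c * z) \<le> 8 / c\<^sup>2 * exp (c / 2 * (1 + z)) * exp (- c * z)"
    by (intro mult_right_mono) auto
  also have "\<dots> = 8 / c\<^sup>2 * exp (c / 2) * exp (- c / 2 * z)"
    by (simp add: exp_add[symmetric] mult.assoc) (simp add: field_simps)
  finally show ?thesis .
qed

text \<open>Used to compare Gaussians with different centres: if \<open>a - b\<close> is bounded,
  decay in \<open>b\<close> gives decay in \<open>a\<close>, at half the rate.\<close>

lemma norm_sq_half_le:
  fixes a b :: "'a::real_inner"
  shows "(norm a)\<^sup>2 / 2 - (norm (a - b))\<^sup>2 \<le> (norm b)\<^sup>2"
proof -
  have "0 \<le> (norm (a - 2 *\<^sub>R b))\<^sup>2" by simp
  then show ?thesis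
    by (simp add: power2_norm_eq_inner inner_diff_left inner_diff_right inner_commute algebra_simps)
qed

text \<open>\<open>L_perp_loc\<close> depends only on the germ of the field. In a chart the velocity
  is computed as a derivative that agrees with \<open>V\<close> only on the open domain, outside of
  which the parametrisation is arbitrary.\<close>

lemma L_perp_loc_cong:
  assumes D: "open D" "u \<in> D" and eq: "\<And>u. u \<in> D \<Longrightarrow> w u = w' u"
  shows "L_perp_loc f x0 t0 w u = L_perp_loc f x0 t0 w' u"
proof -
  have conn: "normal_conn f w v u' = normal_conn f w' v u'" if "u' \<in> D" for v u'
    unfolding normal_conn_def using dd_cong_open[OF D(1) that eq] by simp
  have "normal_conn f (\<lambda>u'. normal_conn f w (a u') u') v u = normal_conn f (\<lambda>u'. normal_conn f w' (a u') u') v u" for a v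
    unfolding normal_conn_def[of f _ v u]
    using dd_cong_open[OF D, of "\<lambda>u'. normal_conn f w (a u') u'" "\<lambda>u'. normal_conn f w' (a u') u'"] conn by simp
  then show ?thesis
    unfolding L_perp_loc_def normal_laplacian_def by (simp add: conn[OF D(2)] eq[OF D(2)])
qed


section \<open>Area ratio along a normal variation\<close>

locale variation = manifold A
  for A :: "('n::finite, 'p::{t2_space, second_countable_topology}) chart set" +
  fixes X V :: "real \<Rightarrow> 'p \<Rightarrow> real^'m::finite" and \<epsilon> :: real
  assumes eps: "\<epsilon> > 0" and variation: "normal_variation A {-\<epsilon><..<\<epsilon>} X V"
begin

abbreviation I :: "real set" where "I \<equiv> {-\<epsilon><..<\<epsilon>}"

lemma zero_in_I: "0 \<in> I" using eps by simp

lemma smooth_chart: "(D, \<phi>) \<in> A \<Longrightarrow> smooth_on (I \<times> D) (\<lambda>(s, u). X s (\<phi> u))"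
  and immersed_manifold: "s \<in> I \<Longrightarrow> immersed_manifold A (X s)"
  and velocity: "s \<in> I \<Longrightarrow> ((\<lambda>r. X r p) has_vector_derivative V s p) (at s)"
  and velocity_normal: "s \<in> I \<Longrightarrow> v \<in> tangent_space A (X s) p \<Longrightarrow> V s p \<bullet> v = 0"
  using variation manifold_axioms
  by (auto simp: normal_variation_def immersed_manifold_def immersed_manifold_axioms_def)

lemma chart_slices:
  assumes c: "(D, \<phi>) \<in> A" and s: "s \<in> I" and u: "u \<in> D"
  shows "frechet_derivative (X s \<circ> \<phi>) (at u) = (\<lambda>v. dd (0, v) (\<lambda>(s, u). X s (\<phi> u)) (s, u))"
    and "dd (1, 0) (\<lambda>(s, u). X s (\<phi> u)) (s, u) = V s (\<phi> u)"
proof -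
  have "(s, u) \<in> I \<times> D" using s u by simp
  note sl = smooth_on_slices[OF smooth_chart[OF c] this]
  show "frechet_derivative (X s \<circ> \<phi>) (at u) = (\<lambda>v. dd (0, v) (\<lambda>(s, u). X s (\<phi> u)) (s, u))"
    using frechet_derivative_at[OF sl(1)] by (simp add: o_def)
  show "dd (1, 0) (\<lambda>(s, u). X s (\<phi> u)) (s, u) = V s (\<phi> u)"
    using vector_derivative_unique_at[OF sl(2)] velocity[OF s, of "\<phi> u"] by simp
qed

text \<open>The hypothesis on \<open>V\<close> concerns the tangent space computed in the chosen
  chart at the point; the chain rule through the transition map transfers it to any chart.\<close>

lemma frechet_in_tangent_space:
  assumes c: "(D, \<phi>) \<in> A" and s: "s \<in> I" and u: "u \<in> D"
  shows "frechet_derivative (X s \<circ> \<phi>) (at u) v \<in> tangent_space A (X s) (\<phi> u)"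
proof -
  interpret S: immersed_manifold A "X s" by (rule immersed_manifold[OF s])
  let ?E = "fst (chart_at A (\<phi> u))" and ?\<psi> = "param_at A (\<phi> u)"
  have c2: "(?E, ?\<psi>) \<in> A" by (rule chart_at(1))
  have "u \<in> D \<inter> \<phi> -` (?\<psi> ` ?E)" using u chart_at(2,3)[of "\<phi> u"] by (metis IntI imageI vimageI2)
  from frechet_transition[OF c c2 S.smooth_X[OF c2] this] show ?thesis
    unfolding tangent_space_def coord_at_def param_at_def by simp
qed

lemma local_variation:
  assumes c: "(D, \<phi>) \<in> A"
  shows "local_variation (\<lambda>(s, u). X s (\<phi> u)) I D"
proof
  show "open I" "open D" "smooth_on (I \<times> D) (\<lambda>(s, u). X s (\<phi> u))"
    using open_domain[OF c] smooth_chart[OF c] by auto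
  fix s u assume s: "s \<in> I" and u: "u \<in> D"
  show "inj (\<lambda>v. dd (0, v) (\<lambda>(s, u). X s (\<phi> u)) (s, u))"
    using immersed_manifold.inj_X[OF immersed_manifold[OF s] c u] by (simp add: chart_slices(1)[OF c s u])
  show "dd (1, 0) (\<lambda>(s, u). X s (\<phi> u)) (s, u) \<bullet> dd (0, v) (\<lambda>(s, u). X s (\<phi> u)) (s, u) = 0" for v
    using velocity_normal[OF s frechet_in_tangent_space[OF c s u, of v]]
    by (simp add: chart_slices[OF c s u])
qed

definition J :: "real \<Rightarrow> 'p \<Rightarrow> real" where
  "J s p = vol_density (X s) (param_at A p) (coord_at A p) / vol_density (X 0) (param_at A p) (coord_at A p)"

definition J1 :: "real \<Rightarrow> 'p \<Rightarrow> real" where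
  "J1 s p = deriv (\<lambda>r. J r p) s"

definition J2 :: "real \<Rightarrow> 'p \<Rightarrow> real" where
  "J2 s p = deriv (\<lambda>r. J1 r p) s"

definition V' :: "real \<Rightarrow> 'p \<Rightarrow> real^'m" where
  "V' s p = vector_derivative (\<lambda>r. V r p) (at s)"

text \<open>Changing the chart multiplies both densities by the same Jacobian factor
  \<open>d\<close>, which does not involve \<open>s\<close> and cancels in the quotient.\<close>

lemma J_vol_density:
  assumes c: "(D, \<phi>) \<in> A" and s: "s \<in> I" and u: "u \<in> D"
  shows "J s (\<phi> u) = vol_density (X s) \<phi> u / vol_density (X 0) \<phi> u"
proof -
  let ?E = "fst (chart_at A (\<phi> u))" and ?\<psi> = "param_at A (\<phi> u)"
  have c2: "(?E, ?\<psi>) \<in> A" by (rule chart_at(1))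
  have u2: "u \<in> D \<inter> \<phi> -` (?\<psi> ` ?E)" using u chart_at(2,3)[of "\<phi> u"] by (metis IntI imageI vimageI2)
  have coord: "inv_into ?E ?\<psi> (\<phi> u) = coord_at A (\<phi> u)"
    by (simp add: coord_at_def param_at_def)
  define d where "d = \<bar>det (matrix (frechet_derivative (inv_into ?E ?\<psi> \<circ> \<phi>) (at u)))\<bar>"
  have vd: "vol_density (X r) \<phi> u = d * vol_density (X r) ?\<psi> (coord_at A (\<phi> u))" if "r \<in> I" for r
    using vol_density_transition[OF c c2 immersed_manifold.smooth_X[OF immersed_manifold[OF that] c2] u2]
    by (simp add: coord d_def)
  have "vol_density (X 0) \<phi> u > 0"
    by (rule immersed_manifold.vol_density_pos[OF immersed_manifold[OF zero_in_I] c u])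
  \<comment> \<open>Positivity of the density at \<open>s = 0\<close> excludes a vanishing Jacobian
    factor, so it may be cancelled.\<close>
  with vd[OF zero_in_I] have "d \<noteq> 0" by auto
  then show ?thesis by (simp add: J_def vd[OF s] vd[OF zero_in_I])
qed

context
  fixes D \<phi> assumes c: "(D, \<phi>) \<in> A"
begin

interpretation L: local_variation "\<lambda>(s, u). X s (\<phi> u)" I D
  by (rule local_variation[OF c])

lemma W_chart: "s \<in> I \<Longrightarrow> u \<in> D \<Longrightarrow> L.W (s, u) = V s (\<phi> u)"
  by (simp add: L.W_def L.Ds_def chart_slices(2)[OF c])

lemma rho_chart: "s \<in> I \<Longrightarrow> u \<in> D \<Longrightarrow> L.\<rho> (s, u) = vol_density (X s) \<phi> u"
  using L.metric_slice[of s u] by (simp add: L.\<rho>_def vol_density_def o_def)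

lemma J_chart: "s \<in> I \<Longrightarrow> u \<in> D \<Longrightarrow> J s (\<phi> u) = L.\<rho> (s, u) / L.\<rho> (0, u)"
  using zero_in_I by (simp add: rho_chart J_vol_density[OF c])

lemma J_has_derivative_chart:
  assumes "s \<in> I" "u \<in> D"
  shows "((\<lambda>r. J r (\<phi> u)) has_real_derivative L.Ds L.\<rho> (s, u) / L.\<rho> (0, u)) (at s)"
proof (rule has_field_derivative_transform_within_open[OF _ open_greaterThanLessThan assms(1)])
  show "((\<lambda>r. L.\<rho> (r, u) / L.\<rho> (0, u)) has_real_derivative L.Ds L.\<rho> (s, u) / L.\<rho> (0, u)) (at s)"
    using L.slice_dd(3)[OF L.smooth_rho assms]
    by (intro DERIV_cdivide) (simp add: has_real_derivative_iff_has_vector_derivative)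
qed (use J_chart assms(2) in auto)

lemma J1_chart: "s \<in> I \<Longrightarrow> u \<in> D \<Longrightarrow> J1 s (\<phi> u) = L.Ds L.\<rho> (s, u) / L.\<rho> (0, u)"
  unfolding J1_def by (rule DERIV_imp_deriv[OF J_has_derivative_chart])

lemma J1_has_derivative_chart:
  assumes "s \<in> I" "u \<in> D"
  shows "((\<lambda>r. J1 r (\<phi> u)) has_real_derivative L.Ds (L.Ds L.\<rho>) (s, u) / L.\<rho> (0, u)) (at s)"
proof (rule has_field_derivative_transform_within_open[OF _ open_greaterThanLessThan assms(1)])
  show "((\<lambda>r. L.Ds L.\<rho> (r, u) / L.\<rho> (0, u)) has_real_derivative L.Ds (L.Ds L.\<rho>) (s, u) / L.\<rho> (0, u)) (at s)"
    using L.slice_dd(3)[OF L.smooth_partial(2)[OF L.smooth_rho] assms]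
    by (intro DERIV_cdivide) (simp add: has_real_derivative_iff_has_vector_derivative)
qed (use J1_chart assms(2) in auto)

lemma J2_chart: "s \<in> I \<Longrightarrow> u \<in> D \<Longrightarrow> J2 s (\<phi> u) = L.Ds (L.Ds L.\<rho>) (s, u) / L.\<rho> (0, u)"
  unfolding J2_def by (rule DERIV_imp_deriv[OF J1_has_derivative_chart])

lemma V_has_derivative_chart:
  assumes "s \<in> I" "u \<in> D"
  shows "((\<lambda>r. V r (\<phi> u)) has_vector_derivative L.Ds L.W (s, u)) (at s)"
proof (rule has_vector_derivative_transform_within_open[OF _ open_greaterThanLessThan assms(1)])
  show "((\<lambda>r. L.W (r, u)) has_vector_derivative L.Ds L.W (s, u)) (at s)"
    by (rule L.slice_dd(3)[OF L.smooth_W assms])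
qed (use W_chart assms(2) in auto)

lemma V'_chart: "s \<in> I \<Longrightarrow> u \<in> D \<Longrightarrow> V' s (\<phi> u) = L.Ds L.W (s, u)"
  unfolding V'_def by (rule vector_derivative_at[OF V_has_derivative_chart])

lemma rho0_continuous: "continuous_on (I \<times> D) (\<lambda>z. L.\<rho> (0, snd z))"
  using zero_in_I
  by (intro continuous_on_compose2[OF smooth_on_continuous[OF L.smooth_rho]] continuous_intros) auto

lemma continuous_chart:
  "continuous_on (I \<times> D) (\<lambda>(s, u). X s (\<phi> u))"
  "continuous_on (I \<times> D) (\<lambda>(s, u). V s (\<phi> u))"
  "continuous_on (I \<times> D) (\<lambda>(s, u). V' s (\<phi> u))"
  "continuous_on (I \<times> D) (\<lambda>(s, u). J s (\<phi> u))"
  "continuous_on (I \<times> D) (\<lambda>(s, u). J1 s (\<phi> u))"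
  "continuous_on (I \<times> D) (\<lambda>(s, u). J2 s (\<phi> u))"
proof -
  have nz: "L.\<rho> (0, snd z) \<noteq> 0" if "z \<in> I \<times> D" for z
    using that L.rho_pos[of "(0, snd z)"] zero_in_I by auto
  have quot: "continuous_on (I \<times> D) (\<lambda>z. k z / L.\<rho> (0, snd z))" if "smooth_on (I \<times> D) k" for k
    using nz by (intro continuous_on_divide smooth_on_continuous[OF that] rho0_continuous) auto
  show "continuous_on (I \<times> D) (\<lambda>(s, u). X s (\<phi> u))"
    by (rule smooth_on_continuous[OF L.smooth])
  show "continuous_on (I \<times> D) (\<lambda>(s, u). V s (\<phi> u))"
    using smooth_on_continuous[OF L.smooth_W]
    by (rule continuous_on_eq) (auto simp: W_chart)
  show "continuous_on (I \<times> D) (\<lambda>(s, u). V' s (\<phi> u))"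
    using smooth_on_continuous[OF L.smooth_partial(2)[OF L.smooth_W]]
    by (rule continuous_on_eq) (auto simp: V'_chart)
  show "continuous_on (I \<times> D) (\<lambda>(s, u). J s (\<phi> u))"
    using quot[OF L.smooth_rho]
    by (rule continuous_on_eq) (auto simp: J_chart)
  show "continuous_on (I \<times> D) (\<lambda>(s, u). J1 s (\<phi> u))"
    using quot[OF L.smooth_partial(2)[OF L.smooth_rho]]
    by (rule continuous_on_eq) (auto simp: J1_chart)
  show "continuous_on (I \<times> D) (\<lambda>(s, u). J2 s (\<phi> u))"
    using quot[OF L.smooth_partial(2)[OF L.smooth_partial(2)[OF L.smooth_rho]]]
    by (rule continuous_on_eq) (auto simp: J2_chart)
qed

lemma variation_formulas_chart:
  assumes u: "u \<in> D"
  defines "H \<equiv> mean_curv_loc (X 0 \<circ> \<phi>) u" and "a \<equiv> V' 0 (\<phi> u)" and "v \<equiv> V 0 (\<phi> u)"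
  shows "J1 0 (\<phi> u) = - (v \<bullet> H)"
    and "J2 0 (\<phi> u) = (v \<bullet> H)\<^sup>2 - (v \<bullet> L_perp_loc (X 0 \<circ> \<phi>) x0 t0 (V 0 \<circ> \<phi>) u - (v \<bullet> v) / (2 * t0)
      - (a \<bullet> (X 0 (\<phi> u) - x0) - normal_part (X 0 \<circ> \<phi>) u a \<bullet> (X 0 (\<phi> u) - x0)) / (2 * t0)
      + normal_part (X 0 \<circ> \<phi>) u a \<bullet> H)"
proof -
  have z: "(0, u) \<in> I \<times> D" using u zero_in_I by simp
  have pos: "L.\<rho> (0, u) > 0" by (rule L.rho_pos[OF z])
  have f0: "L.f 0 = X 0 \<circ> \<phi>" by (simp add: o_def)
  have tr: "L.tr (0, u) = v \<bullet> H"
    using L.W_inner_mean_curv[OF zero_in_I u] unfolding f0 by (simp add: W_chart[OF zero_in_I u] H_def v_def)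
  have Lw: "L_perp_loc (X 0 \<circ> \<phi>) x0 t0 (L.w 0) u = L_perp_loc (X 0 \<circ> \<phi>) x0 t0 (V 0 \<circ> \<phi>) u"
    by (rule L_perp_loc_cong[OF open_domain[OF c] u]) (simp add: W_chart[OF zero_in_I])
  show "J1 0 (\<phi> u) = - (v \<bullet> H)"
    using pos by (simp add: J1_chart[OF zero_in_I u] L.partial_s_rho[OF z] tr)
  show "J2 0 (\<phi> u) = (v \<bullet> H)\<^sup>2 - (v \<bullet> L_perp_loc (X 0 \<circ> \<phi>) x0 t0 (V 0 \<circ> \<phi>) u - (v \<bullet> v) / (2 * t0)
      - (a \<bullet> (X 0 (\<phi> u) - x0) - normal_part (X 0 \<circ> \<phi>) u a \<bullet> (X 0 (\<phi> u) - x0)) / (2 * t0)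
      + normal_part (X 0 \<circ> \<phi>) u a \<bullet> H)"
    using pos L.W_inner_L_perp[OF zero_in_I u, of x0 t0]
    unfolding f0 Lw W_chart[OF zero_in_I u] V'_chart[OF zero_in_I u, symmetric]
    by (simp add: J2_chart[OF zero_in_I u] L.partial_s_s_rho[OF z] tr a_def v_def H_def)
qed

end

lemma J_has_derivative: "s \<in> I \<Longrightarrow> ((\<lambda>r. J r p) has_real_derivative J1 s p) (at s)"
  and J1_has_derivative: "s \<in> I \<Longrightarrow> ((\<lambda>r. J1 r p) has_real_derivative J2 s p) (at s)"
  and V_has_derivative: "s \<in> I \<Longrightarrow> ((\<lambda>r. V r p) has_vector_derivative V' s p) (at s)"
  using J_has_derivative_chart[OF chart_at(1) _ chart_at(2), of s p]
    J1_has_derivative_chart[OF chart_at(1) _ chart_at(2), of s p]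
    V_has_derivative_chart[OF chart_at(1) _ chart_at(2), of s p]
    J1_chart[OF chart_at(1) _ chart_at(2), of s p]
    J2_chart[OF chart_at(1) _ chart_at(2), of s p]
    V'_chart[OF chart_at(1) _ chart_at(2), of s p]
  by (simp_all add: chart_at(3))

lemma J_0: "J 0 p = 1"
  using J_chart[OF chart_at(1) zero_in_I chart_at(2), of p]
    local_variation.rho_pos[OF local_variation[OF chart_at(1)], of "(0, coord_at A p)" p]
    chart_at(2)[of p] zero_in_I
  by (auto simp: chart_at(3))

lemma J_pos: "s \<in> I \<Longrightarrow> J s p > 0"
  unfolding J_def
  using immersed_manifold.vol_density_pos[OF immersed_manifold chart_at(1) chart_at(2)] zero_in_I
  by (intro divide_pos_pos) auto

lemma variation_formulas:
  defines "H \<equiv> \<lambda>p. mean_curv A (X 0) p" and "N \<equiv> \<lambda>p. normal_proj A (X 0) p (V' 0 p)"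
  shows "J1 0 p = - (V 0 p \<bullet> H p)"
    and "J2 0 p = (V 0 p \<bullet> H p)\<^sup>2 - (V 0 p \<bullet> L_perp A (X 0) x0 t0 (V 0) p - (V 0 p \<bullet> V 0 p) / (2 * t0)
      - (V' 0 p \<bullet> (X 0 p - x0) - N p \<bullet> (X 0 p - x0)) / (2 * t0) + N p \<bullet> H p)"
  using variation_formulas_chart(1)[OF chart_at(1) chart_at(2), of p]
    variation_formulas_chart(2)[OF chart_at(1) chart_at(2), of p x0 t0]
  by (simp_all add: chart_at(3) H_def N_def mean_curv_def normal_proj_def L_perp_def)

section \<open>Joint continuity in time and point, and uniform bounds over compact sets\<close>

definition jointly_continuous :: "(real \<Rightarrow> 'p \<Rightarrow> 'b::topological_space) \<Rightarrow> bool" where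
  "jointly_continuous k \<longleftrightarrow> (\<forall>(D, \<phi>)\<in>A. continuous_on (I \<times> D) (\<lambda>(s, u). k s (\<phi> u)))"

lemma jointly_continuous_variation:
  "jointly_continuous X" "jointly_continuous V" "jointly_continuous V'"
  "jointly_continuous J" "jointly_continuous J1" "jointly_continuous J2"
  unfolding jointly_continuous_def using continuous_chart by blast+

lemma jointly_continuous_continuous:
  assumes k: "jointly_continuous k" and s: "s \<in> I"
  shows "continuous_on UNIV (k s)"
proof -
  have "isCont (k s) p" for p
  proof -
    obtain D \<phi> where c: "(D, \<phi>) \<in> A" and p: "p \<in> \<phi> ` D" using charts_cover by blast
    have "continuous_on (I \<times> D) (\<lambda>(s, u). k s (\<phi> u))"
      using k c unfolding jointly_continuous_def by blast
    then have "continuous_on (\<phi> ` D) (\<lambda>q. case (s, inv_into D \<phi> q) of (s, u) \<Rightarrow> k s (\<phi> u))"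
      by (rule continuous_on_compose2)
        (use s in \<open>auto intro!: continuous_intros chart_inv_continuous[OF c] inv_into_into\<close>)
    then have "continuous_on (\<phi> ` D) (k s)"
      by (rule continuous_on_eq) (simp add: f_inv_into_f)
    then show ?thesis
      using p unfolding continuous_on_eq_continuous_at[OF open_image[OF c]] by (rule bspec)
  qed
  then show ?thesis by (simp add: continuous_at_imp_continuous_on)
qed

text \<open>Each point has a chart ball on whose closure, times the compact time interval, the
  function is bounded. Finitely many of these balls cover \<open>K\<close>, and the sum of the local
  bounds serves for all of them.\<close>

lemma jointly_continuous_bounded:
  fixes k :: "real \<Rightarrow> 'p \<Rightarrow> 'b::real_normed_vector"
  assumes k: "jointly_continuous k" and K: "compact K" and \<delta>: "\<delta> < \<epsilon>"
  shows "\<exists>C. \<forall>s\<in>{-\<delta>..\<delta>}. \<forall>p\<in>K. norm (k s p) \<le> C"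
proof -
  have "\<exists>U C. open U \<and> p \<in> U \<and> (\<forall>s\<in>{-\<delta>..\<delta>}. \<forall>q\<in>U. norm (k s q) \<le> C)" for p
  proof -
    obtain D \<phi> u where c: "(D, \<phi>) \<in> A" and u: "u \<in> D" "p = \<phi> u" using charts_cover by blast
    obtain r where r: "r > 0" "cball u r \<subseteq> D"
      using open_domain[OF c] u(1) open_contains_cball by blast
    have "continuous_on (I \<times> D) (\<lambda>(s, u). k s (\<phi> u))"
      using k c unfolding jointly_continuous_def by blast
    then have "continuous_on ({-\<delta>..\<delta>} \<times> cball u r) (\<lambda>(s, u). k s (\<phi> u))"
      by (rule continuous_on_subset) (use r \<delta> in auto)
    then have "bounded ((\<lambda>(s, u). k s (\<phi> u)) ` ({-\<delta>..\<delta>} \<times> cball u r))"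
      by (intro compact_imp_bounded compact_continuous_image compact_Times compact_Icc compact_cball)
    then obtain C where C: "\<And>s v. s \<in> {-\<delta>..\<delta>} \<Longrightarrow> v \<in> cball u r \<Longrightarrow> norm (k s (\<phi> v)) \<le> C"
      unfolding bounded_iff by fastforce
    have "\<phi> ` ball u r = \<phi> ` D \<inter> inv_into D \<phi> -` ball u r"
      using r(2) inj_chart[OF c] ball_subset_cball[of u r]
      by (auto simp: inv_into_f_f image_iff subset_iff)
    then have "open (\<phi> ` ball u r)"
      using continuous_open_preimage[OF chart_inv_continuous[OF c] open_image[OF c] open_ball] by simp
    moreover have "p \<in> \<phi> ` ball u r" using u r by auto
    ultimately show ?thesis using C by (intro exI[of _ "\<phi> ` ball u r"] exI[of _ C]) auto
  qed
  then obtain U C where U: "\<And>p. open (U p)" "\<And>p. p \<in> U p"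
      and C: "\<And>p s q. s \<in> {-\<delta>..\<delta>} \<Longrightarrow> q \<in> U p \<Longrightarrow> norm (k s q) \<le> C p"
    by metis
  obtain F where F: "F \<subseteq> K" "finite F" "K \<subseteq> (\<Union>p\<in>F. U p)"
    using compactE_image[OF K, of K U] U by (metis UN_I subsetI)
  show ?thesis
  proof (intro exI ballI)
    fix s q assume s: "s \<in> {-\<delta>..\<delta>}" and "q \<in> K"
    then obtain p where p: "p \<in> F" "q \<in> U p" using F by blast
    have "norm (k s q) \<le> \<bar>C p\<bar>" using C[OF s p(2)] by linarith
    also have "\<dots> \<le> (\<Sum>p\<in>F. \<bar>C p\<bar>)" using p(1) F(2) by (intro member_le_sum) auto
    finally show "norm (k s q) \<le> (\<Sum>p\<in>F. \<bar>C p\<bar>)" .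
  qed
qed

text \<open>Zero velocity freezes the points outside \<open>K\<close>. As \<open>K\<close> is
  closed, a whole neighbourhood of such a point is frozen, so the spatial derivatives and hence the
  area element do not change either.\<close>

lemma off_support:
  assumes K: "closed K" and supp: "\<And>s p. s \<in> I \<Longrightarrow> p \<notin> K \<Longrightarrow> V s p = 0"
    and s: "s \<in> I" and p: "p \<notin> K"
  shows "X s p = X 0 p" "V' s p = 0" "J s p = 1" "J1 s p = 0" "J2 s p = 0"
proof -
  have X0: "X s q = X 0 q" if s: "s \<in> I" and q: "q \<notin> K" for s q
  proof -
    have "((\<lambda>r. X r q) has_derivative (\<lambda>h. 0)) (at r within I)" if "r \<in> I" for r
      using velocity[OF that, of q] supp[OF that q]
      by (simp add: has_vector_derivative_def has_derivative_at_withinI)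
    from has_derivative_zero_unique[OF _ this s zero_in_I] show ?thesis by simp
  qed
  show "X s p = X 0 p" by (rule X0[OF s p])
  have "((\<lambda>r. V r p) has_vector_derivative 0) (at s)"
    by (rule has_vector_derivative_transform_within_open[OF _ open_greaterThanLessThan s, of "\<lambda>_. 0"])
      (use supp p in \<open>auto intro: has_vector_derivative_const\<close>)
  then show "V' s p = 0" unfolding V'_def by (rule vector_derivative_at)
  have J: "J s p = 1" if s: "s \<in> I" for s
  proof -
    let ?D = "fst (chart_at A p)" and ?\<phi> = "param_at A p" and ?u = "coord_at A p"
    have c: "(?D, ?\<phi>) \<in> A" by (rule chart_at(1))
    have op: "open (?D \<inter> ?\<phi> -` (- K))"
      by (rule continuous_open_preimage[OF chart_continuous[OF c] open_domain[OF c] open_Compl[OF K]])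
    have u: "?u \<in> ?D \<inter> ?\<phi> -` (- K)" using chart_at(2,3)[of p] p by auto
    have "pd i (X s \<circ> ?\<phi>) ?u = pd i (X 0 \<circ> ?\<phi>) ?u" for i
      unfolding pd_def by (rule dd_cong_open[OF op u]) (simp add: X0[OF s])
    then have "vol_density (X s) ?\<phi> ?u = vol_density (X 0) ?\<phi> ?u"
      by (simp add: vol_density_def metric_def)
    then show ?thesis using J_0[of p] by (simp add: J_def)
  qed
  then show "J s p = 1" using s by simp
  have zero: "d = 0" if "(k has_real_derivative d) (at r)" "\<And>r. r \<in> I \<Longrightarrow> k r = b" "r \<in> I" for k d b r
  proof -
    have "(k has_real_derivative 0) (at r)"
      by (rule has_field_derivative_transform_within_open[OF _ open_greaterThanLessThan that(3), of "\<lambda>_. b"])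
        (use that in auto)
    then show ?thesis using DERIV_unique[OF that(1)] by simp
  qed
  have J1: "J1 s p = 0" if s: "s \<in> I" for s
    using zero[OF J_has_derivative[OF s] J s] .
  then show "J1 s p = 0" using s by simp
  show "J2 s p = 0" using zero[OF J1_has_derivative[OF s] J1 s] .
qed

lemma J_measurable: "s \<in> I \<Longrightarrow> J s \<in> borel_measurable borel"
  by (intro borel_measurable_continuous_onI jointly_continuous_continuous jointly_continuous_variation)

text \<open>The measure with density \<open>J s\<close> has the chart densities of
  \<open>X s\<close>, because the density of \<open>X 0\<close> cancels in every chart; uniqueness
  does the rest.\<close>

lemma volume_measure_variation:
  assumes s: "s \<in> I"
  shows "volume_measure A (X s) = density (volume_measure A (X 0)) (\<lambda>p. ennreal (J s p))"
proof -
  interpret S: immersed_manifold A "X s" by (rule immersed_manifold[OF s])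
  interpret Z: immersed_manifold A "X 0" by (rule immersed_manifold[OF zero_in_I])
  have Js: "(\<lambda>p. ennreal (J s p)) \<in> borel_measurable borel" using J_measurable[OF s] by measurable
  show ?thesis
  proof (rule S.volume_measure_eqI)
    have "emeasure (density (volume_measure A (X 0)) (\<lambda>p. ennreal (J s p))) E = emeasure (chart_measure (X s) (D, \<phi>)) E"
      if c: "(D, \<phi>) \<in> A" and E: "E \<in> sets borel" "E \<subseteq> \<phi> ` D" for D \<phi> E
    proof -
      have "emeasure (density (volume_measure A (X 0)) (\<lambda>p. ennreal (J s p))) E
        = (\<integral>\<^sup>+p. ennreal (J s p) * indicator E p \<partial>volume_measure A (X 0))"
        using E Js by (intro emeasure_density) auto
      also have "\<dots> = (\<integral>\<^sup>+p\<in>\<phi> ` D. ennreal (J s p) * indicator E p \<partial>volume_measure A (X 0))"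
        using E by (intro nn_integral_cong) (auto split: split_indicator)
      also have "\<dots> = (\<integral>\<^sup>+u\<in>D. ennreal (vol_density (X 0) \<phi> u) * (ennreal (J s (\<phi> u)) * indicator E (\<phi> u)) \<partial>lborel)"
        using E Js by (intro Z.nn_integral_volume_measure_chart[OF c]) auto
      also have "\<dots> = (\<integral>\<^sup>+u\<in>D \<inter> \<phi> -` E. ennreal (vol_density (X s) \<phi> u) \<partial>lborel)"
      proof (rule nn_integral_cong)
        fix u
        have "ennreal (vol_density (X 0) \<phi> u) * ennreal (J s (\<phi> u)) = ennreal (vol_density (X s) \<phi> u)" if u: "u \<in> D"
          using Z.vol_density_pos[OF c u] J_pos[OF s, of "\<phi> u"]
          by (simp add: J_vol_density[OF c s u] ennreal_mult[symmetric])
        then show "ennreal (vol_density (X 0) \<phi> u) * (ennreal (J s (\<phi> u)) * indicator E (\<phi> u)) * indicator D u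
            = ennreal (vol_density (X s) \<phi> u) * indicator (D \<inter> \<phi> -` E) u"
          by (auto split: split_indicator simp: mult.assoc[symmetric])
      qed
      also have "\<dots> = emeasure (chart_measure (X s) (D, \<phi>)) E"
        by (rule S.emeasure_chart_measure[OF c E(1), symmetric])
      finally show ?thesis .
    qed
    then show "has_chart_densities A (X s) (density (volume_measure A (X 0)) (\<lambda>p. ennreal (J s p)))"
      by (auto simp: has_chart_densities_def)
  qed
qed

end


section \<open>The second variation of the F-functional\<close>

definition unif_bounded :: "real set \<Rightarrow> (real \<Rightarrow> 'p \<Rightarrow> 'b::real_normed_vector) \<Rightarrow> bool" where
  "unif_bounded T k \<longleftrightarrow> (\<exists>C. \<forall>s\<in>T. \<forall>p. norm (k s p) \<le> C)"

lemma unif_bounded_add: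
  assumes "unif_bounded T f" "unif_bounded T g"
  shows "unif_bounded T (\<lambda>s p. f s p + g s p)"
proof -
  obtain C C' where "\<forall>s\<in>T. \<forall>p. norm (f s p) \<le> C" "\<forall>s\<in>T. \<forall>p. norm (g s p) \<le> C'"
    using assms by (auto simp: unif_bounded_def)
  then have "\<forall>s\<in>T. \<forall>p. norm (f s p + g s p) \<le> C + C'" by (auto intro: norm_add_rule_thm)
  then show ?thesis by (auto simp: unif_bounded_def)
qed

lemma unif_bounded_norm: "unif_bounded T f \<Longrightarrow> unif_bounded T (\<lambda>s p. norm (f s p))"
  by (simp add: unif_bounded_def)

lemma unif_bounded_minus: "unif_bounded T f \<Longrightarrow> unif_bounded T (\<lambda>s p. - f s p)"
  by (simp add: unif_bounded_def)

lemma unif_bounded_diff: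
  "unif_bounded T f \<Longrightarrow> unif_bounded T g \<Longrightarrow> unif_bounded T (\<lambda>s p. f s p - g s p)"
  using unif_bounded_add[of T f "\<lambda>s p. - g s p"] unif_bounded_minus[of T g] by simp

lemma unif_bounded_product:
  assumes le: "\<And>x y. norm (b x y) \<le> norm x * norm y" and f: "unif_bounded T f" and g: "unif_bounded T g"
  shows "unif_bounded T (\<lambda>s p. b (f s p) (g s p))"
proof -
  obtain C C' where C: "\<forall>s\<in>T. \<forall>p. norm (f s p) \<le> C" "\<forall>s\<in>T. \<forall>p. norm (g s p) \<le> C'"
    using f g by (auto simp: unif_bounded_def)
  have "norm (b (f s p) (g s p)) \<le> \<bar>C\<bar> * \<bar>C'\<bar>" if "s \<in> T" for s p
    using C that by (intro order_trans[OF le] mult_mono) (auto intro: order_trans[OF _ abs_ge_self])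
  then show ?thesis by (auto simp: unif_bounded_def)
qed

lemma unif_bounded_scaleR:
  "unif_bounded T f \<Longrightarrow> unif_bounded T g \<Longrightarrow> unif_bounded T (\<lambda>s p. f s p *\<^sub>R g s p)"
  by (rule unif_bounded_product) simp_all

lemma unif_bounded_inner:
  "unif_bounded T f \<Longrightarrow> unif_bounded T g \<Longrightarrow> unif_bounded T (\<lambda>s p. f s p \<bullet> g s p)"
  by (rule unif_bounded_product) (simp_all add: Cauchy_Schwarz_ineq2)

lemma unif_bounded_continuous:
  assumes "compact T" "continuous_on T f"
  shows "unif_bounded T (\<lambda>s p. f s)"
  using compact_imp_bounded[OF compact_continuous_image[OF assms(2,1)]]
  by (auto simp: unif_bounded_def bounded_iff)

text \<open>One common constant for finitely many coefficients; taking it at least 1 lets lower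
  powers of it be absorbed into higher ones.\<close>

lemma unif_bounded_list:
  fixes ks :: "(real \<Rightarrow> 'p \<Rightarrow> real) list"
  assumes "\<forall>k\<in>set ks. unif_bounded T k"
  shows "\<exists>M\<ge>1. \<forall>k\<in>set ks. \<forall>s\<in>T. \<forall>p. \<bar>k s p\<bar> \<le> M"
  using assms
proof (induction ks)
  case (Cons k ks)
  then obtain M where M: "M \<ge> 1" "\<forall>k\<in>set ks. \<forall>s\<in>T. \<forall>p. \<bar>k s p\<bar> \<le> M" by auto
  obtain C where C: "\<forall>s\<in>T. \<forall>p. \<bar>k s p\<bar> \<le> C" using Cons.prems by (auto simp: unif_bounded_def)
  have "\<forall>j\<in>set (k # ks). \<forall>s\<in>T. \<forall>p. \<bar>j s p\<bar> \<le> max M C"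
    using M(2) C by (auto intro: max.coboundedI1 max.coboundedI2)
  then show ?case using M(1) by (intro exI[of _ "max M C"]) auto
qed auto

locale gaussian_variation = variation A X V \<epsilon>
  for A :: "('n::finite, 'p::{t2_space, second_countable_topology}) chart set"
    and X V :: "real \<Rightarrow> 'p \<Rightarrow> real^'m::finite" and \<epsilon> :: real +
  fixes x y y' :: "real \<Rightarrow> real^'m" and t \<tau> \<tau>' :: "real \<Rightarrow> real" and K :: "'p set"
  assumes growth: "polynomial_volume_growth A (X 0)"
    and K: "compact K" and support: "\<And>s p. s \<in> I \<Longrightarrow> p \<notin> K \<Longrightarrow> V s p = 0"
    and x': "\<And>s. s \<in> I \<Longrightarrow> (x has_vector_derivative y s) (at s)"
    and x'': "\<And>s. s \<in> I \<Longrightarrow> (y has_vector_derivative y' s) (at s)"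
    and y'_cont: "continuous_on I y'"
    and t_pos: "\<And>s. s \<in> I \<Longrightarrow> t s > 0"
    and t': "\<And>s. s \<in> I \<Longrightarrow> (t has_real_derivative \<tau> s) (at s)"
    and t'': "\<And>s. s \<in> I \<Longrightarrow> (\<tau> has_real_derivative \<tau>' s) (at s)"
    and \<tau>'_cont: "continuous_on I \<tau>'"
begin

definition n :: real where "n = real CARD('n)"

definition Z where "Z s p = X s p - x s"
definition Zv where "Zv s p = V s p - y s"
definition Za where "Za s p = V' s p - y' s"

definition r where "r s = 1 / t s"

text \<open>\<open>b1\<close> and \<open>b2\<close> are arranged as polynomials of degree at most
  two in \<open>Z\<close>. Only \<open>Z\<close> can be unbounded on the manifold; the coefficients
  \<open>a0\<close> to \<open>u2\<close> are bounded because the velocities and accelerations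
  are.\<close>

definition a0 where "a0 s = - n / 2 * (\<tau> s * r s)"
definition a1 where "a1 s = \<tau> s * (r s)\<^sup>2 / 4"
definition u1 where "u1 s p = (- r s / 2) *\<^sub>R Zv s p"
definition c0 where "c0 s p = - n / 2 * (\<tau>' s * r s - (\<tau> s * r s)\<^sup>2) + Zv s p \<bullet> u1 s p"
definition c1 where "c1 s = \<tau>' s * (r s)\<^sup>2 / 4 - (\<tau> s)\<^sup>2 * (r s) ^ 3 / 2"
definition u2 where "u2 s p = (\<tau> s * (r s)\<^sup>2) *\<^sub>R Zv s p + (- r s / 2) *\<^sub>R Za s p"

text \<open>\<open>b\<close> is the logarithm of the Gaussian weight, with first and second derivatives \<open>b1\<close>, \<open>b2\<close> in \<open>s\<close>.\<close>

definition b where "b s p = - n / 2 * ln (4 * pi * t s) - r s / 4 * (Z s p \<bullet> Z s p)"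
definition b1 where "b1 s p = a0 s + a1 s * (Z s p \<bullet> Z s p) + Z s p \<bullet> u1 s p"
definition b2 where "b2 s p = c0 s p + c1 s * (Z s p \<bullet> Z s p) + Z s p \<bullet> u2 s p"

definition G where "G s p = exp (b s p) * J s p"
definition G1 where "G1 s p = exp (b s p) * (b1 s p * J s p + J1 s p)"
definition G2 where "G2 s p = exp (b s p) * (((b1 s p)\<^sup>2 + b2 s p) * J s p + 2 * b1 s p * J1 s p + J2 s p)"

lemma inner_has_real_derivative:
  fixes f g :: "real \<Rightarrow> real^'m"
  assumes "(f has_vector_derivative f') (at s)" "(g has_vector_derivative g') (at s)"
  shows "((\<lambda>s. f s \<bullet> g s) has_real_derivative f s \<bullet> g' + f' \<bullet> g s) (at s)"
  unfolding has_real_derivative_iff_has_vector_derivative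
  by (rule bounded_bilinear.has_vector_derivative[OF bounded_bilinear_inner assms])

context
  fixes s :: real and p :: 'p assumes s: "s \<in> I"
begin

lemma Z_deriv: "((\<lambda>s. Z s p) has_vector_derivative Zv s p) (at s)"
  unfolding Z_def Zv_def by (intro has_vector_derivative_diff velocity x' s)

lemma Zv_deriv: "((\<lambda>s. Zv s p) has_vector_derivative Za s p) (at s)"
  unfolding Zv_def Za_def by (intro has_vector_derivative_diff V_has_derivative x'' s)

lemma ZZ_deriv: "((\<lambda>s. Z s p \<bullet> Z s p) has_real_derivative 2 * (Z s p \<bullet> Zv s p)) (at s)"
  using inner_has_real_derivative[OF Z_deriv Z_deriv] by (simp add: inner_commute)

lemma ZZv_deriv: "((\<lambda>s. Z s p \<bullet> Zv s p) has_real_derivative Z s p \<bullet> Za s p + Zv s p \<bullet> Zv s p) (at s)"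
  by (rule inner_has_real_derivative[OF Z_deriv Zv_deriv])

lemma r_deriv: "(r has_real_derivative - \<tau> s * (r s)\<^sup>2) (at s)"
  unfolding r_def[abs_def] using t_pos[OF s]
  by (auto intro!: derivative_eq_intros t' s simp: power2_eq_square)

lemma ln_deriv: "((\<lambda>s. ln (4 * pi * t s)) has_real_derivative \<tau> s * r s) (at s)"
  using t_pos[OF s] by (auto intro!: derivative_eq_intros t' s simp: r_def)

lemma b_deriv: "((\<lambda>s. b s p) has_real_derivative b1 s p) (at s)"
  unfolding b_def
  by (rule DERIV_cong[OF DERIV_diff[OF DERIV_cmult[OF ln_deriv, of "- n / 2"]
          DERIV_mult[OF DERIV_cdivide[OF r_deriv, of 4] ZZ_deriv]]])
    (simp add: b1_def a0_def a1_def u1_def algebra_simps)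

lemma b1_deriv: "((\<lambda>s. b1 s p) has_real_derivative b2 s p) (at s)"
proof -
  have "((\<lambda>s. - n / 2 * (\<tau> s * r s) + \<tau> s * (r s * r s) / 4 * (Z s p \<bullet> Z s p) - r s / 2 * (Z s p \<bullet> Zv s p))
      has_real_derivative b2 s p) (at s)"
    by (rule DERIV_cong[OF DERIV_diff[OF DERIV_add[OF DERIV_cmult[OF DERIV_mult[OF t''[OF s] r_deriv], of "- n / 2"]
            DERIV_mult[OF DERIV_cdivide[OF DERIV_mult[OF t''[OF s] DERIV_mult[OF r_deriv r_deriv]], of 4] ZZ_deriv]]
            DERIV_mult[OF DERIV_cdivide[OF r_deriv, of 2] ZZv_deriv]]])
      (simp add: b2_def c0_def c1_def u1_def u2_def inner_add_right inner_diff_right, simp add: field_simps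
        power2_eq_square power3_eq_cube)
  then show ?thesis by (simp add: b1_def a0_def a1_def u1_def power2_eq_square)
qed

lemma G_deriv: "((\<lambda>s. G s p) has_real_derivative G1 s p) (at s)"
  unfolding G_def
  by (rule derivative_eq_intros b_deriv J_has_derivative s refl)+ (simp add: G1_def algebra_simps)

lemma G1_deriv: "((\<lambda>s. G1 s p) has_real_derivative G2 s p) (at s)"
  unfolding G1_def
  by (rule derivative_eq_intros b_deriv b1_deriv J_has_derivative J1_has_derivative s refl)+
    (simp add: G2_def power2_eq_square algebra_simps)

end

lemma measurable_variation:
  assumes s: "s \<in> I"
  shows "X s \<in> borel_measurable borel" "V s \<in> borel_measurable borel" "V' s \<in> borel_measurable borel"
    "J s \<in> borel_measurable borel" "J1 s \<in> borel_measurable borel" "J2 s \<in> borel_measurable borel"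
  by (intro borel_measurable_continuous_onI jointly_continuous_continuous[OF _ s] jointly_continuous_variation)+

lemma measurable_G:
  assumes s: "s \<in> I"
  shows "G s \<in> borel_measurable borel" "G1 s \<in> borel_measurable borel" "G2 s \<in> borel_measurable borel"
proof -
  note [measurable] = measurable_variation[OF s]
  have [measurable]: "Z s \<in> borel_measurable borel" "Zv s \<in> borel_measurable borel" "Za s \<in> borel_measurable borel"
    unfolding Z_def[abs_def] Zv_def[abs_def] Za_def[abs_def] by measurable
  have [measurable]: "u1 s \<in> borel_measurable borel" "u2 s \<in> borel_measurable borel"
    unfolding u1_def[abs_def] u2_def[abs_def] by measurable
  have [measurable]: "c0 s \<in> borel_measurable borel"
    unfolding c0_def[abs_def] by measurable
  have [measurable]: "b s \<in> borel_measurable borel" "b1 s \<in> borel_measurable borel" "b2 s \<in> borel_measurable borel"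
    unfolding b_def[abs_def] b1_def[abs_def] b2_def[abs_def] by measurable
  show "G s \<in> borel_measurable borel" "G1 s \<in> borel_measurable borel" "G2 s \<in> borel_measurable borel"
    unfolding G_def[abs_def] G1_def[abs_def] G2_def[abs_def] by measurable
qed

text \<open>Halving the interval gives a compact set of times inside \<open>I\<close>, on which
  continuous coefficients are bounded.\<close>

definition T where "T = {- (\<epsilon> / 2)..\<epsilon> / 2}"

lemma T_sub: "T \<subseteq> I" and T_compact: "compact T"
  using eps by (auto simp: T_def)

text \<open>Compactness controls \<open>K\<close>. Off \<open>K\<close> the constant 1 is enough,
  since there \<open>J\<close> is 1 and \<open>V\<close>, \<open>V'\<close>, \<open>J1\<close>,
  \<open>J2\<close> vanish.\<close>

lemma unif_bounded_variation:
  fixes k :: "real \<Rightarrow> 'p \<Rightarrow> 'b::real_normed_vector"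
  assumes k: "jointly_continuous k" and off: "\<And>s p. s \<in> I \<Longrightarrow> p \<notin> K \<Longrightarrow> norm (k s p) \<le> 1"
  shows "unif_bounded T k"
proof -
  obtain C where C: "\<forall>s\<in>T. \<forall>p\<in>K. norm (k s p) \<le> C"
    using jointly_continuous_bounded[OF k K, of "\<epsilon> / 2"] eps by (auto simp: T_def)
  have "norm (k s p) \<le> max C 1" if "s \<in> T" for s p
    using C off[of s p] that T_sub by (cases "p \<in> K") fastforce+
  then show ?thesis by (auto simp: unif_bounded_def)
qed

lemma continuous_T:
  "continuous_on T x" "continuous_on T y" "continuous_on T y'"
  "continuous_on T t" "continuous_on T \<tau>" "continuous_on T \<tau>'"
proof -
  have c: "continuous_on T f" if "\<And>s. s \<in> I \<Longrightarrow> (f has_vector_derivative f' s) (at s)"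
    for f :: "real \<Rightarrow> 'b::real_normed_vector" and f'
  proof (rule continuous_at_imp_continuous_on, rule ballI)
    fix s assume "s \<in> T"
    then show "isCont f s" using that T_sub has_vector_derivative_continuous by blast
  qed
  show "continuous_on T x" by (rule c[OF x'])
  show "continuous_on T y" by (rule c[OF x''])
  show "continuous_on T t" by (rule c[OF t'[unfolded has_real_derivative_iff_has_vector_derivative]])
  show "continuous_on T \<tau>" by (rule c[OF t''[unfolded has_real_derivative_iff_has_vector_derivative]])
  show "continuous_on T y'" "continuous_on T \<tau>'"
    by (rule continuous_on_subset[OF _ T_sub], rule y'_cont, rule continuous_on_subset[OF _ T_sub], rule \<tau>'_cont)
qed

lemma t_nonzero: "s \<in> T \<Longrightarrow> t s \<noteq> 0"
  using t_pos T_sub by force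

lemma unif_bounded_coeffs:
  "unif_bounded T (\<lambda>s p. a0 s)" "unif_bounded T (\<lambda>s p. a1 s)" "unif_bounded T u1"
  "unif_bounded T c0" "unif_bounded T (\<lambda>s p. c1 s)" "unif_bounded T u2"
  "unif_bounded T J" "unif_bounded T J1" "unif_bounded T J2"
  "unif_bounded T (\<lambda>s p. X 0 p - Z s p)" "unif_bounded T (\<lambda>s p. exp (- n / 2 * ln (4 * pi * t s)))"
  "unif_bounded T (\<lambda>s p. t s)"
proof -
  note scal = unif_bounded_continuous[OF T_compact]
  have Kc: "closed K" using K by (rule compact_imp_closed)
  have off: "X s p = X 0 p" "V' s p = 0" "J s p = 1" "J1 s p = 0" "J2 s p = 0"
    if "s \<in> I" "p \<notin> K" for s p
    by (rule off_support[OF Kc _ that], rule support, assumption+)+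
  note cc = unif_bounded_variation[OF jointly_continuous_variation(2)]
    unif_bounded_variation[OF jointly_continuous_variation(3)]
    unif_bounded_variation[OF jointly_continuous_variation(4)]
    unif_bounded_variation[OF jointly_continuous_variation(5)]
    unif_bounded_variation[OF jointly_continuous_variation(6)]
  have V: "unif_bounded T V" by (rule cc(1)) (simp add: support)
  have Va: "unif_bounded T V'" using off(2) by (intro cc(2)) auto
  show "unif_bounded T J" using off(3) by (intro cc(3)) auto
  show "unif_bounded T J1" using off(4) by (intro cc(4)) auto
  show "unif_bounded T J2" using off(5) by (intro cc(5)) auto
  have Zv: "unif_bounded T Zv" and Za: "unif_bounded T Za"
    unfolding Zv_def[abs_def] Za_def[abs_def] by (intro unif_bounded_diff V Va scal continuous_T)+
  have cr: "continuous_on T r"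
    unfolding r_def[abs_def] by (intro continuous_intros continuous_T) (simp add: t_nonzero)
  have r: "unif_bounded T (\<lambda>s p. - r s / 2)"
    by (intro scal continuous_intros cr; simp)
  show "unif_bounded T (\<lambda>s p. a0 s)" "unif_bounded T (\<lambda>s p. a1 s)" "unif_bounded T (\<lambda>s p. c1 s)"
    unfolding a0_def a1_def c1_def by (intro scal continuous_intros continuous_T cr; simp)+
  show u1: "unif_bounded T u1"
    unfolding u1_def[abs_def] by (intro unif_bounded_scaleR r Zv)
  have "unif_bounded T (\<lambda>s p. \<tau> s * (r s)\<^sup>2)"
    by (intro scal continuous_intros continuous_T cr; simp)
  then show "unif_bounded T u2"
    unfolding u2_def[abs_def] by (intro unif_bounded_add unif_bounded_scaleR r Zv Za)
  have "unif_bounded T (\<lambda>s p. - n / 2 * (\<tau>' s * r s - (\<tau> s * r s)\<^sup>2))"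
    by (intro scal continuous_intros continuous_T cr; simp)
  then show "unif_bounded T c0"
    unfolding c0_def[abs_def] by (intro unif_bounded_add unif_bounded_inner Zv u1)
  show "unif_bounded T (\<lambda>s p. exp (- n / 2 * ln (4 * pi * t s)))"
    using t_pos T_sub by (intro scal continuous_intros continuous_T) (auto dest: t_nonzero)
  show "unif_bounded T (\<lambda>s p. t s)" by (intro scal continuous_T)
  have X0: "jointly_continuous (\<lambda>s. X 0)"
    unfolding jointly_continuous_def
  proof clarify
    fix D \<phi> assume c: "(D, \<phi>) \<in> A"
    have "continuous_on D (\<lambda>u. X 0 (\<phi> u))"
      using smooth_on_continuous[OF immersed_manifold.smooth_X[OF immersed_manifold[OF zero_in_I] c]]
      by (simp add: o_def)
    then show "continuous_on (I \<times> D) (\<lambda>(s, u). X 0 (\<phi> u))"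
      unfolding split_beta by (rule continuous_on_compose2) (auto intro: continuous_intros)
  qed
  \<comment> \<open>\<open>X\<close> itself may be unbounded, but its displacement from
    \<open>X 0\<close> vanishes off \<open>K\<close>. So \<open>Z\<close> stays within bounded
    distance of \<open>X 0\<close>, which makes domination by a fixed Gaussian possible.\<close>
  have "jointly_continuous (\<lambda>s p. X 0 p - X s p)"
    using X0 jointly_continuous_variation(1) unfolding jointly_continuous_def split_beta
    by (auto intro!: continuous_on_diff)
  then have "unif_bounded T (\<lambda>s p. X 0 p - X s p)"
  proof (rule unif_bounded_variation)
    show "norm (X 0 p - X s p) \<le> 1" if "s \<in> I" "p \<notin> K" for s p
      using off(1)[OF that] by simp
  qed
  then have "unif_bounded T (\<lambda>s p. (X 0 p - X s p) + x s)"
    by (intro unif_bounded_add scal continuous_T)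
  then show "unif_bounded T (\<lambda>s p. X 0 p - Z s p)"
    by (simp add: Z_def algebra_simps)
qed

lemma G_bounds:
  "\<exists>C c. c > 0 \<and> (\<forall>s\<in>T. \<forall>p. \<bar>G s p\<bar> \<le> C * exp (- c * (norm (X 0 p))\<^sup>2) \<and>
    \<bar>G1 s p\<bar> \<le> C * exp (- c * (norm (X 0 p))\<^sup>2) \<and> \<bar>G2 s p\<bar> \<le> C * exp (- c * (norm (X 0 p))\<^sup>2))"
proof -
  have "\<exists>M\<ge>1. \<forall>k\<in>set [\<lambda>s p. norm (a0 s), \<lambda>s p. norm (a1 s), \<lambda>s p. norm (u1 s p), \<lambda>s p. norm (c0 s p),
      \<lambda>s p. norm (c1 s), \<lambda>s p. norm (u2 s p), \<lambda>s p. norm (J s p), \<lambda>s p. norm (J1 s p), \<lambda>s p. norm (J2 s p),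
      \<lambda>s p. norm (X 0 p - Z s p), \<lambda>s p. norm (exp (- n / 2 * ln (4 * pi * t s))), \<lambda>s p. norm (t s)].
      \<forall>s\<in>T. \<forall>p. \<bar>k s p\<bar> \<le> M"
    by (rule unif_bounded_list) (simp only: list.set ball_simps simp_thms unif_bounded_norm unif_bounded_coeffs)
  then obtain M where M1: "M \<ge> 1"
    and M: "\<forall>s\<in>T. \<forall>p. \<bar>a0 s\<bar> \<le> M" "\<forall>s\<in>T. \<forall>p. \<bar>a1 s\<bar> \<le> M" "\<forall>s\<in>T. \<forall>p. norm (u1 s p) \<le> M"
      "\<forall>s\<in>T. \<forall>p. \<bar>c0 s p\<bar> \<le> M" "\<forall>s\<in>T. \<forall>p. \<bar>c1 s\<bar> \<le> M" "\<forall>s\<in>T. \<forall>p. norm (u2 s p) \<le> M"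
      "\<forall>s\<in>T. \<forall>p. \<bar>J s p\<bar> \<le> M" "\<forall>s\<in>T. \<forall>p. \<bar>J1 s p\<bar> \<le> M" "\<forall>s\<in>T. \<forall>p. \<bar>J2 s p\<bar> \<le> M"
      "\<forall>s\<in>T. \<forall>p. norm (X 0 p - Z s p) \<le> M" "\<forall>s\<in>T. exp (- n / 2 * ln (4 * pi * t s)) \<le> M"
      "\<forall>s\<in>T. \<bar>t s\<bar> \<le> M"
    by auto
  \<comment> \<open>As \<open>t s \<le> M\<close> on \<open>T\<close>, this is a lower bound for the
    coefficient \<open>r s / 4\<close> in the exponent of the weight.\<close>
  define c where "c = 1 / (4 * M)"
  have c: "c > 0" using M1 by (simp add: c_def)
  \<comment> \<open>The factors are, in order: the weight times the polynomial factor, the constant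
    of \<open>gaussian_polynomial_bound\<close>, and the price of recentring the Gaussian from
    \<open>Z s p\<close> to \<open>X 0 p\<close>.\<close>
  define C where "C = 16 * M ^ 4 * (8 / c\<^sup>2 * exp (c / 2)) * exp (c / 2 * M\<^sup>2)"
  \<comment> \<open>The rate \<open>c\<close> is halved twice: once to absorb the polynomial factor
    and once to recentre.\<close>
  have "\<bar>G s p\<bar> \<le> C * exp (- (c / 4) * (norm (X 0 p))\<^sup>2) \<and>
    \<bar>G1 s p\<bar> \<le> C * exp (- (c / 4) * (norm (X 0 p))\<^sup>2) \<and> \<bar>G2 s p\<bar> \<le> C * exp (- (c / 4) * (norm (X 0 p))\<^sup>2)"
    if s: "s \<in> T" for s p
  proof -
    define z where "z = (norm (Z s p))\<^sup>2"
    have z: "z \<ge> 0" "Z s p \<bullet> Z s p = z" by (simp_all add: z_def power2_norm_eq_inner)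
    have le: "\<bar>a0 s\<bar> \<le> M" "\<bar>a1 s\<bar> \<le> M" "norm (u1 s p) \<le> M" "\<bar>c0 s p\<bar> \<le> M" "\<bar>c1 s\<bar> \<le> M"
      "norm (u2 s p) \<le> M" "\<bar>J s p\<bar> \<le> M" "\<bar>J1 s p\<bar> \<le> M" "\<bar>J2 s p\<bar> \<le> M" "norm (X 0 p - Z s p) \<le> M"
      "exp (- n / 2 * ln (4 * pi * t s)) \<le> M" "t s \<le> M"
      using M s by auto
    have nZ: "norm (Z s p) \<le> 1 + z"
    proof -
      have "0 \<le> (norm (Z s p) - 1 / 2)\<^sup>2" by simp
      then show ?thesis by (simp add: z_def power2_eq_square algebra_simps)
    qed
    have ip: "\<bar>Z s p \<bullet> u\<bar> \<le> (1 + z) * M" if "norm u \<le> M" for u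
      using nZ that z by (intro order_trans[OF Cauchy_Schwarz_ineq2] mult_mono) auto
    \<comment> \<open>An expression of the form of \<open>b1\<close> or \<open>b2\<close> is at most
      \<open>M + M * z + (1 + z) * M\<close>, because \<open>norm (Z s p)\<close> is at most
      \<open>1 + z\<close>.\<close>
    define \<beta> where "\<beta> = 2 * M * (1 + z)"
    have aff: "\<bar>A0 + A1 * z + B0\<bar> \<le> \<beta>" if "\<bar>A0\<bar> \<le> M" "\<bar>A1\<bar> \<le> M" "\<bar>B0\<bar> \<le> (1 + z) * M" for A0 A1 B0
    proof -
      have "\<bar>A1 * z\<bar> \<le> M * z" using that z by (simp add: abs_mult mult_right_mono)
      then show ?thesis using that unfolding \<beta>_def by (simp add: algebra_simps)
    qed
    have b1: "\<bar>b1 s p\<bar> \<le> \<beta>" and b2: "\<bar>b2 s p\<bar> \<le> \<beta>"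
      unfolding b1_def b2_def z(2) by (intro aff le ip)+
    have \<beta>: "\<beta> \<ge> 0" using M1 z by (simp add: \<beta>_def)
    have "\<beta> + 2 \<le> 4 * M * (1 + z)"
    proof -
      have "1 * 1 \<le> M * (1 + z)" using M1 z by (intro mult_mono) auto
      then show ?thesis by (simp add: \<beta>_def)
    qed
    then have \<beta>2: "(\<beta> + 2)\<^sup>2 \<le> (4 * M * (1 + z))\<^sup>2" using \<beta> by (intro power_mono) auto
    have E: "exp (b s p) \<le> M * exp (- c * z)"
    proof -
      have tp: "t s > 0" using t_pos s T_sub by blast
      have "c \<le> r s / 4"
        using le(12) tp M1 by (simp add: c_def r_def field_simps)
      then have "c * z \<le> r s / 4 * z" using z(1) by (rule mult_right_mono)
      then have "exp (- (r s / 4 * z)) \<le> exp (- c * z)" by simp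
      then have "exp (- n / 2 * ln (4 * pi * t s)) * exp (- (r s / 4 * z)) \<le> M * exp (- c * z)"
        using le(11) M1 by (intro mult_mono) auto
      also have "exp (- n / 2 * ln (4 * pi * t s)) * exp (- (r s / 4 * z)) = exp (b s p)"
        unfolding exp_add[symmetric] by (simp add: b_def z)
      finally show ?thesis .
    qed
    \<comment> \<open>A common form for all three estimates: besides \<open>exp (b s p)\<close> each
      of \<open>G\<close>, \<open>G1\<close>, \<open>G2\<close> has a factor bounded by
      \<open>M\<close> times a polynomial in \<open>\<beta>\<close> of degree at most two, whose
      coefficients do not exceed those of \<open>(\<beta> + 2)^2\<close>.\<close>
    have final: "\<bar>exp (b s p) * P\<bar> \<le> C * exp (- (c / 4) * (norm (X 0 p))\<^sup>2)" if P: "\<bar>P\<bar> \<le> M * (\<beta> + 2)\<^sup>2" for P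
    proof -
      have "\<bar>exp (b s p) * P\<bar> \<le> (M * exp (- c * z)) * (M * (4 * M * (1 + z))\<^sup>2)"
        unfolding abs_mult using E P \<beta>2 M1
        by (intro mult_mono) (auto intro: order_trans[OF P] mult_left_mono)
      also have "\<dots> = 16 * M ^ 4 * ((1 + z)\<^sup>2 * exp (- c * z))"
        by (simp add: power_mult_distrib power2_eq_square[of M] power4_eq_xxxx)
      also have "\<dots> \<le> 16 * M ^ 4 * (8 / c\<^sup>2 * exp (c / 2) * exp (- c / 2 * z))"
        using gaussian_polynomial_bound[OF c z(1)] M1 by (intro mult_left_mono) auto
      also have "\<dots> \<le> 16 * M ^ 4 * (8 / c\<^sup>2 * exp (c / 2) * (exp (c / 2 * M\<^sup>2) * exp (- (c / 4) * (norm (X 0 p))\<^sup>2)))"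
      proof -
        have "(norm (X 0 p - Z s p))\<^sup>2 \<le> M\<^sup>2" using le(10) by (intro power_mono) auto
        then have "(norm (X 0 p))\<^sup>2 / 2 - M\<^sup>2 \<le> z"
          using norm_sq_half_le[of "X 0 p" "Z s p"] by (simp add: z_def)
        then have "c / 2 * ((norm (X 0 p))\<^sup>2 / 2 - M\<^sup>2) \<le> c / 2 * z" using c by (intro mult_left_mono) auto
        then have "exp (- c / 2 * z) \<le> exp (c / 2 * M\<^sup>2 + - (c / 4) * (norm (X 0 p))\<^sup>2)"
          by (simp add: algebra_simps)
        then show ?thesis unfolding exp_add using c M1 by (intro mult_left_mono) auto
      qed
      also have "\<dots> = C * exp (- (c / 4) * (norm (X 0 p))\<^sup>2)"
        by (simp add: C_def mult_ac)
      finally show ?thesis .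
    qed
    have sq: "(\<beta> + 2)\<^sup>2 = \<beta>\<^sup>2 + 4 * \<beta> + 4" by (simp add: power2_eq_square algebra_simps)
    have mul: "\<bar>q * j\<bar> \<le> r * M" if "\<bar>q\<bar> \<le> r" "\<bar>j\<bar> \<le> M" for q j r
      using that by (simp add: abs_mult mult_mono)
    have "\<bar>J s p\<bar> \<le> M * (\<beta> + 2)\<^sup>2"
    proof -
      have "M * 1 \<le> M * (\<beta> + 2)\<^sup>2" using M1 \<beta> unfolding sq by (intro mult_left_mono) auto
      then show ?thesis using le(7) by linarith
    qed
    moreover have "\<bar>b1 s p * J s p + J1 s p\<bar> \<le> M * (\<beta> + 2)\<^sup>2"
    proof -
      have "\<bar>b1 s p * J s p + J1 s p\<bar> \<le> \<beta> * M + M"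
        using mul[OF b1 le(7)] le(8) by linarith
      also have "\<dots> = M * (\<beta> + 1)" by (simp add: algebra_simps)
      also have "\<dots> \<le> M * (\<beta> + 2)\<^sup>2" using M1 \<beta> unfolding sq by (intro mult_left_mono) auto
      finally show ?thesis .
    qed
    moreover have "\<bar>((b1 s p)\<^sup>2 + b2 s p) * J s p + 2 * b1 s p * J1 s p + J2 s p\<bar> \<le> M * (\<beta> + 2)\<^sup>2"
    proof -
      have "(b1 s p)\<^sup>2 \<le> \<beta>\<^sup>2" using b1 by (metis abs_le_square_iff abs_of_nonneg \<beta>)
      then have "\<bar>(b1 s p)\<^sup>2 + b2 s p\<bar> \<le> \<beta>\<^sup>2 + \<beta>" using b2 zero_le_power2[of "b1 s p"] by linarith
      from mul[OF this le(7)] have "\<bar>((b1 s p)\<^sup>2 + b2 s p) * J s p\<bar> \<le> (\<beta>\<^sup>2 + \<beta>) * M" .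
      moreover have "\<bar>2 * b1 s p * J1 s p\<bar> \<le> 2 * \<beta> * M" using b1 by (intro mul le) simp
      ultimately have "\<bar>((b1 s p)\<^sup>2 + b2 s p) * J s p + 2 * b1 s p * J1 s p + J2 s p\<bar>
          \<le> (\<beta>\<^sup>2 + \<beta>) * M + 2 * \<beta> * M + M"
        using le(9) by linarith
      also have "\<dots> = M * (\<beta>\<^sup>2 + 3 * \<beta> + 1)" by (simp add: algebra_simps)
      also have "\<dots> \<le> M * (\<beta> + 2)\<^sup>2" using M1 \<beta> unfolding sq by (intro mult_left_mono) auto
      finally show ?thesis .
    qed
    ultimately show ?thesis unfolding G_def G1_def G2_def by (blast intro: final)
  qed
  then show ?thesis using c by (intro exI[of _ C] exI[of _ "c / 4"]) auto
qed

section \<open>Differentiating the F-functional twice under the integral\<close>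

abbreviation \<mu> where "\<mu> \<equiv> volume_measure A (X 0)"

lemma measurable_mu: "borel_measurable \<mu> = borel_measurable borel" and space_mu: "space \<mu> = UNIV"
  using immersed_manifold.measurable_volume_measure[OF immersed_manifold[OF zero_in_I]]
    immersed_manifold.space_volume_measure[OF immersed_manifold[OF zero_in_I]] by auto

lemma integrable_gaussian_mu:
  assumes "c > 0"
  shows "integrable \<mu> (\<lambda>p. exp (- c * (norm (X 0 p))\<^sup>2))"
proof -
  obtain C1 C2 k where gr: "\<And>r. r \<ge> 0 \<Longrightarrow> emeasure \<mu> (X 0 -` ball 0 r) \<le> ennreal (C1 * r ^ k + C2)"
    using growth unfolding polynomial_volume_growth_def by blast
  have X0: "X 0 \<in> borel_measurable borel" by (rule measurable_variation(1)[OF zero_in_I])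
  show ?thesis
  proof (rule integrable_gaussian[OF _ assms])
    show "(\<lambda>p. norm (X 0 p)) \<in> borel_measurable \<mu>" unfolding measurable_mu using X0 by measurable
    have "{p \<in> space \<mu>. norm (X 0 p) < r} = X 0 -` ball 0 r" for r
      by (auto simp: space_mu)
    then show "emeasure \<mu> {p \<in> space \<mu>. norm (X 0 p) < r} \<le> ennreal (C1 * r ^ k + C2)" if "r \<ge> 0" for r
      using gr[OF that] by simp
  qed
qed

lemma F_functional_eq:
  assumes s: "s \<in> I"
  shows "F_functional A (X s) (x s) (t s) = (\<integral>p. G s p \<partial>\<mu>)"
proof -
  have tp: "t s > 0" by (rule t_pos[OF s])
  note [measurable] = measurable_variation[OF s]
  have "(\<integral>p. exp (- (norm (X s p - x s))\<^sup>2 / (4 * t s)) \<partial>volume_measure A (X s))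
      = (\<integral>p. J s p *\<^sub>R exp (- (norm (X s p - x s))\<^sup>2 / (4 * t s)) \<partial>\<mu>)"
    unfolding volume_measure_variation[OF s]
  proof (rule integral_density)
    show "(\<lambda>p. exp (- (norm (X s p - x s))\<^sup>2 / (4 * t s))) \<in> borel_measurable \<mu>" "J s \<in> borel_measurable \<mu>"
      unfolding measurable_mu by measurable
  qed (use J_pos[OF s] in \<open>auto intro: less_imp_le\<close>)
  moreover have "G s p = (4 * pi * t s) powr (- n / 2) * (J s p *\<^sub>R exp (- (norm (X s p - x s))\<^sup>2 / (4 * t s)))" for p
  proof -
    have "b s p = - n / 2 * ln (4 * pi * t s) + - (norm (X s p - x s))\<^sup>2 / (4 * t s)"
      by (simp add: b_def r_def Z_def power2_norm_eq_inner)
    then have "exp (b s p) = (4 * pi * t s) powr (- n / 2) * exp (- (norm (X s p - x s))\<^sup>2 / (4 * t s))"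
      using tp by (simp only: exp_add) (simp add: powr_def)
    then show ?thesis by (simp add: G_def)
  qed
  ultimately show ?thesis
    by (simp add: F_functional_def n_def)
qed

text \<open>Dominated differentiation is applied first to \<open>G\<close> and then to
  \<open>G1\<close>. The first derivative is needed at all times of an open interval, since the
  second is the derivative of \<open>deriv F\<close> at 0.\<close>

lemma F_derivatives:
  defines "F \<equiv> \<lambda>s. F_functional A (X s) (x s) (t s)"
  shows "\<forall>\<^sub>F s in nhds 0. F differentiable (at s)" "integrable \<mu> (G2 0)"
    "(deriv F has_real_derivative (\<integral>p. G2 0 p \<partial>\<mu>)) (at 0)"
proof -
  obtain C c where c: "c > 0" and B: "\<And>s p. s \<in> T \<Longrightarrow> \<bar>G s p\<bar> \<le> C * exp (- c * (norm (X 0 p))\<^sup>2)"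
    "\<And>s p. s \<in> T \<Longrightarrow> \<bar>G1 s p\<bar> \<le> C * exp (- c * (norm (X 0 p))\<^sup>2)"
    "\<And>s p. s \<in> T \<Longrightarrow> \<bar>G2 s p\<bar> \<le> C * exp (- c * (norm (X 0 p))\<^sup>2)"
    using G_bounds by blast
  let ?B = "\<lambda>p. C * exp (- c * (norm (X 0 p))\<^sup>2)"
  let ?S = "{- (\<epsilon> / 2)<..<\<epsilon> / 2}"
  have iB: "integrable \<mu> ?B" by (intro integrable_mult_right integrable_gaussian_mu c)
  have ST: "?S \<subseteq> T" by (auto simp: T_def)
  have S0: "0 \<in> ?S" using eps by simp
  have SI: "?S \<subseteq> I" using ST T_sub by blast
  have int: "integrable \<mu> f" if "f \<in> borel_measurable borel" "\<And>p. \<bar>f p\<bar> \<le> ?B p" for f :: "'p \<Rightarrow> real"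
    by (rule Bochner_Integration.integrable_bound[OF iB])
      (use that in \<open>auto simp: measurable_mu intro: order_trans[OF _ abs_ge_self]\<close>)
  have ints: "integrable \<mu> (G s)" "integrable \<mu> (G1 s)" "integrable \<mu> (G2 s)" if "s \<in> ?S" for s
    using measurable_G[of s] B[of s] that ST SI by (auto intro!: int)
  have dF: "(F has_real_derivative (\<integral>p. G1 s p \<partial>\<mu>)) (at s)" if s: "s \<in> ?S" for s
  proof (rule has_field_derivative_transform_within_open[OF _ open_greaterThanLessThan s])
    show "((\<lambda>s. \<integral>p. G s p \<partial>\<mu>) has_real_derivative (\<integral>p. G1 s p \<partial>\<mu>)) (at s)"
      by (rule has_real_derivative_integral[OF open_greaterThanLessThan _ s ints(1) _ _ iB])
        (use G_deriv B(2) ST SI measurable_G[of s] s in \<open>auto simp: measurable_mu\<close>)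
  qed (use F_functional_eq SI in \<open>auto simp: F_def\<close>)
  have dG1: "((\<lambda>s. \<integral>p. G1 s p \<partial>\<mu>) has_real_derivative (\<integral>p. G2 0 p \<partial>\<mu>)) (at 0)"
    by (rule has_real_derivative_integral[OF open_greaterThanLessThan _ S0 ints(2) _ _ iB])
      (use G1_deriv B(3) ST SI measurable_G[OF zero_in_I] in \<open>auto simp: measurable_mu\<close>)
  show "\<forall>\<^sub>F s in nhds 0. F differentiable (at s)"
    using eventually_nhds_in_open[OF open_greaterThanLessThan S0]
    by eventually_elim (use dF differentiableI has_field_derivative_imp_has_derivative in blast)
  show "integrable \<mu> (G2 0)" by (rule ints(3)[OF S0])
  show "(deriv F has_real_derivative (\<integral>p. G2 0 p \<partial>\<mu>)) (at 0)"
    by (rule has_field_derivative_transform_within_open[OF dG1 open_greaterThanLessThan S0])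
      (rule DERIV_imp_deriv[OF dF, symmetric])
qed

section \<open>Identification of the integrand at \<open>s = 0\<close>\<close>

definition Q :: "'p \<Rightarrow> real" where
  "Q = (\<lambda>p.
           let Z = X 0 p - x 0; v = V 0 p; H = mean_curv A (X 0) p;
               DVV = normal_proj A (X 0) p (vector_derivative (\<lambda>s. V s p) (at 0))
           in exp (- (norm Z)\<^sup>2 / (4 * t 0)) *
              (- (v \<bullet> L_perp A (X 0) (x 0) (t 0) (V 0) p)
               + (Z \<bullet> v) / (t 0)\<^sup>2 * \<tau> 0
               + (v \<bullet> y 0) / t 0
               - ((norm Z)\<^sup>2 - real CARD('n) * t 0) * (\<tau> 0)\<^sup>2 / (2 * t 0 ^ 3)
               - (norm (y 0))\<^sup>2 / (2 * t 0)
               - \<tau> 0 * (Z \<bullet> y 0) / (t 0)\<^sup>2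
               + (- (v \<bullet> (H + (1 / (2 * t 0)) *\<^sub>R Z))
                  + \<tau> 0 * ((norm Z)\<^sup>2 / (4 * (t 0)\<^sup>2) - real CARD('n) / (2 * t 0))
                  + ((1 / (2 * t 0)) *\<^sub>R Z) \<bullet> y 0)\<^sup>2
               - DVV \<bullet> (H + (1 / (2 * t 0)) *\<^sub>R Z)
               + \<tau>' 0 * ((norm Z)\<^sup>2 / (4 * (t 0)\<^sup>2) - real CARD('n) / (2 * t 0))
               + (Z \<bullet> y' 0) / (2 * t 0)))"

text \<open>With \<open>J = 1\<close>, the mixed term and the square of \<open>v \<bullet> H\<close>
  in \<open>J2\<close> complete the square of \<open>b1\<close>; what remains is linear in second
  order quantities.\<close>

lemma G2_at_0: "G2 0 p = 1 / sqrt (4 * pi * t 0) ^ CARD('n) * Q p"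
proof -
  define v z where "v = V 0 p" and "z = Z 0 p"
  define t0 where "t0 = t 0"
  define H where "H = mean_curv A (X 0) p"
  define N where "N = normal_proj A (X 0) p (V' 0 p)"
  define L where "L = L_perp A (X 0) (x 0) t0 (V 0) p"
  have tp: "t0 > 0" using t_pos[OF zero_in_I] by (simp add: t0_def)
  have e: "exp (b 0 p) = 1 / sqrt (4 * pi * t0) ^ CARD('n) * exp (- (norm z)\<^sup>2 / (4 * t0))"
  proof -
    have "sqrt (4 * pi * t0) ^ CARD('n) = exp (n * ln (sqrt (4 * pi * t0)))"
      using tp by (simp add: n_def exp_of_nat_mult)
    also have "\<dots> = exp (n / 2 * ln (4 * pi * t0))"
      using tp by (subst ln_sqrt) auto
    finally have sq: "sqrt (4 * pi * t0) ^ CARD('n) = exp (n / 2 * ln (4 * pi * t0))" .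
    have "1 / sqrt (4 * pi * t0) ^ CARD('n) = exp (- (n / 2 * ln (4 * pi * t0)))"
      by (simp only: sq exp_minus inverse_eq_divide)
    also have "- (n / 2 * ln (4 * pi * t0)) = - n / 2 * ln (4 * pi * t0)" by simp
    finally have "1 / sqrt (4 * pi * t0) ^ CARD('n) = exp (- n / 2 * ln (4 * pi * t0))" .
    moreover have "b 0 p = - n / 2 * ln (4 * pi * t0) + - (norm z)\<^sup>2 / (4 * t0)"
      by (simp add: b_def r_def t0_def z_def power2_norm_eq_inner)
    ultimately show ?thesis by (simp only: exp_add)
  qed
  \<comment> \<open>The derivative of \<open><V, H>\<close> in \<open>s\<close>; with a minus sign
    it is the second logarithmic derivative of the area ratio.\<close>
  define R where "R = v \<bullet> L - (v \<bullet> v) / (2 * t0) - (V' 0 p \<bullet> z - N \<bullet> z) / (2 * t0) + N \<bullet> H"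
  have J1: "J1 0 p = - (v \<bullet> H)" and J2: "J2 0 p = (v \<bullet> H)\<^sup>2 - R"
    using variation_formulas(1)[of p] variation_formulas(2)[of p "x 0" t0]
    by (simp_all add: v_def H_def N_def L_def R_def z_def Z_def)
  define \<omega> where "\<omega> = - (v \<bullet> (H + (1 / (2 * t0)) *\<^sub>R z))
    + \<tau> 0 * ((norm z)\<^sup>2 / (4 * t0\<^sup>2) - n / (2 * t0)) + ((1 / (2 * t0)) *\<^sub>R z) \<bullet> y 0"
  \<comment> \<open>\<open>\<omega>\<close> is the first logarithmic derivative of
    \<open>exp b * J\<close>, the bracket that appears squared in the theorem.\<close>
  have w: "b1 0 p - v \<bullet> H = \<omega>"
    unfolding b1_def a0_def a1_def u1_def Zv_def r_def \<omega>_def v_def[symmetric] t0_def[symmetric]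
      z_def[symmetric] power2_norm_eq_inner
    using tp by (simp add: inner_add_right inner_diff_right inner_commute field_simps power2_eq_square)
  \<comment> \<open>Two cancellations: the squared norm of \<open>v\<close> in \<open>c0\<close>
    against the one in \<open>R\<close>, and the tangential part of \<open>V' 0 p\<close> paired
    with \<open>z\<close> in \<open>u2\<close> against the one in \<open>R\<close>. Only the normal
    acceleration \<open>N\<close> survives.\<close>
  have r: "b2 0 p - R = - (v \<bullet> L) + (z \<bullet> v) / t0\<^sup>2 * \<tau> 0 + (v \<bullet> y 0) / t0
     - ((norm z)\<^sup>2 - n * t0) * (\<tau> 0)\<^sup>2 / (2 * t0 ^ 3) - (norm (y 0))\<^sup>2 / (2 * t0)
     - \<tau> 0 * (z \<bullet> y 0) / t0\<^sup>2 - N \<bullet> (H + (1 / (2 * t0)) *\<^sub>R z)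
     + \<tau>' 0 * ((norm z)\<^sup>2 / (4 * t0\<^sup>2) - n / (2 * t0)) + (z \<bullet> y' 0) / (2 * t0)"
    unfolding b2_def c0_def c1_def u1_def u2_def Zv_def Za_def r_def R_def v_def[symmetric] t0_def[symmetric]
      z_def[symmetric] power2_norm_eq_inner
    using tp by (simp add: inner_add_right inner_diff_right inner_diff_left inner_commute
        field_simps power2_eq_square power3_eq_cube)
  have "((b1 0 p)\<^sup>2 + b2 0 p) * J 0 p + 2 * b1 0 p * J1 0 p + J2 0 p = (b1 0 p - v \<bullet> H)\<^sup>2 + (b2 0 p - R)"
    by (simp add: J_0 J1 J2 power2_eq_square algebra_simps)
  moreover have "Q p = exp (- (norm z)\<^sup>2 / (4 * t0)) * (\<omega>\<^sup>2 + (b2 0 p - R))"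
    unfolding r \<omega>_def Q_def Let_def Z_def[symmetric] V'_def[symmetric]
    by (simp add: v_def z_def t0_def H_def N_def L_def n_def)
  ultimately show ?thesis
    unfolding G2_def e w by (simp add: t0_def)
qed

lemma Q_facts:
  "integrable \<mu> Q"
  "(\<integral>p. G2 0 p \<partial>\<mu>) = 1 / sqrt (4 * pi * t 0) ^ CARD('n) * (\<integral>p. Q p \<partial>\<mu>)"
proof -
  let ?c = "1 / sqrt (4 * pi * t 0) ^ CARD('n)"
  have c: "?c \<noteq> 0" using t_pos[OF zero_in_I] by simp
  have G2: "G2 0 = (\<lambda>p. ?c * Q p)" by (rule ext) (rule G2_at_0)
  show "integrable \<mu> Q"
  proof -
    have "integrable \<mu> (\<lambda>p. inverse ?c * G2 0 p)"
      by (rule integrable_mult_right[OF F_derivatives(2)])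
    moreover have "(\<lambda>p. inverse ?c * G2 0 p) = Q"
      by (simp only: G2 mult.assoc[symmetric] left_inverse[OF c] mult_1_left)
    ultimately show ?thesis by (simp only:)
  qed
  show "(\<integral>p. G2 0 p \<partial>\<mu>) = ?c * (\<integral>p. Q p \<partial>\<mu>)"
    unfolding G2 by (rule integral_mult_right_zero)
qed

end

text \<open>\<open>deriv\<close> and the Lebesgue integral are total, so their values alone would
  not guarantee that the derivative or the integral exists. Differentiability near 0 and
  integrability of the integrand are therefore part of the conclusion.\<close>

theorem theorem2:
  fixes A :: "('n::finite, 'p::{t2_space, second_countable_topology}) chart set"
    and X V :: "real \<Rightarrow> 'p \<Rightarrow> real^'m::finite"
    and x y y' :: "real \<Rightarrow> real^'m"
    and t \<tau> \<tau>' :: "real \<Rightarrow> real"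
    and \<epsilon> :: real
  assumes atlas: "smooth_atlas A"
    and complete: "complete_immersion (X 0)"
    and growth: "polynomial_volume_growth A (X 0)"
    and eps: "\<epsilon> > 0"
    and variation: "normal_variation A {-\<epsilon><..<\<epsilon>} X V"
    and support: "\<exists>K. compact K \<and> (\<forall>s\<in>{-\<epsilon><..<\<epsilon>}. \<forall>p. p \<notin> K \<longrightarrow> V s p = 0)"
    and x': "\<And>s. s \<in> {-\<epsilon><..<\<epsilon>} \<Longrightarrow> (x has_vector_derivative y s) (at s)"
    and x'': "\<And>s. s \<in> {-\<epsilon><..<\<epsilon>} \<Longrightarrow> (y has_vector_derivative y' s) (at s)"
    and x''_cont: "continuous_on {-\<epsilon><..<\<epsilon>} y'"
    and t_pos: "\<And>s. s \<in> {-\<epsilon><..<\<epsilon>} \<Longrightarrow> t s > 0"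
    and t': "\<And>s. s \<in> {-\<epsilon><..<\<epsilon>} \<Longrightarrow> (t has_real_derivative \<tau> s) (at s)"
    and t'': "\<And>s. s \<in> {-\<epsilon><..<\<epsilon>} \<Longrightarrow> (\<tau> has_real_derivative \<tau>' s) (at s)"
    and t''_cont: "continuous_on {-\<epsilon><..<\<epsilon>} \<tau>'"
  shows
    "let n = real CARD('n); F = (\<lambda>s. F_functional A (X s) (x s) (t s));
         x0 = x 0; t0 = t 0; \<mu> = volume_measure A (X 0);
         Q = (\<lambda>p.
           let Z = X 0 p - x0; v = V 0 p; H = mean_curv A (X 0) p;
               DVV = normal_proj A (X 0) p (vector_derivative (\<lambda>s. V s p) (at 0))
           in exp (- (norm Z)\<^sup>2 / (4 * t0)) *
              (- (v \<bullet> L_perp A (X 0) x0 t0 (V 0) p)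
               + (Z \<bullet> v) / t0\<^sup>2 * \<tau> 0
               + (v \<bullet> y 0) / t0
               - ((norm Z)\<^sup>2 - n * t0) * (\<tau> 0)\<^sup>2 / (2 * t0 ^ 3)
               - (norm (y 0))\<^sup>2 / (2 * t0)
               - \<tau> 0 * (Z \<bullet> y 0) / t0\<^sup>2
               + (- (v \<bullet> (H + (1 / (2 * t0)) *\<^sub>R Z))
                  + \<tau> 0 * ((norm Z)\<^sup>2 / (4 * t0\<^sup>2) - n / (2 * t0))
                  + ((1 / (2 * t0)) *\<^sub>R Z) \<bullet> y 0)\<^sup>2
               - DVV \<bullet> (H + (1 / (2 * t0)) *\<^sub>R Z)
               + \<tau>' 0 * ((norm Z)\<^sup>2 / (4 * t0\<^sup>2) - n / (2 * t0))
               + (Z \<bullet> y' 0) / (2 * t0)))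
     in (\<forall>\<^sub>F s in nhds 0. F differentiable (at s)) \<and>
        integrable \<mu> Q \<and>
        (deriv F has_real_derivative
           1 / sqrt (4 * pi * t0) ^ CARD('n) * (\<integral>p. Q p \<partial>\<mu>)) (at 0)"
proof -
  obtain K where K: "compact K" "\<And>s p. s \<in> {-\<epsilon><..<\<epsilon>} \<Longrightarrow> p \<notin> K \<Longrightarrow> V s p = 0"
    using support by blast
  interpret gaussian_variation A X V \<epsilon> x y y' t \<tau> \<tau>' K
    by unfold_locales (fact atlas eps variation growth K x' x'' x''_cont t_pos t' t'' t''_cont)+
  show ?thesis
    using F_derivatives(1,3) Q_facts unfolding Q_def Let_def by (simp only: simp_thms)
qed

end
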